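(* Let $x^0\in\mathbb{R}^n$ and assume the Kalman condition $\mathrm{rank}(B,AB,\dots,A^{n-1}B)=n$. Let $(v(b))_{b\in\mathcal{T}}$ be the family constructed below. Then there exists $\lambda_0>0$ such that for all $\lambda\in\mathbb{R}$ with $|\lambda|<\lambda_0$, the series $v:=\sum_{b\in\mathcal{T}}\lambda^{|b|}v(b)$ converges in $L^2((0,T),\mathbb{R}^m)$ and the solution $x\in\mathcal{S}$ of $x'=Ax+Bv+\lambda F(x)$, $x(0)=x^0$, satisfies $x(T)=0$.
   Context: Setting: $T>0$, $n,m\in\mathbb{N}^*$, $A\in\mathcal{M}_n(\mathbb{R})$, $B$ a real $n\times m$ matrix with transpose $B^*$. $\mathcal{S}:=\mathcal{C}^0([0,T],\mathbb{R}^n)\cap H^1([0,T],\mathbb{R}^n)$, $\mathcal{I}:=\mathbb{R}^n\times L^2((0,T),\mathbb{R}^n)$ with fixed Banach norms. Hypothesis (H1): $F(x)=\sum_{p\ge2}F_p(x,\dots,x)$ with $F_p:\mathcal{S}^p\to L^2((0,T),\mathbb{R}^n)$ continuous $p$-linear, and $\sum_{p}\|F_p\|z^p$ converges for all $z\in\mathbb{C}$. Adjoint problem $(\mathcal{P}')$: $y\in\mathcal{S}$, $-y'=A^*y$, $y(0)=y^0$. Trees: $\mathcal{T}$ = planar rooted trees (children ordered) in which every internal vertex has $\ge2$ children; $\|b\|$ = number of leaves, $|b|$ = number of internal vertices; $\circ$ = one-vertex tree; $B_+(b_1,\dots,b_r)$ ($r\ge2$) attaches roots of $b_1,\dots,b_r$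 to a new root, every $b\ne\circ$ being uniquely of this form, and then $B_-(b)=b_1\bullet\cdots\bullet b_r$; $E\propto c$ replaces the $i$-th leaf of $c$ by $E_i$. $\Phi(\circ):\mathcal{I}\to\mathcal{S}$, $(x^0,f)\mapsto$ solution of $x'=Ax+f$, $x(0)=x^0$; $\Phi(B_+(b_1,\dots,b_r))(w):=\Phi(\circ)(0,F_r(\Phi(b_1)(w^{(1)}),\dots,\Phi(b_r)(w^{(r)})))$ with $w^{(j)}$ consecutive blocks of lengths $\|b_j\|$. $(\Phi\ast u)(b):=\sum_{c\in\mathcal{T}}\sum_{E\in\mathcal{T}^{\|c\|},E\propto c=b}\Phi(c)(u(E_1),\dots,u(E_{\|c\|}))$ and $F[(\Phi\ast u)(b_1\bullet\cdots\bullet b_r)]:=F_r((\Phi\ast u)(b_1),\dots,(\Phi\ast u)(b_r))$. Construction: recursively on $|b|$, $v(b):=B^*\tilde y(b)$ where $\tilde y(b)$ solves $(\mathcal{P}')$ with initial value a minimizer of $J(b):\mathbb{R}^n\to\mathbb{R}$, with $J(\circ)(y^0)=\frac12\int_0^T|B^*\tilde y|^2dt+\langle x^0,y^0\rangle$ and, for $b\ne\circ$, $J(b)(y^0)=\frac12\int_0^T|B^*\tilde y|^2dt+\int_0^T\langle\tilde y,F[(\Phi\ast u)(B_-(b))]\rangle dt$, $\tilde y$ the solution of $(\mathcal{P}')$ with initial value $y^0$; here $u(\circ):=(x^0,Bv(\circ))$ and $u(c):=(0,Bv(c))$ for $c\ne\circ$.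
   Formalization: "The solution x in S satisfies x(T)=0" is proved as "there is a solution x in S with x(T)=0": under (H1) solutions need not be unique (e.g. n=m=1, A=0, B=1, T=1, F(x)=x(T)^2 has a second solution with x(T)=1/λ); where the solution is unique, the claims agree. *)

theory Defs
  imports "HOL-Analysis.Analysis"
begin

text \<open>Elements of L2((0,T),R^k) are represented by functions real => R^k; only their
 values on [0,T] matter, and L2-equality is equality almost everywhere.\<close>

definition L2 :: "real \<Rightarrow> (real \<Rightarrow> 'a::euclidean_space) \<Rightarrow> bool" where
  "L2 T f \<longleftrightarrow> f \<in> borel_measurable (lebesgue_on {0..T})
      \<and> integrable (lebesgue_on {0..T}) (\<lambda>t. (norm (f t))^2)"

definition l2norm :: "real \<Rightarrow> (real \<Rightarrow> 'a::euclidean_space) \<Rightarrow> real" where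
  "l2norm T f = sqrt (LINT t|lebesgue_on {0..T}. (norm (f t))^2)"

definition ae_eq :: "real \<Rightarrow> (real \<Rightarrow> 'a::euclidean_space) \<Rightarrow> (real \<Rightarrow> 'a) \<Rightarrow> bool" where
  "ae_eq T f g \<longleftrightarrow> (AE t in lebesgue_on {0..T}. f t = g t)"

definition weak_deriv_of :: "real \<Rightarrow> (real \<Rightarrow> 'a::euclidean_space) \<Rightarrow> (real \<Rightarrow> 'a) \<Rightarrow> bool" where
  "weak_deriv_of T x g \<longleftrightarrow> L2 T g \<and> (\<forall>t\<in>{0..T}. x t = x 0 + (LINT s|lebesgue_on {0..t}. g s))"

definition in_S :: "real \<Rightarrow> (real \<Rightarrow> 'a::euclidean_space) \<Rightarrow> bool" where
  "in_S T x \<longleftrightarrow> continuous_on {0..T} x \<and> (\<exists>g. weak_deriv_of T x g)"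

definition S_norm :: "real \<Rightarrow> (real \<Rightarrow> 'a::euclidean_space) \<Rightarrow> real" where
  "S_norm T x = sqrt ((l2norm T x)^2 + (l2norm T (SOME g. weak_deriv_of T x g))^2)"

definition L2_has_sum :: "real \<Rightarrow> ('i \<Rightarrow> real \<Rightarrow> 'a::euclidean_space) \<Rightarrow> 'i set \<Rightarrow> (real \<Rightarrow> 'a) \<Rightarrow> bool" where
  "L2_has_sum T w I s \<longleftrightarrow> L2 T s \<and>
     (\<forall>\<epsilon>>0. \<exists>G0. finite G0 \<and> G0 \<subseteq> I \<and>
        (\<forall>G. finite G \<and> G0 \<subseteq> G \<and> G \<subseteq> I \<longrightarrow> l2norm T (\<lambda>t. (\<Sum>b\<in>G. w b t) - s t) < \<epsilon>))"

definition L2_series_sum_from2 :: "real \<Rightarrow> (nat \<Rightarrow> real \<Rightarrow> 'a::euclidean_space) \<Rightarrow> (real \<Rightarrow> 'a) \<Rightarrow> bool" where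
  "L2_series_sum_from2 T g s \<longleftrightarrow> L2 T s \<and>
     (\<lambda>N. l2norm T (\<lambda>t. (\<Sum>p\<in>{2..N}. g p t) - s t)) \<longlonglongrightarrow> 0"

definition cont_multilinear ::
  "real \<Rightarrow> nat \<Rightarrow> ((real \<Rightarrow> 'a::euclidean_space) list \<Rightarrow> real \<Rightarrow> 'a) \<Rightarrow> bool" where
  "cont_multilinear T p G \<longleftrightarrow>
    (\<forall>xs. length xs = p \<and> (\<forall>x\<in>set xs. in_S T x) \<longrightarrow> L2 T (G xs)) \<and>
    (\<forall>xs i y a b. length xs = p \<and> (\<forall>x\<in>set xs. in_S T x) \<and> i < p \<and> in_S T y \<longrightarrow>
        ae_eq T (G (xs[i := (\<lambda>t. a *\<^sub>R (xs!i) t + b *\<^sub>R y t)]))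
                (\<lambda>t. a *\<^sub>R G xs t + b *\<^sub>R G (xs[i := y]) t)) \<and>
    (\<forall>xs. length xs = p \<and> (\<forall>x\<in>set xs. in_S T x) \<longrightarrow>
       (\<forall>\<epsilon>>0. \<exists>\<delta>>0. \<forall>ys. length ys = p \<and> (\<forall>y\<in>set ys. in_S T y) \<and>
           (\<forall>i<p. S_norm T (\<lambda>t. (ys!i) t - (xs!i) t) < \<delta>) \<longrightarrow>
           l2norm T (\<lambda>t. G ys t - G xs t) < \<epsilon>))"

definition op_norm :: "real \<Rightarrow> nat \<Rightarrow> ((real \<Rightarrow> 'a::euclidean_space) list \<Rightarrow> real \<Rightarrow> 'a) \<Rightarrow> real" where
  "op_norm T p G = Sup {l2norm T (G xs) | xs. length xs = p \<and> (\<forall>x\<in>set xs. in_S T x \<and> S_norm T x \<le> 1)}"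

definition H1 :: "real \<Rightarrow> (nat \<Rightarrow> (real \<Rightarrow> 'a::euclidean_space) list \<Rightarrow> real \<Rightarrow> 'a) \<Rightarrow> bool" where
  "H1 T F \<longleftrightarrow> (\<forall>p\<ge>2. cont_multilinear T p (F p)) \<and>
     (\<forall>z::complex. summable (\<lambda>k. complex_of_real (op_norm T (k+2) (F (k+2))) * z ^ (k+2)))"

fun matpow :: "real^'n^'n \<Rightarrow> nat \<Rightarrow> real^'n^'n" where
  "matpow M 0 = mat 1"
| "matpow M (Suc k) = M ** matpow M k"

text \<open>Rank of the block matrix (B, AB, ..., A^(n-1) B) = dimension of its column space.\<close>
definition kalman_rank :: "real^'n^'n \<Rightarrow> real^'m^'n \<Rightarrow> nat" where
  "kalman_rank A B = dim (\<Union>k<CARD('n). columns (matpow A k ** B))"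

datatype tree = Leaf | Node "tree list"

fun wf_tree :: "tree \<Rightarrow> bool" where
  "wf_tree Leaf = True"
| "wf_tree (Node bs) = (2 \<le> length bs \<and> (\<forall>b\<in>set bs. wf_tree b))"

definition Trees :: "tree set" where "Trees = {b. wf_tree b}"

fun leaves :: "tree \<Rightarrow> nat" where
  "leaves Leaf = 1"
| "leaves (Node bs) = sum_list (map leaves bs)"

fun internal :: "tree \<Rightarrow> nat" where
  "internal Leaf = 0"
| "internal (Node bs) = 1 + sum_list (map internal bs)"

text \<open>Grafting E \<propto> c: the i-th leaf of c (left to right) is replaced by E!i.\<close>
fun graft_aux :: "tree \<Rightarrow> tree list \<Rightarrow> tree \<times> tree list"
and graft_forest :: "tree list \<Rightarrow> tree list \<Rightarrow> tree list \<times> tree list" where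
  "graft_aux Leaf Es = (hd Es, tl Es)"
| "graft_aux (Node bs) Es = (case graft_forest bs Es of (cs, R) \<Rightarrow> (Node cs, R))"
| "graft_forest [] Es = ([], Es)"
| "graft_forest (b # bs) Es = (case graft_aux b Es of (c, R) \<Rightarrow>
      (case graft_forest bs R of (cs, R') \<Rightarrow> (c # cs, R')))"

definition graft :: "tree list \<Rightarrow> tree \<Rightarrow> tree" where
  "graft Es c = fst (graft_aux c Es)"

definition lin_sol :: "real \<Rightarrow> real^'n^'n \<Rightarrow> real^'n \<Rightarrow> (real \<Rightarrow> real^'n) \<Rightarrow> real \<Rightarrow> real^'n" where
  "lin_sol T M x0 f = (THE x. continuous_on {0..T} x \<and> (\<forall>t. t \<notin> {0..T} \<longrightarrow> x t = 0) \<and>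
      (\<forall>t\<in>{0..T}. x t = x0 + (LINT s|lebesgue_on {0..t}. M *v x s + f s)))"

definition adj_sol :: "real \<Rightarrow> real^'n^'n \<Rightarrow> real^'n \<Rightarrow> real \<Rightarrow> real^'n" where
  "adj_sol T A y0 = lin_sol T (- transpose A) y0 (\<lambda>_. 0)"

text \<open>Phi(b) applied to a list of inputs in I = R^n \<times> L2 of length leaves b;
 Phi_forest distributes consecutive blocks of inputs to the trees of a forest.\<close>
fun Phi :: "real \<Rightarrow> real^'n^'n \<Rightarrow> (nat \<Rightarrow> (real \<Rightarrow> real^'n) list \<Rightarrow> real \<Rightarrow> real^'n)
             \<Rightarrow> tree \<Rightarrow> ((real^'n) \<times> (real \<Rightarrow> real^'n)) list \<Rightarrow> real \<Rightarrow> real^'n"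
and Phi_forest :: "real \<Rightarrow> real^'n^'n \<Rightarrow> (nat \<Rightarrow> (real \<Rightarrow> real^'n) list \<Rightarrow> real \<Rightarrow> real^'n)
             \<Rightarrow> tree list \<Rightarrow> ((real^'n) \<times> (real \<Rightarrow> real^'n)) list \<Rightarrow> (real \<Rightarrow> real^'n) list" where
  "Phi T A F Leaf ws = lin_sol T A (fst (hd ws)) (snd (hd ws))"
| "Phi T A F (Node bs) ws = lin_sol T A 0 (F (length bs) (Phi_forest T A F bs ws))"
| "Phi_forest T A F [] ws = []"
| "Phi_forest T A F (b # bs) ws =
     Phi T A F b (take (leaves b) ws) # Phi_forest T A F bs (drop (leaves b) ws)"

text \<open>(Phi * u)(b) = sum over c in Trees, E in Trees^(leaves c) with E \<propto> c = b (a finite set).\<close>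
definition Phi_star :: "real \<Rightarrow> real^'n^'n \<Rightarrow> (nat \<Rightarrow> (real \<Rightarrow> real^'n) list \<Rightarrow> real \<Rightarrow> real^'n)
             \<Rightarrow> (tree \<Rightarrow> (real^'n) \<times> (real \<Rightarrow> real^'n)) \<Rightarrow> tree \<Rightarrow> real \<Rightarrow> real^'n" where
  "Phi_star T A F u b = (\<lambda>t.
     \<Sum>(c, E)\<in>{(c, E). wf_tree c \<and> length E = leaves c \<and> (\<forall>e\<in>set E. wf_tree e) \<and> graft E c = b}.
        Phi T A F c (map u E) t)"

definition u_of :: "real^'m^'n \<Rightarrow> real^'n \<Rightarrow> (tree \<Rightarrow> real \<Rightarrow> real^'m) \<Rightarrow> tree \<Rightarrow> (real^'n) \<times> (real \<Rightarrow> real^'n)" where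
  "u_of B x0 v c = (if c = Leaf then x0 else 0, \<lambda>t. B *v v c t)"

definition J :: "real \<Rightarrow> real^'n^'n \<Rightarrow> real^'m^'n \<Rightarrow> (nat \<Rightarrow> (real \<Rightarrow> real^'n) list \<Rightarrow> real \<Rightarrow> real^'n)
     \<Rightarrow> real^'n \<Rightarrow> (tree \<Rightarrow> real \<Rightarrow> real^'m) \<Rightarrow> tree \<Rightarrow> real^'n \<Rightarrow> real" where
  "J T A B F x0 v b y0 =
     (1/2) * (LINT t|lebesgue_on {0..T}. (norm (transpose B *v adj_sol T A y0 t))^2) +
     (case b of
        Leaf \<Rightarrow> x0 \<bullet> y0
      | Node bs \<Rightarrow> (LINT t|lebesgue_on {0..T}.
           adj_sol T A y0 t \<bullet> F (length bs) (map (Phi_star T A F (u_of B x0 v)) bs) t))"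

definition constructed_family :: "real \<Rightarrow> real^'n^'n \<Rightarrow> real^'m^'n \<Rightarrow> (nat \<Rightarrow> (real \<Rightarrow> real^'n) list \<Rightarrow> real \<Rightarrow> real^'n)
     \<Rightarrow> real^'n \<Rightarrow> (tree \<Rightarrow> real \<Rightarrow> real^'m) \<Rightarrow> bool" where
  "constructed_family T A B F x0 v \<longleftrightarrow>
     (\<forall>b\<in>Trees. \<exists>y0. (\<forall>z. J T A B F x0 v b y0 \<le> J T A B F x0 v b z) \<and>
        (\<forall>t\<in>{0..T}. v b t = transpose B *v adj_sol T A y0 t))"

end

theory Submission
  imports Defs
begin

text \<open>
  By multilinearity, \<open>X b = (\<Phi> \<ast> u)(b)\<close> obeys a recursion: \<open>X b\<close> solves the linear equation with
  forcing \<open>B v(b) + f b\<close>, where \<open>f b = F\<^sub>r(X b\<^sub>1, \<dots>, X b\<^sub>r)\<close> for \<open>b = B\<^sub>+(b\<^sub>1, \<dots>, b\<^sub>r)\<close>, starting at \<open>x0\<close> for the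
  one-vertex tree and at \<open>0\<close> otherwise. The Euler equation of the minimisation of \<open>J b\<close> says, by duality
  with the adjoint equation, that \<open>X b T = 0\<close>, and it bounds \<open>v(b)\<close>, hence \<open>X b\<close>, linearly by \<open>f b\<close>. So
  the norms of the \<open>X b\<close> satisfy \<open>|X b| \<le> K \<parallel>F\<^sub>r\<parallel> |X b\<^sub>1| \<dots> |X b\<^sub>r|\<close>, and a majorant argument makes
  \<open>\<Sum> |\<lambda>|^|b| |X b|\<close> converge for small \<open>\<lambda>\<close>. The sum \<open>x\<close> of the series \<open>\<lambda>^|b| X b\<close> then solves the linear
  equation with forcing \<open>B v + \<lambda> g\<close>, \<open>g\<close> being the sum of the series \<open>\<lambda>^(|b| - 1) f b\<close>; regrouping the latter by
  the degree of the root gives \<open>g = F(x)\<close>.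
\<close>

subsection \<open>Square integrable functions\<close>

text \<open>L2 is a predicate on plain functions, so multilinearity of \<open>F p\<close> holds only
  almost everywhere. The solution operator removes the discrepancy: \<open>lin_sol\<close> depends
  only on the class of its forcing and is pinned to 0 outside the interval, so the recursion for
  \<open>X b\<close> is an equality of functions. Since forcings are merely L2, solutions are only
  absolutely continuous, and duality needs a product rule at that level. The series of the
  \<open>X b\<close> is never summed in the space S. Its sum \<open>x\<close> is defined as the
  linear solution driven by the limits of the two L2 series, and continuity of the solution map
  shows that the partial sums tend to it; completeness is thus needed in L2 only. Giving the series
  of forcings the exponent |b| - 1 avoids a division by lambda, so lambda = 0 needs no separate
  treatment. Identifying \<open>g\<close> with F(x) is an exchange of limits in the degree and in
  the set of trees. It is done on finite sets of trees, where expanding F_p on a partial sum is an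
  exact finite identity; the set of trees is chosen after the degree bound.\<close>

lemma l2norm_nonneg [simp]: "0 \<le> l2norm T f"
  by (simp add: l2norm_def)

lemma l2norm_power2: "(l2norm T f)\<^sup>2 = (LINT t|lebesgue_on {0..T}. (norm (f t))\<^sup>2)"
  by (simp add: l2norm_def)

lemma L2_measurable: "L2 T f \<Longrightarrow> f \<in> borel_measurable (lebesgue_on {0..T})"
  by (simp add: L2_def)

lemma L2_bound:
  fixes f :: "real \<Rightarrow> 'a::euclidean_space" and g :: "real \<Rightarrow> 'b::euclidean_space"
  assumes f: "L2 T f" and g: "g \<in> borel_measurable (lebesgue_on {0..T})"
    and le: "AE t in lebesgue_on {0..T}. norm (g t) \<le> c * norm (f t)" and c: "0 \<le> c"
  shows "L2 T g" and "l2norm T g \<le> c * l2norm T f"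
proof -
  have le2: "AE t in lebesgue_on {0..T}. (norm (g t))\<^sup>2 \<le> c\<^sup>2 * (norm (f t))\<^sup>2"
    using le by eventually_elim (metis norm_ge_zero power_mono power_mult_distrib)
  have i: "integrable (lebesgue_on {0..T}) (\<lambda>t. c\<^sup>2 * (norm (f t))\<^sup>2)"
    using f by (simp add: L2_def)
  have ig: "integrable (lebesgue_on {0..T}) (\<lambda>t. (norm (g t))\<^sup>2)"
    by (rule Bochner_Integration.integrable_bound[OF i]) (use g le2 in auto)
  then show "L2 T g" using g by (simp add: L2_def)
  have "(l2norm T g)\<^sup>2 \<le> (LINT t|lebesgue_on {0..T}. c\<^sup>2 * (norm (f t))\<^sup>2)"
    unfolding l2norm_power2 by (rule integral_mono_AE[OF ig i le2])
  also have "\<dots> = (c * l2norm T f)\<^sup>2"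
    by (simp add: power_mult_distrib l2norm_power2)
  finally show "l2norm T g \<le> c * l2norm T f"
    by (rule power2_le_imp_le) (simp add: c)
qed

lemma l2norm_cong_AE:
  assumes "L2 T f" "L2 T g" "ae_eq T f g"
  shows "l2norm T f = l2norm T g"
  unfolding l2norm_def
  by (rule arg_cong[where f=sqrt], rule integral_cong_AE)
     (use assms in \<open>auto simp: L2_def ae_eq_def\<close>)

lemma integrable_inner_L2:
  assumes f: "L2 T f" and g: "L2 T g"
  shows "integrable (lebesgue_on {0..T}) (\<lambda>t. f t \<bullet> g t)"
proof (rule Bochner_Integration.integrable_bound)
  show "integrable (lebesgue_on {0..T}) (\<lambda>t. (norm (f t))\<^sup>2 + (norm (g t))\<^sup>2)"
    using f g by (simp add: L2_def)
  show "(\<lambda>t. f t \<bullet> g t) \<in> borel_measurable (lebesgue_on {0..T})"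
    using f g by (auto simp: L2_def)
  show "AE t in lebesgue_on {0..T}. norm (f t \<bullet> g t) \<le> norm ((norm (f t))\<^sup>2 + (norm (g t))\<^sup>2)"
  proof (rule AE_I2)
    fix t
    have "norm (f t \<bullet> g t) \<le> norm (f t) * norm (g t)"
      by (simp add: Cauchy_Schwarz_ineq2)
    also have "\<dots> \<le> (norm (f t))\<^sup>2 + (norm (g t))\<^sup>2"
      using sum_squares_bound[of "norm (f t)" "norm (g t)"]
        mult_nonneg_nonneg[OF norm_ge_zero norm_ge_zero, of "f t" "g t"] by linarith
    finally show "norm (f t \<bullet> g t) \<le> norm ((norm (f t))\<^sup>2 + (norm (g t))\<^sup>2)" by simp
  qed
qed

lemma L2_add:
  assumes f: "L2 T f" and g: "L2 T g"
  shows "L2 T (\<lambda>t. f t + g t)"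
proof -
  have "integrable (lebesgue_on {0..T}) (\<lambda>t. (norm (f t))\<^sup>2 + (norm (g t))\<^sup>2 + 2 * (f t \<bullet> g t))"
    using f g integrable_inner_L2[OF f g] by (simp add: L2_def)
  moreover have "(norm (f t))\<^sup>2 + (norm (g t))\<^sup>2 + 2 * (f t \<bullet> g t) = (norm (f t + g t))\<^sup>2" for t
    by (simp add: power2_norm_eq_inner inner_add_left inner_add_right inner_commute)
  ultimately show ?thesis using f g by (auto simp: L2_def)
qed

lemma L2_scaleR:
  assumes f: "L2 T f" shows "L2 T (\<lambda>t. a *\<^sub>R f t)"
  by (rule L2_bound(1)[OF f, of _ "\<bar>a\<bar>"]) (use f in \<open>auto simp: L2_def\<close>)

lemma l2norm_scaleR: "l2norm T (\<lambda>t. a *\<^sub>R f t) = \<bar>a\<bar> * l2norm T f"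
  by (simp add: l2norm_def power_mult_distrib real_sqrt_mult)

lemma L2_zero [simp]: "L2 T (\<lambda>t. 0)"
  by (simp add: L2_def)

lemma l2norm_zero [simp]: "l2norm T (\<lambda>t. 0) = 0"
  by (simp add: l2norm_def)

lemma L2_diff:
  assumes "L2 T f" "L2 T g" shows "L2 T (\<lambda>t. f t - g t)"
  using L2_add[OF assms(1) L2_scaleR[OF assms(2), of "-1"]] by simp

lemma L2_sum:
  assumes "\<And>i. i \<in> I \<Longrightarrow> L2 T (w i)" shows "L2 T (\<lambda>t. \<Sum>i\<in>I. w i t)"
  using assms by (induction I rule: infinite_finite_induct) (auto intro: L2_add)

text \<open>Discriminant argument: the squared norm of \<open>s f + g\<close> is a nonnegative
  polynomial in \<open>s\<close>. If the norm of \<open>f\<close> is 0 the polynomial is affine, and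
  this case is treated apart.\<close>

lemma abs_integral_inner_le:
  assumes f: "L2 T f" and g: "L2 T g"
  shows "\<bar>LINT t|lebesgue_on {0..T}. f t \<bullet> g t\<bar> \<le> l2norm T f * l2norm T g"
proof -
  define c where "c = (LINT t|lebesgue_on {0..T}. f t \<bullet> g t)"
  have q: "0 \<le> (l2norm T f)\<^sup>2 * s\<^sup>2 + 2 * s * c + (l2norm T g)\<^sup>2" for s
  proof -
    have "(norm (s *\<^sub>R f t + g t))\<^sup>2 = s\<^sup>2 * (norm (f t))\<^sup>2 + 2 * s * (f t \<bullet> g t) + (norm (g t))\<^sup>2" for t
      unfolding power2_norm_eq_inner power2_eq_square[of s]
      by (simp add: inner_add_left inner_add_right inner_commute)
    then have "(LINT t|lebesgue_on {0..T}. (norm (s *\<^sub>R f t + g t))\<^sup>2)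
       = s\<^sup>2 * (l2norm T f)\<^sup>2 + 2 * s * c + (l2norm T g)\<^sup>2"
      using f g integrable_inner_L2[OF f g] by (simp add: L2_def l2norm_power2 c_def)
    moreover have "0 \<le> (LINT t|lebesgue_on {0..T}. (norm (s *\<^sub>R f t + g t))\<^sup>2)"
      by simp
    ultimately show ?thesis by (simp add: mult.commute)
  qed
  have "c\<^sup>2 \<le> (l2norm T f)\<^sup>2 * (l2norm T g)\<^sup>2"
  proof (cases "l2norm T f = 0")
    case True
    have "c = 0"
    proof (rule ccontr)
      assume "c \<noteq> 0"
      \<comment> \<open>At this \<open>s\<close> the affine polynomial takes the value -1.\<close>
      then show False using q[of "-((l2norm T g)\<^sup>2 + 1) / (2 * c)"] True by (simp add: field_simps)
    qed
    then show ?thesis by simp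
  next
    case False
    define a where "a = (l2norm T f)\<^sup>2"
    have a: "a > 0" using False by (simp add: a_def)
    have "a * (- c / a)\<^sup>2 + 2 * (- c / a) * c = - (c\<^sup>2 / a)"
      using a by (simp add: field_simps power2_eq_square)
    with q[of "- c / a"] have "c\<^sup>2 / a \<le> (l2norm T g)\<^sup>2" unfolding a_def by linarith
    then show ?thesis using a unfolding a_def by (simp add: field_simps)
  qed
  then have "\<bar>c\<bar>\<^sup>2 \<le> (l2norm T f * l2norm T g)\<^sup>2"
    by (simp add: power_mult_distrib)
  then show ?thesis unfolding c_def by (rule power2_le_imp_le) simp
qed

lemma l2norm_triangle:
  assumes f: "L2 T f" and g: "L2 T g"
  shows "l2norm T (\<lambda>t. f t + g t) \<le> l2norm T f + l2norm T g"
proof (rule power2_le_imp_le)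
  have "(norm (f t + g t))\<^sup>2 = (norm (f t))\<^sup>2 + 2 * (f t \<bullet> g t) + (norm (g t))\<^sup>2" for t
    by (simp add: power2_norm_eq_inner inner_add_left inner_add_right inner_commute)
  then have "(l2norm T (\<lambda>t. f t + g t))\<^sup>2 =
      (l2norm T f)\<^sup>2 + 2 * (LINT t|lebesgue_on {0..T}. f t \<bullet> g t) + (l2norm T g)\<^sup>2"
    using f g integrable_inner_L2[OF f g] by (simp add: L2_def l2norm_power2)
  also have "\<dots> \<le> (l2norm T f + l2norm T g)\<^sup>2"
    using abs_integral_inner_le[OF f g] by (simp add: power2_sum)
  finally show "(l2norm T (\<lambda>t. f t + g t))\<^sup>2 \<le> (l2norm T f + l2norm T g)\<^sup>2" .
qed simp

lemma l2norm_minus_commute: "l2norm T (\<lambda>t. f t - g t) = l2norm T (\<lambda>t. g t - f t)"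
  by (simp add: l2norm_def norm_minus_commute)

lemma l2norm_triangle_diff:
  assumes "L2 T f" "L2 T g" "L2 T h"
  shows "l2norm T (\<lambda>t. f t - h t) \<le> l2norm T (\<lambda>t. f t - g t) + l2norm T (\<lambda>t. g t - h t)"
  using l2norm_triangle[OF L2_diff[OF assms(1,2)] L2_diff[OF assms(2,3)]] by simp

lemma l2norm_sum_le:
  assumes "\<And>i. i \<in> I \<Longrightarrow> L2 T (w i)"
  shows "l2norm T (\<lambda>t. \<Sum>i\<in>I. w i t) \<le> (\<Sum>i\<in>I. l2norm T (w i))"
  using assms
proof (induction I rule: infinite_finite_induct)
  case (insert i I)
  have "l2norm T (\<lambda>t. w i t + (\<Sum>i\<in>I. w i t)) \<le> l2norm T (w i) + l2norm T (\<lambda>t. \<Sum>i\<in>I. w i t)"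
    by (rule l2norm_triangle) (use insert in \<open>auto intro: L2_sum\<close>)
  with insert show ?case by fastforce
qed auto

lemma L2_bounded_on:
  assumes "f \<in> borel_measurable (lebesgue_on {0..T})" "\<And>t. t \<in> {0..T} \<Longrightarrow> norm (f t) \<le> K" "0 \<le> K"
  shows "L2 T f" and "0 \<le> T \<Longrightarrow> l2norm T f \<le> K * sqrt T"
proof -
  have one: "L2 T (\<lambda>t. 1::real)"
    using finite_measure.integrable_const[OF finite_measure_lebesgue_on[OF lmeasurable_interval(1)]]
    by (simp add: L2_def)
  have ae: "AE t in lebesgue_on {0..T}. norm (f t) \<le> K * norm (1::real)"
    by (rule AE_I2) (use assms in auto)
  show "L2 T f" by (rule L2_bound(1)[OF one assms(1) ae assms(3)])
  assume "0 \<le> T"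
  then have "l2norm T (\<lambda>t. 1::real) = sqrt T"
    by (simp add: l2norm_def measure_restrict_space)
  then show "l2norm T f \<le> K * sqrt T" using L2_bound(2)[OF one assms(1) ae assms(3)] by simp
qed

lemma L2_continuous:
  assumes "continuous_on {0..T} f" shows "L2 T f"
proof -
  obtain K where "\<forall>t\<in>{0..T}. norm (f t) \<le> K"
    using compact_imp_bounded[OF compact_continuous_image[OF assms compact_Icc]]
    unfolding bounded_iff by blast
  then show ?thesis
    by (intro L2_bounded_on(1)[of f T "max K 0"] continuous_imp_measurable_on_sets_lebesgue assms)
       (auto simp: le_max_iff_disj)
qed

lemma L2_integrable:
  assumes "L2 T f" shows "integrable (lebesgue_on {0..T}) f"
proof (rule Bochner_Integration.integrable_bound)
  show "integrable (lebesgue_on {0..T}) (\<lambda>t. 1 + (norm (f t))\<^sup>2)"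
    using assms finite_measure.integrable_const[OF finite_measure_lebesgue_on[OF lmeasurable_interval(1)]]
    by (simp add: L2_def)
  show "AE t in lebesgue_on {0..T}. norm (f t) \<le> norm (1 + (norm (f t))\<^sup>2)"
  proof (rule AE_I2)
    fix t
    have "2 * norm (f t) * 1 \<le> (norm (f t))\<^sup>2 + 1\<^sup>2" by (rule sum_squares_bound)
    then show "norm (f t) \<le> norm (1 + (norm (f t))\<^sup>2)"
      by (smt (verit) norm_ge_zero one_power2 real_norm_def)
  qed
qed (use assms in \<open>simp add: L2_def\<close>)

lemma L2_norm: "L2 T f \<Longrightarrow> L2 T (\<lambda>t. norm (f t))"
  by (auto simp: L2_def)

lemma integral_norm_le_l2norm:
  assumes "L2 T f" "0 \<le> T"
  shows "(LINT t|lebesgue_on {0..T}. norm (f t)) \<le> sqrt T * l2norm T f"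
proof -
  have 1: "L2 T (\<lambda>t. 1::real)" "l2norm T (\<lambda>t. 1::real) \<le> 1 * sqrt T"
    using L2_bounded_on[of "\<lambda>t. 1::real" T 1] assms by simp_all
  have "(LINT t|lebesgue_on {0..T}. norm (f t)) \<le> l2norm T (\<lambda>t. norm (f t)) * l2norm T (\<lambda>t. 1::real)"
    using abs_integral_inner_le[OF L2_norm[OF assms(1)] 1(1)] by simp
  also have "\<dots> = l2norm T f * l2norm T (\<lambda>t. 1::real)" by (simp add: l2norm_def)
  also have "\<dots> \<le> l2norm T f * sqrt T" using 1(2) by (simp add: mult_left_mono)
  finally show ?thesis by (simp add: mult.commute)
qed

lemma norm_matrix_vector_le: "norm (M *v x) \<le> onorm ((*v) M) * norm (x :: real^'n)"
  by (rule onorm) (rule matrix_vector_mul_bounded_linear)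

lemma onorm_matrix_nonneg: "0 \<le> onorm ((*v) (M :: real^'n^'m))"
  by (rule onorm_pos_le) (rule matrix_vector_mul_bounded_linear)

lemma L2_matrix:
  fixes M :: "real^'n^'m"
  assumes f: "L2 T f"
  shows "L2 T (\<lambda>t. M *v f t)" and "l2norm T (\<lambda>t. M *v f t) \<le> onorm ((*v) M) * l2norm T f"
proof -
  have "(\<lambda>x. M *v x) \<in> borel_measurable borel"
    by (intro borel_measurable_continuous_onI linear_continuous_on matrix_vector_mul_bounded_linear)
  then have m: "(\<lambda>t. M *v f t) \<in> borel_measurable (lebesgue_on {0..T})"
    using measurable_compose[OF L2_measurable[OF f]] by blast
  have ae: "AE t in lebesgue_on {0..T}. norm (M *v f t) \<le> onorm ((*v) M) * norm (f t)"
    by (simp add: norm_matrix_vector_le)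
  show "L2 T (\<lambda>t. M *v f t)" "l2norm T (\<lambda>t. M *v f t) \<le> onorm ((*v) M) * l2norm T f"
    using L2_bound[OF f m ae onorm_matrix_nonneg] by auto
qed

text \<open>The Bochner integrals over \<^term>\<open>{0..t}\<close> of the definitions are traded for gauge
  integrals, for which the library has the calculus on intervals.\<close>

lemma integrable_on_Icc:
  assumes "integrable (lebesgue_on {0..T}) (f :: real \<Rightarrow> 'a::euclidean_space)" "{s..t} \<subseteq> {0..T}"
  shows "f integrable_on {s..t}"
  by (rule integrable_on_lebesgue_on[OF integrable_subinterval[OF assms]]) simp

lemma LINT_eq_integral:
  assumes "integrable (lebesgue_on {0..T}) (f :: real \<Rightarrow> 'a::euclidean_space)" "{s..t} \<subseteq> {0..T}"
  shows "(LINT u|lebesgue_on {s..t}. f u) = integral {s..t} f"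
  by (rule lebesgue_integral_eq_integral[OF integrable_subinterval[OF assms]]) simp

lemma norm_integral_le_L2:
  assumes f: "L2 T (f :: real \<Rightarrow> 'a::euclidean_space)" and t: "t \<in> {0..T}"
  shows "norm (integral {0..t} f) \<le> sqrt T * l2norm T f"
proof -
  have T: "0 \<le> T" using t by simp
  note i = L2_integrable[OF f] and n = L2_integrable[OF L2_norm[OF f]]
  have sub: "{0..t} \<subseteq> {0..T}" using t by auto
  have "norm (integral {0..t} f) \<le> integral {0..t} (\<lambda>s. norm (f s))"
    by (rule integral_norm_bound_integral) (use integrable_on_Icc[OF i sub] integrable_on_Icc[OF n sub] in auto)
  also have "\<dots> \<le> integral {0..T} (\<lambda>s. norm (f s))"
    by (rule integral_subset_le[OF sub]) (use integrable_on_Icc[OF n sub] integrable_on_Icc[OF n] in auto)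
  also have "\<dots> = (LINT s|lebesgue_on {0..T}. norm (f s))"
    using LINT_eq_integral[OF n, of 0 T] by simp
  also have "\<dots> \<le> sqrt T * l2norm T f" by (rule integral_norm_le_l2norm[OF f T])
  finally show ?thesis .
qed

text \<open>Intervals generate the Borel sets, and vanishing of the integral of an integrable
  function passes to complements and countable disjoint unions. So the integral vanishes over every
  Borel set, then over every Lebesgue set, which forces the function to vanish almost
  everywhere.\<close>

lemma integral_Icc_0_imp_AE_0:
  fixes g :: "real \<Rightarrow> 'a::euclidean_space"
  assumes g: "integrable (lebesgue_on {0..T}) g"
    and 0: "\<And>t. t \<in> {0..T} \<Longrightarrow> integral {0..t} g = 0"
  shows "AE t in lebesgue_on {0..T}. g t = 0"
proof -
  \<comment> \<open>Extension by 0, so that the induction can run over the Borel sets of the whole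
    line.\<close>
  define h where "h t = (if t \<in> {0..T} then g t else 0)" for t
  have h: "integrable lebesgue h"
    using Lebesgue_Measure.integrable_restrict_UNIV[of "{0..T}" g] g by (simp add: h_def[abs_def])
  have si: "set_integrable lebesgue A h" if "A \<in> sets lebesgue" for A
    using h that by (auto simp: set_integrable_def intro: integrable_mult_indicator)
  have gi: "g integrable_on {0..T}"
    using integrable_on_Icc[OF g, of 0 T] by simp
  have zero: "integral {s..t} g = 0" if "0 \<le> s" "t \<le> T" for s t
  proof (cases "s \<le> t")
    case True
    have "integral {0..s} g + integral {s..t} g = integral {0..t} g"
      by (rule Henstock_Kurzweil_Integration.integral_combine)
         (use that True in \<open>auto intro: integrable_on_Icc[OF g]\<close>)
    then show ?thesis using 0[of s] 0[of t] that True by simp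
  qed simp
  have borel: "set_lebesgue_integral lebesgue A h = 0" if "A \<in> sets borel" for A
    using that
  proof (induction rule: borel_set_induct)
    case empty
    then show ?case by (simp add: set_lebesgue_integral_def)
  next
    case (interval a b)
    have "set_lebesgue_integral lebesgue {a..b} h = integral {a..b} h"
      by (rule set_lebesgue_integral_eq_integral(2)[OF si]) simp
    also have "\<dots> = integral ({0..T} \<inter> {a..b}) g"
      unfolding h_def[abs_def] by (rule Henstock_Kurzweil_Integration.integral_restrict_Int)
    also have "{0..T} \<inter> {a..b} = {max 0 a..min T b}" by auto
    also have "integral {max 0 a..min T b} g = 0" by (rule zero) auto
    finally show ?case .
  next
    case (compl A)
    have u: "set_lebesgue_integral lebesgue UNIV h = 0"
    proof -
      have "set_lebesgue_integral lebesgue UNIV h = integral UNIV h"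
        by (rule set_lebesgue_integral_eq_integral(2)[OF si]) simp
      also have "\<dots> = integral {0..T} g"
        unfolding h_def[abs_def] by (rule Henstock_Kurzweil_Integration.integral_restrict_UNIV)
      finally show ?thesis using zero[of 0 T] by simp
    qed
    have "set_lebesgue_integral lebesgue (A \<union> (- A)) h =
      set_lebesgue_integral lebesgue A h + set_lebesgue_integral lebesgue (- A) h"
      by (rule set_integral_Un) (use compl in \<open>auto intro!: si\<close>)
    then show ?case using u compl.IH by simp
  next
    case (union f)
    have "set_lebesgue_integral lebesgue (\<Union>i. f i) h = (\<Sum>i. set_lebesgue_integral lebesgue (f i) h)"
      by (rule lebesgue_integral_countable_add)
         (use union in \<open>auto intro!: si simp: disjoint_family_on_def\<close>)
    then show ?case using union by simp
  qed
  interpret finite_measure "lebesgue_on {0..T}"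
    by (rule finite_measure_lebesgue_on) simp
  show ?thesis
  proof (rule density_zero[OF g])
    fix A :: "real set" assume "A \<in> sets (lebesgue_on {0..T})"
    then have "A \<in> sets lebesgue"
      by (auto simp: sets_restrict_space)
    \<comment> \<open>A Lebesgue set is a Borel set up to a part of a null set, which does not
      change the integral.\<close>
    from sets_completionE[OF this] obtain S N N' where A: "A = S \<union> N" "N \<subseteq> N'" "N' \<in> null_sets lborel" "S \<in> sets lborel"
      by blast
    then have N': "N' \<in> null_sets lebesgue" by (simp add: null_sets_completionI)
    have S: "S \<in> sets lebesgue" using A(4) by (auto intro: sets_completionI_sets)
    have "set_lebesgue_integral lebesgue A h = set_lebesgue_integral lebesgue S h"
      unfolding set_lebesgue_integral_def
    proof (rule integral_cong_AE)
      show "AE x in lebesgue. indicator A x *\<^sub>R h x = indicator S x *\<^sub>R h x"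
        by (rule AE_I'[OF N']) (use A in \<open>auto split: split_indicator_asm\<close>)
    qed (use h \<open>A \<in> sets lebesgue\<close> S in auto)
    also have "\<dots> = 0" using A by (intro borel) simp
    finally have "set_lebesgue_integral lebesgue A h = 0" .
    moreover have "(\<lambda>x. indicator {0..T} x *\<^sub>R g x) = h"
      by (auto simp: h_def split: split_indicator)
    ultimately show "set_lebesgue_integral (lebesgue_on {0..T}) A g = 0"
      by (subst set_integral_restrict_space) auto
  qed
qed

lemma LINT_eq_integral_0:
  assumes "L2 T f" "t \<in> {0..T}"
  shows "(LINT u|lebesgue_on {0..t}. f u) = integral {0..t} f"
  by (rule LINT_eq_integral[OF L2_integrable[OF assms(1)]]) (use assms in auto)

section \<open>Weak derivatives and the norm of the space S\<close>

lemma weak_deriv_L2: "weak_deriv_of T x g \<Longrightarrow> L2 T g"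
  unfolding weak_deriv_of_def by (rule conjunct1)

lemma weak_deriv_of_iff:
  "weak_deriv_of T x g \<longleftrightarrow> L2 T g \<and> (\<forall>t\<in>{0..T}. x t = x 0 + integral {0..t} g)"
  unfolding weak_deriv_of_def by (intro conj_cong ball_cong refl) (simp only: LINT_eq_integral_0)

lemma weak_deriv_of_integral:
  assumes "weak_deriv_of T x g" "t \<in> {0..T}"
  shows "x t = x 0 + integral {0..t} g"
  using assms unfolding weak_deriv_of_iff by blast

text \<open>The difference of two derivatives has zero integral over all initial intervals. This
  makes \<open>S_norm\<close> independent of the derivative picked by \<open>SOME\<close>.\<close>

lemma weak_deriv_unique:
  assumes g: "weak_deriv_of T x g" and h: "weak_deriv_of T x h"
  shows "ae_eq T g h"
proof -
  note L = weak_deriv_L2[OF g] weak_deriv_L2[OF h]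
  have "AE t in lebesgue_on {0..T}. g t - h t = 0"
  proof (rule integral_Icc_0_imp_AE_0)
    show "integrable (lebesgue_on {0..T}) (\<lambda>t. g t - h t)" by (rule L2_integrable[OF L2_diff[OF L]])
    fix t assume t: "t \<in> {0..T}"
    then have sub: "{0..t} \<subseteq> {0..T}" by auto
    have "integral {0..t} (\<lambda>t. g t - h t) = integral {0..t} g - integral {0..t} h"
      by (rule Henstock_Kurzweil_Integration.integral_diff)
         (use integrable_on_Icc[OF L2_integrable sub] L in auto)
    then show "integral {0..t} (\<lambda>t. g t - h t) = 0"
      using weak_deriv_of_integral[OF g t] weak_deriv_of_integral[OF h t] by simp
  qed
  then show ?thesis by (simp add: ae_eq_def)
qed

lemma S_norm_eq:
  assumes g: "weak_deriv_of T x g"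
  shows "S_norm T x = sqrt ((l2norm T x)\<^sup>2 + (l2norm T g)\<^sup>2)"
proof -
  have s: "weak_deriv_of T x (SOME g. weak_deriv_of T x g)" using someI[of "weak_deriv_of T x", OF g] .
  have "l2norm T (SOME g. weak_deriv_of T x g) = l2norm T g"
    by (rule l2norm_cong_AE[OF weak_deriv_L2[OF s] weak_deriv_L2[OF g] weak_deriv_unique[OF s g]])
  then show ?thesis by (simp add: S_norm_def)
qed

lemma S_norm_nonneg [simp]: "0 \<le> S_norm T x"
  by (simp add: S_norm_def)

lemma S_norm_le:
  assumes "weak_deriv_of T x g" shows "S_norm T x \<le> l2norm T x + l2norm T g"
  unfolding S_norm_eq[OF assms] by (rule sqrt_sum_squares_le_sum) auto

lemma weak_deriv_lincomb:
  assumes x: "weak_deriv_of T x g" and y: "weak_deriv_of T y h"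
  shows "weak_deriv_of T (\<lambda>t. a *\<^sub>R x t + b *\<^sub>R y t) (\<lambda>t. a *\<^sub>R g t + b *\<^sub>R h t)"
proof -
  note L = weak_deriv_L2[OF x] weak_deriv_L2[OF y]
  have "a *\<^sub>R x t + b *\<^sub>R y t = a *\<^sub>R x 0 + b *\<^sub>R y 0 + integral {0..t} (\<lambda>t. a *\<^sub>R g t + b *\<^sub>R h t)"
    if t: "t \<in> {0..T}" for t
  proof -
    have sub: "{0..t} \<subseteq> {0..T}" using t by auto
    have i: "g integrable_on {0..t}" "h integrable_on {0..t}"
      using integrable_on_Icc[OF L2_integrable sub] L by auto
    show ?thesis
      unfolding weak_deriv_of_integral[OF x t] weak_deriv_of_integral[OF y t]
      using i by (simp add: Henstock_Kurzweil_Integration.integral_add integrable_cmul scaleR_add_right)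
  qed
  then show ?thesis
    unfolding weak_deriv_of_iff by (intro conjI ballI L2_add L2_scaleR L)
qed

lemma in_S_lincomb:
  assumes "in_S T x" "in_S T y" shows "in_S T (\<lambda>t. a *\<^sub>R x t + b *\<^sub>R y t)"
proof -
  obtain g h where "weak_deriv_of T x g" "weak_deriv_of T y h" using assms unfolding in_S_def by blast
  from weak_deriv_lincomb[OF this] show ?thesis
    unfolding in_S_def by (intro conjI exI continuous_intros) (use assms in \<open>auto simp: in_S_def\<close>)
qed

lemma weak_deriv_zero: "weak_deriv_of T (\<lambda>t. 0) (\<lambda>t. 0)"
  by (simp add: weak_deriv_of_def)

lemma in_S_zero: "in_S T (\<lambda>t. 0)"
  using weak_deriv_zero by (auto simp: in_S_def)

lemma in_S_scaleR: "in_S T x \<Longrightarrow> in_S T (\<lambda>t. a *\<^sub>R x t)"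
  using in_S_lincomb[of T x x a 0] by simp

lemma in_S_add: "in_S T x \<Longrightarrow> in_S T y \<Longrightarrow> in_S T (\<lambda>t. x t + y t)"
  using in_S_lincomb[of T x y 1 1] by simp

lemma in_S_sum: "(\<And>i. i \<in> I \<Longrightarrow> in_S T (w i)) \<Longrightarrow> in_S T (\<lambda>t. \<Sum>i\<in>I. w i t)"
  by (induction I rule: infinite_finite_induct) (auto intro: in_S_add in_S_zero)

lemma S_norm_scaleR:
  assumes "in_S T x" shows "S_norm T (\<lambda>t. a *\<^sub>R x t) = \<bar>a\<bar> * S_norm T x"
proof -
  obtain g where g: "weak_deriv_of T x g" using assms by (auto simp: in_S_def)
  then have "weak_deriv_of T (\<lambda>t. a *\<^sub>R x t) (\<lambda>t. a *\<^sub>R g t)"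
    using weak_deriv_lincomb[OF g g, of a 0] by simp
  from S_norm_eq[OF this] show ?thesis
    unfolding S_norm_eq[OF g] l2norm_scaleR power_mult_distrib
    by (simp add: distrib_left[symmetric] real_sqrt_mult)
qed

section \<open>Limits and completeness in L2\<close>

lemma L2_fatou:
  fixes u :: "nat \<Rightarrow> real \<Rightarrow> 'a::euclidean_space"
  assumes u: "\<And>N. L2 T (u N)" and lim: "AE t in lebesgue_on {0..T}. (\<lambda>N. u N t) \<longlonglongrightarrow> s t"
    and s: "s \<in> borel_measurable (lebesgue_on {0..T})"
    and le: "eventually (\<lambda>N. l2norm T (u N) \<le> C) sequentially" and C: "0 \<le> C"
  shows "L2 T s" and "l2norm T s \<le> C"
proof -
  let ?M = "lebesgue_on {0..T}"
  have m: "u N \<in> borel_measurable ?M" for N using u by (simp add: L2_def)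
  \<comment> \<open>The squared norms are integrated in \<open>ennreal\<close>, where Fatou's lemma
    applies before the limit is known to be square integrable; membership in L2 and the bound then
    come out together.\<close>
  have "(\<integral>\<^sup>+t. ennreal ((norm (s t))\<^sup>2) \<partial>?M) = (\<integral>\<^sup>+t. liminf (\<lambda>N. ennreal ((norm (u N t))\<^sup>2)) \<partial>?M)"
  proof (rule nn_integral_cong_AE)
    show "AE t in ?M. ennreal ((norm (s t))\<^sup>2) = liminf (\<lambda>N. ennreal ((norm (u N t))\<^sup>2))"
      using lim
    proof eventually_elim
      case (elim t)
      then have "(\<lambda>N. ennreal ((norm (u N t))\<^sup>2)) \<longlonglongrightarrow> ennreal ((norm (s t))\<^sup>2)"
        by (intro tendsto_intros tendsto_ennrealI)
      then show ?case by (metis lim_imp_Liminf sequentially_bot)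
    qed
  qed
  also have "\<dots> \<le> liminf (\<lambda>N. \<integral>\<^sup>+t. ennreal ((norm (u N t))\<^sup>2) \<partial>?M)"
    by (rule nn_integral_liminf) (use m in auto)
  also have "\<dots> \<le> limsup (\<lambda>N. \<integral>\<^sup>+t. ennreal ((norm (u N t))\<^sup>2) \<partial>?M)"
    by (rule Liminf_le_Limsup) simp
  also have "\<dots> \<le> ennreal (C\<^sup>2)"
  proof (rule Limsup_bounded)
    show "eventually (\<lambda>N. (\<integral>\<^sup>+t. ennreal ((norm (u N t))\<^sup>2) \<partial>?M) \<le> ennreal (C\<^sup>2)) sequentially"
      using le
    proof eventually_elim
      case (elim N)
      have "(\<integral>\<^sup>+t. ennreal ((norm (u N t))\<^sup>2) \<partial>?M) = ennreal ((l2norm T (u N))\<^sup>2)"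
        unfolding l2norm_power2 by (rule nn_integral_eq_integral) (use u in \<open>auto simp: L2_def\<close>)
      with elim show ?case by (simp add: ennreal_leI power_mono)
    qed
  qed
  finally have fin: "(\<integral>\<^sup>+t. ennreal ((norm (s t))\<^sup>2) \<partial>?M) \<le> ennreal (C\<^sup>2)" .
  then have i: "integrable ?M (\<lambda>t. (norm (s t))\<^sup>2)"
    by (intro integrableI_nonneg) (use s in \<open>auto simp: le_less_trans\<close>)
  with s show "L2 T s" by (simp add: L2_def)
  have "ennreal ((l2norm T s)\<^sup>2) \<le> ennreal (C\<^sup>2)"
    using fin unfolding l2norm_power2 by (subst nn_integral_eq_integral[OF i, symmetric]) auto
  then have "(l2norm T s)\<^sup>2 \<le> C\<^sup>2" by (simp add: ennreal_le_iff)
  then show "l2norm T s \<le> C" by (rule power2_le_imp_le[OF _ C])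
qed

text \<open>Riesz-Fischer: on a bounded interval the L1 norms are summable too, so the series
  converges absolutely almost everywhere. The remainder is estimated for every finite index set
  \<open>G\<close>, not only for initial segments, because unconditional sums are wanted.\<close>

lemma L2_series_complete:
  fixes w :: "nat \<Rightarrow> real \<Rightarrow> 'a::euclidean_space"
  assumes T: "0 \<le> T" and w: "\<And>n. L2 T (w n)" and sm: "summable (\<lambda>n. l2norm T (w n))"
  obtains s where "L2 T s"
    "\<And>G. finite G \<Longrightarrow> l2norm T (\<lambda>t. s t - (\<Sum>n\<in>G. w n t))
       \<le> (\<Sum>n. l2norm T (w n)) - (\<Sum>n\<in>G. l2norm T (w n))"
proof -
  let ?M = "lebesgue_on {0..T}"
  have m[measurable]: "w n \<in> borel_measurable ?M" for n using w by (simp add: L2_def)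
  have "(\<integral>\<^sup>+t. (\<Sum>n. ennreal (norm (w n t))) \<partial>?M) = (\<Sum>n. \<integral>\<^sup>+t. ennreal (norm (w n t)) \<partial>?M)"
    by (rule nn_integral_suminf) simp
  also have "\<dots> \<le> (\<Sum>n. ennreal (sqrt T * l2norm T (w n)))"
  proof (rule suminf_le)
    fix n
    have "(\<integral>\<^sup>+t. ennreal (norm (w n t)) \<partial>?M) = ennreal (LINT t|?M. norm (w n t))"
      by (rule nn_integral_eq_integral) (use L2_integrable[OF L2_norm[OF w]] in auto)
    then show "(\<integral>\<^sup>+t. ennreal (norm (w n t)) \<partial>?M) \<le> ennreal (sqrt T * l2norm T (w n))"
      using integral_norm_le_l2norm[OF w T] by (simp add: ennreal_leI)
  qed auto
  also have "\<dots> < \<infinity>"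
    using T by (subst suminf_ennreal2[OF _ summable_mult[OF sm]]) simp_all
  finally have "AE t in ?M. (\<Sum>n. ennreal (norm (w n t))) \<noteq> \<infinity>"
    by (intro nn_integral_PInf_AE) auto
  then have ae: "AE t in ?M. summable (\<lambda>n. norm (w n t))"
    by eventually_elim (auto intro: summable_suminf_not_top)
  define s where "s t = (\<Sum>n. w n t)" for t
  have ms[measurable]: "s \<in> borel_measurable ?M" unfolding s_def[abs_def] by simp
  have est: "L2 T (\<lambda>t. s t - (\<Sum>n\<in>G. w n t)) \<and> l2norm T (\<lambda>t. s t - (\<Sum>n\<in>G. w n t))
       \<le> (\<Sum>n. l2norm T (w n)) - (\<Sum>n\<in>G. l2norm T (w n))" if G: "finite G" for G
  proof -
    \<comment> \<open>Once \<open>N\<close> exceeds all of \<open>G\<close>, this is the sum over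
      the remaining indices below \<open>N\<close>, whose norm is at most the sum of the remaining
      norms.\<close>
    define u where "u N t = (\<Sum>n<N. w n t) - (\<Sum>n\<in>G. w n t)" for N t
    have u: "L2 T (u N)" for N
      unfolding u_def[abs_def] by (intro L2_diff L2_sum w)
    have lim: "AE t in ?M. (\<lambda>N. u N t) \<longlonglongrightarrow> s t - (\<Sum>n\<in>G. w n t)"
      using ae
    proof eventually_elim
      case (elim t)
      then have "(\<lambda>N. \<Sum>n<N. w n t) \<longlonglongrightarrow> s t"
        unfolding s_def by (rule summable_LIMSEQ[OF summable_norm_cancel])
      then show ?case unfolding u_def by (intro tendsto_intros)
    qed
    obtain K where K: "G \<subseteq> {..<K}" using G finite_nat_bounded by blast
    have le: "eventually (\<lambda>N. l2norm T (u N) \<le> (\<Sum>n. l2norm T (w n)) - (\<Sum>n\<in>G. l2norm T (w n))) sequentially"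
      using eventually_ge_at_top[of K]
    proof eventually_elim
      case (elim N)
      then have sub: "G \<subseteq> {..<N}" using K by auto
      have "u N = (\<lambda>t. \<Sum>n\<in>{..<N} - G. w n t)"
        unfolding u_def[abs_def] using sub G by (simp add: sum_diff)
      then have "l2norm T (u N) \<le> (\<Sum>n\<in>{..<N} - G. l2norm T (w n))"
        using l2norm_sum_le[of "{..<N} - G" T w] w by simp
      also have "\<dots> = (\<Sum>n<N. l2norm T (w n)) - (\<Sum>n\<in>G. l2norm T (w n))"
        using sub G by (simp add: sum_diff)
      also have "(\<Sum>n<N. l2norm T (w n)) \<le> (\<Sum>n. l2norm T (w n))"
        by (rule sum_le_suminf[OF sm]) auto
      finally show ?case by simp
    qed
    have pos: "0 \<le> (\<Sum>n. l2norm T (w n)) - (\<Sum>n\<in>G. l2norm T (w n))"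
      using sum_le_suminf[OF sm G] by simp
    show ?thesis using L2_fatou[OF u lim _ le pos] by simp
  qed
  show ?thesis
  proof (rule that)
    show "L2 T s" using est[of "{}"] by simp
  qed (use est in blast)
qed

lemma L2_has_sum_complete:
  fixes w :: "'i::countable \<Rightarrow> real \<Rightarrow> 'a::euclidean_space"
  assumes T: "0 \<le> T" and w: "\<And>i. i \<in> I \<Longrightarrow> L2 T (w i)"
    and bd: "\<And>G. finite G \<Longrightarrow> G \<subseteq> I \<Longrightarrow> (\<Sum>i\<in>G. l2norm T (w i)) \<le> C"
  shows "\<exists>s. L2_has_sum T w I s"
proof -
  define P where "P N = {i \<in> I. to_nat i < N}" for N
  have fP: "finite (P N)" for N
  proof (rule finite_imageD)
    show "finite (to_nat ` P N)" by (rule finite_subset[of _ "{..<N}"]) (auto simp: P_def)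
  qed (auto intro: inj_onI)
  define w' where "w' n = (if n \<in> to_nat ` I then w (from_nat n) else (\<lambda>t. 0))" for n
  have w'to: "w' (to_nat i) = w i" if "i \<in> I" for i using that by (simp add: w'_def)
  have w': "L2 T (w' n)" for n using w by (auto simp: w'_def)
  have part: "(\<Sum>n<N. l2norm T (w' n)) = (\<Sum>i\<in>P N. l2norm T (w i))" for N
  proof -
    have "(\<Sum>n<N. l2norm T (w' n)) = (\<Sum>n\<in>to_nat ` P N. l2norm T (w' n))"
      by (rule sum.mono_neutral_right) (auto simp: P_def w'_def)
    also have "\<dots> = (\<Sum>i\<in>P N. l2norm T (w' (to_nat i)))"
      by (subst sum.reindex) (auto intro: inj_onI)
    also have "\<dots> = (\<Sum>i\<in>P N. l2norm T (w i))"
      by (rule sum.cong) (auto simp: P_def w'to)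
    finally show ?thesis .
  qed
  have sm: "summable (\<lambda>n. l2norm T (w' n))"
    by (rule summableI_nonneg_bounded[of _ C])
       (use bd[OF fP] part in \<open>auto simp: P_def\<close>)
  obtain s where s: "L2 T s"
    and est: "\<And>G. finite G \<Longrightarrow> l2norm T (\<lambda>t. s t - (\<Sum>n\<in>G. w' n t))
       \<le> (\<Sum>n. l2norm T (w' n)) - (\<Sum>n\<in>G. l2norm T (w' n))"
    using L2_series_complete[OF T w' sm] by metis
  have "L2_has_sum T w I s"
    unfolding L2_has_sum_def
  proof (intro conjI allI impI s)
    fix e :: real assume e: "e > 0"
    have "(\<lambda>N. \<Sum>n<N. l2norm T (w' n)) \<longlonglongrightarrow> (\<Sum>n. l2norm T (w' n))"
      by (rule summable_LIMSEQ[OF sm])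
    then have "eventually (\<lambda>N. (\<Sum>n<N. l2norm T (w' n)) > (\<Sum>n. l2norm T (w' n)) - e) sequentially"
      by (rule order_tendstoD) (use e in simp)
    then obtain N where N: "(\<Sum>n<N. l2norm T (w' n)) > (\<Sum>n. l2norm T (w' n)) - e"
      by (auto simp: eventually_sequentially)
    show "\<exists>G0. finite G0 \<and> G0 \<subseteq> I \<and> (\<forall>G. finite G \<and> G0 \<subseteq> G \<and> G \<subseteq> I \<longrightarrow>
        l2norm T (\<lambda>t. (\<Sum>b\<in>G. w b t) - s t) < e)"
    proof (intro exI[of _ "P N"] conjI allI impI fP)
      show "P N \<subseteq> I" by (auto simp: P_def)
      fix G assume G: "finite G \<and> P N \<subseteq> G \<and> G \<subseteq> I"
      have re: "(\<Sum>n\<in>to_nat ` G. h (w' n)) = (\<Sum>i\<in>G. h (w i))" for h :: "_ \<Rightarrow> 'b::comm_monoid_add"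
        by (subst sum.reindex) (use G in \<open>auto intro!: inj_onI sum.cong simp: w'to subset_iff\<close>)
      have "l2norm T (\<lambda>t. (\<Sum>b\<in>G. w b t) - s t) = l2norm T (\<lambda>t. s t - (\<Sum>n\<in>to_nat ` G. w' n t))"
        using re[of "\<lambda>f. f _"] by (subst l2norm_minus_commute) simp
      also have "\<dots> \<le> (\<Sum>n. l2norm T (w' n)) - (\<Sum>n\<in>to_nat ` G. l2norm T (w' n))"
        using est G by simp
      also have "\<dots> \<le> (\<Sum>n. l2norm T (w' n)) - (\<Sum>n<N. l2norm T (w' n))"
        unfolding part re using G by (simp add: sum_mono2)
      also have "\<dots> < e" using N by simp
      finally show "l2norm T (\<lambda>t. (\<Sum>b\<in>G. w b t) - s t) < e" .
    qed
  qed
  then show ?thesis by blast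
qed

subsection \<open>Linear equations with square integrable forcing\<close>

lemma continuous_on_matrix_vector:
  "continuous_on S f \<Longrightarrow> continuous_on S (\<lambda>t. (M :: real^'n^'m) *v f t)"
  by (rule bounded_linear.continuous_on[OF matrix_vector_mul_bounded_linear])

text \<open>Integrating the bound for \<open>k\<close> produces the next Taylor term, hence the
  factorial. The sequence \<open>h\<close> is arbitrary apart from the recursion, so the lemma
  covers both the Picard iterates and a constant sequence formed by one homogeneous
  solution.\<close>

lemma volterra_iterates_bound:
  fixes M :: "real^'n^'n" and h :: "nat \<Rightarrow> real \<Rightarrow> real^'n"
  assumes h0: "\<And>t. t \<in> {0..T} \<Longrightarrow> norm (h 0 t) \<le> C"
    and cont: "\<And>k. continuous_on {0..T} (h k)"
    and step: "\<And>k t. t \<in> {0..T} \<Longrightarrow> h (Suc k) t = integral {0..t} (\<lambda>s. M *v h k s)"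
    and t: "t \<in> {0..T}"
  shows "norm (h k t) \<le> C * (onorm ((*v) M) * t) ^ k / fact k"
  using t
proof (induction k arbitrary: t)
  case 0
  then show ?case using h0 by simp
next
  case (Suc k)
  let ?m = "onorm ((*v) M)"
  have sub: "{0..t} \<subseteq> {0..T}" using Suc.prems by auto
  have c: "continuous_on {0..t} (\<lambda>s. M *v h k s)"
    by (rule continuous_on_subset[OF continuous_on_matrix_vector[OF cont] sub])
  have d: "((\<lambda>s. C * (?m * s) ^ Suc k / fact (Suc k)) has_vector_derivative
        ?m * (C * (?m * s) ^ k / fact k)) (at s within {0..t})" for s
  proof -
    have "((\<lambda>s. ?m * s) has_real_derivative ?m) (at s within {0..t})"
      using DERIV_cmult[OF DERIV_ident] by fastforce
    from DERIV_cdivide[OF DERIV_cmult[OF DERIV_power[OF this, of "Suc k"]]]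
    have "((\<lambda>s. C * (?m * s) ^ Suc k / fact (Suc k)) has_real_derivative
        C * (of_nat (Suc k) * (?m * (?m * s) ^ (Suc k - Suc 0))) / fact (Suc k)) (at s within {0..t})" .
    also have "C * (of_nat (Suc k) * (?m * (?m * s) ^ (Suc k - Suc 0))) / fact (Suc k) = ?m * (C * (?m * s) ^ k / fact k)"
      unfolding fact_Suc by (simp add: field_simps del: of_nat_Suc)
    finally show ?thesis by (simp add: has_real_derivative_iff_has_vector_derivative)
  qed
  have I: "((\<lambda>s. ?m * (C * (?m * s) ^ k / fact k)) has_integral
      C * (?m * t) ^ Suc k / fact (Suc k) - C * (?m * 0) ^ Suc k / fact (Suc k)) {0..t}"
    by (rule fundamental_theorem_of_calculus) (use Suc.prems d in auto)
  have "norm (h (Suc k) t) = norm (integral {0..t} (\<lambda>s. M *v h k s))"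
    using step[OF Suc.prems] by simp
  also have "\<dots> \<le> integral {0..t} (\<lambda>s. ?m * (C * (?m * s) ^ k / fact k))"
  proof (rule integral_norm_bound_integral)
    show "(\<lambda>s. M *v h k s) integrable_on {0..t}" by (rule integrable_continuous_real[OF c])
    show "(\<lambda>s. ?m * (C * (?m * s) ^ k / fact k)) integrable_on {0..t}" using I by blast
    fix s assume "s \<in> {0..t}"
    then have "norm (h k s) \<le> C * (?m * s) ^ k / fact k" using Suc sub by auto
    then have "?m * norm (h k s) \<le> ?m * (C * (?m * s) ^ k / fact k)"
      by (rule mult_left_mono) (rule onorm_matrix_nonneg)
    then show "norm (M *v h k s) \<le> ?m * (C * (?m * s) ^ k / fact k)"
      using norm_matrix_vector_le order_trans by blast
  qed
  also have "\<dots> = C * (?m * t) ^ Suc k / fact (Suc k)"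
    using integral_unique[OF I] by simp
  finally show ?case .
qed

text \<open>Neumann series: the factorial bound gives uniform convergence on the whole interval, so
  integral and sum may be exchanged termwise. The same majorant sums to the exponential in the final
  estimate.\<close>

lemma volterra_exists:
  fixes M :: "real^'n^'n" and h0 :: "real \<Rightarrow> real^'n"
  assumes T: "0 \<le> T" and h0: "continuous_on {0..T} h0" and C: "\<And>t. t \<in> {0..T} \<Longrightarrow> norm (h0 t) \<le> C"
  shows "\<exists>x. continuous_on {0..T} x \<and>
    (\<forall>t\<in>{0..T}. x t = h0 t + integral {0..t} (\<lambda>s. M *v x s)) \<and>
    (\<forall>t\<in>{0..T}. norm (x t) \<le> C * exp (onorm ((*v) M) * T))"
proof -
  let ?m = "onorm ((*v) M)"
  have m: "0 \<le> ?m" by (rule onorm_matrix_nonneg)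
  have "0 \<le> norm (h0 0)" by simp
  also have "\<dots> \<le> C" using C[of 0] T by simp
  finally have C0: "0 \<le> C" .
  define h where "h = rec_nat h0 (\<lambda>k g t. integral {0..t} (\<lambda>s. M *v g s))"
  have h_0: "h 0 = h0" and h_Suc: "h (Suc k) = (\<lambda>t. integral {0..t} (\<lambda>s. M *v h k s))" for k
    by (simp_all add: h_def)
  have cont: "continuous_on {0..T} (h k)" for k
  proof (induction k)
    case (Suc k)
    show ?case unfolding h_Suc
      by (rule indefinite_integral_continuous_1[OF integrable_continuous_real])
         (rule continuous_on_matrix_vector[OF Suc])
  qed (simp add: h_0 h0)
  have bd: "norm (h k t) \<le> C * (?m * T) ^ k / fact k" if t: "t \<in> {0..T}" for k t
  proof -
    have "norm (h k t) \<le> C * (?m * t) ^ k / fact k"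
      by (rule volterra_iterates_bound[where h=h, OF _ cont _ t]) (use C in \<open>auto simp: h_0 h_Suc\<close>)
    also have "\<dots> \<le> C * (?m * T) ^ k / fact k"
      using t m C0 by (intro divide_right_mono mult_left_mono power_mono) auto
    finally show ?thesis .
  qed
  have sm: "summable (\<lambda>k. C * (?m * T) ^ k / fact k)"
    using summable_mult[OF summable_exp[of "?m * T"], of C] by (simp add: field_simps)
  have ex: "(\<Sum>k. C * (?m * T) ^ k / fact k) = C * exp (?m * T)"
    using suminf_mult[OF summable_exp[of "?m * T"], of C]
    by (simp add: exp_def field_simps)
  define x where "x t = (\<Sum>k. h k t)" for t
  have ul: "uniform_limit {0..T} (\<lambda>N t. \<Sum>k<N. h k t) x sequentially"
    unfolding x_def[abs_def] by (rule Weierstrass_m_test[OF _ sm]) (use bd in auto)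
  have cx: "continuous_on {0..T} x"
    by (rule uniform_limit_theorem[OF _ ul]) (auto intro!: always_eventually continuous_on_sum cont)
  have eq: "x t = h0 t + integral {0..t} (\<lambda>s. M *v x s)" if t: "t \<in> {0..T}" for t
  proof -
    have sub: "{0..t} \<subseteq> {0..T}" using t by auto
    have ul': "uniform_limit {0..t} (\<lambda>N s. M *v (\<Sum>k<N. h k s)) (\<lambda>s. M *v x s) sequentially"
      by (rule bounded_linear.uniform_limit[OF matrix_vector_mul_bounded_linear uniform_limit_on_subset[OF ul sub]])
    obtain I J where IJ: "\<And>N. ((\<lambda>s. M *v (\<Sum>k<N. h k s)) has_integral I N) {0..t}"
      "((\<lambda>s. M *v x s) has_integral J) {0..t}" "I \<longlonglongrightarrow> J"
    proof (rule uniform_limit_integral[OF ul'])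
      show "continuous_on {0..t} (\<lambda>s. M *v (\<Sum>k<N. h k s))" for N
        by (intro continuous_on_matrix_vector continuous_on_sum continuous_on_subset[OF cont sub])
    qed auto
    have I: "I N = (\<Sum>k<N. h (Suc k) t)" for N
    proof -
      have "((\<lambda>s. \<Sum>k<N. M *v h k s) has_integral (\<Sum>k<N. h (Suc k) t)) {0..t}"
        unfolding h_Suc
        by (intro has_integral_sum integrable_integral integrable_continuous_real
            continuous_on_matrix_vector continuous_on_subset[OF cont sub]) simp
      then show ?thesis
        using IJ(1)[of N] has_integral_unique
        unfolding linear_sum[OF matrix_vector_mul_linear] by blast
    qed
    have s: "summable (\<lambda>k. h k t)"
      by (rule summable_comparison_test'[OF sm]) (use bd t in auto)
    have "(\<lambda>N. \<Sum>k<N. h (Suc k) t) \<longlonglongrightarrow> (\<Sum>k. h (Suc k) t)"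
      by (rule summable_LIMSEQ[OF summable_Suc_iff[THEN iffD2, OF s]])
    then have "I \<longlonglongrightarrow> (\<Sum>k. h (Suc k) t)"
      by (rule Lim_transform_eventually) (simp add: I)
    then have "J = (\<Sum>k. h (Suc k) t)" by (rule LIMSEQ_unique[OF IJ(3)])
    also have "\<dots> = x t - h0 t"
      using suminf_split_head[OF s] by (simp add: x_def h_0)
    finally show ?thesis using integral_unique[OF IJ(2)] by simp
  qed
  have "norm (x t) \<le> C * exp (?m * T)" if t: "t \<in> {0..T}" for t
    unfolding x_def ex[symmetric] by (rule norm_suminf_le[OF _ sm]) (use bd t in auto)
  with cx eq show ?thesis by blast
qed

text \<open>A homogeneous solution is its own iterate, so the factorial bound holds for it with
  every \<open>k\<close> and tends to 0.\<close>

lemma volterra_unique: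
  fixes M :: "real^'n^'n" and x :: "real \<Rightarrow> real^'n"
  assumes x: "continuous_on {0..T} x" and eq: "\<And>t. t \<in> {0..T} \<Longrightarrow> x t = integral {0..t} (\<lambda>s. M *v x s)"
    and t: "t \<in> {0..T}"
  shows "x t = 0"
proof -
  obtain C where C: "\<forall>t\<in>{0..T}. norm (x t) \<le> C"
    using compact_imp_bounded[OF compact_continuous_image[OF x compact_Icc]]
    unfolding bounded_iff by blast
  have "norm (x t) \<le> C * (onorm ((*v) M) * t) ^ k / fact k" for k
    by (rule volterra_iterates_bound[where h="\<lambda>k. x", OF _ x eq t]) (use C in auto)
  moreover have "(\<lambda>k. C * (onorm ((*v) M) * t) ^ k / fact k) \<longlonglongrightarrow> 0"
  proof (rule summable_LIMSEQ_zero)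
    show "summable (\<lambda>k. C * (onorm ((*v) M) * t) ^ k / fact k)"
      using summable_mult[OF summable_exp[of "onorm ((*v) M) * t"], of C] by (simp add: field_simps)
  qed
  ultimately have "norm (x t) \<le> 0"
    by (intro LIMSEQ_le_const) auto
  then show ?thesis by simp
qed

text \<open>The equation behind \<open>lin_sol\<close>, with gauge integrals and without the
  normalisation outside the interval.\<close>

definition solves :: "real \<Rightarrow> real^'n^'n \<Rightarrow> real^'n \<Rightarrow> (real \<Rightarrow> real^'n) \<Rightarrow> (real \<Rightarrow> real^'n) \<Rightarrow> bool" where
  "solves T M x0 f x \<longleftrightarrow> continuous_on {0..T} x \<and>
     (\<forall>t\<in>{0..T}. x t = x0 + integral {0..t} (\<lambda>s. M *v x s + f s))"

lemma solves_rhs_L2: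
  fixes M :: "real^'n^'m"
  assumes "continuous_on {0..T} x" "L2 T f" shows "L2 T (\<lambda>s. M *v x s + f s)"
  by (rule L2_add[OF L2_continuous[OF continuous_on_matrix_vector[OF assms(1)]] assms(2)])

lemma solves_iff_LINT:
  assumes "L2 T f"
  shows "solves T M x0 f x \<longleftrightarrow> continuous_on {0..T} x \<and>
     (\<forall>t\<in>{0..T}. x t = x0 + (LINT s|lebesgue_on {0..t}. M *v x s + f s))"
  unfolding solves_def
  by (intro conj_cong ball_cong refl) (simp only: LINT_eq_integral_0[OF solves_rhs_L2[OF _ assms]])

lemma solves_cont: "solves T M x0 f x \<Longrightarrow> continuous_on {0..T} x"
  by (simp add: solves_def)

lemma solves_eq: "solves T M x0 f x \<Longrightarrow> t \<in> {0..T} \<Longrightarrow> x t = x0 + integral {0..t} (\<lambda>s. M *v x s + f s)"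
  unfolding solves_def by blast

lemma solves_lincomb:
  assumes x: "solves T M x0 f x" and y: "solves T M y0 g y" and f: "L2 T f" and g: "L2 T g"
  shows "solves T M (a *\<^sub>R x0 + b *\<^sub>R y0) (\<lambda>t. a *\<^sub>R f t + b *\<^sub>R g t) (\<lambda>t. a *\<^sub>R x t + b *\<^sub>R y t)"
  unfolding solves_def
proof (intro conjI ballI)
  show "continuous_on {0..T} (\<lambda>t. a *\<^sub>R x t + b *\<^sub>R y t)"
    by (intro continuous_intros solves_cont[OF x] solves_cont[OF y])
  fix t assume t: "t \<in> {0..T}"
  then have sub: "{0..t} \<subseteq> {0..T}" by auto
  have i: "(\<lambda>s. M *v x s + f s) integrable_on {0..t}" "(\<lambda>s. M *v y s + g s) integrable_on {0..t}"
    by (auto intro!: integrable_on_Icc[OF L2_integrable sub] solves_rhs_L2 solves_cont[OF x] solves_cont[OF y] f g)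
  have "integral {0..t} (\<lambda>s. M *v (a *\<^sub>R x s + b *\<^sub>R y s) + (a *\<^sub>R f s + b *\<^sub>R g s))
     = integral {0..t} (\<lambda>s. a *\<^sub>R (M *v x s + f s) + b *\<^sub>R (M *v y s + g s))"
    by (simp add: algebra_simps matrix_vector_mult_scaleR)
  also have "\<dots> = a *\<^sub>R integral {0..t} (\<lambda>s. M *v x s + f s) + b *\<^sub>R integral {0..t} (\<lambda>s. M *v y s + g s)"
    using i by (simp only: Henstock_Kurzweil_Integration.integral_add integrable_cmul
        Henstock_Kurzweil_Integration.integral_cmul)
  finally show "a *\<^sub>R x t + b *\<^sub>R y t = a *\<^sub>R x0 + b *\<^sub>R y0 +
      integral {0..t} (\<lambda>s. M *v (a *\<^sub>R x s + b *\<^sub>R y s) + (a *\<^sub>R f s + b *\<^sub>R g s))"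
    unfolding solves_eq[OF x t] solves_eq[OF y t] scaleR_add_right by (simp only: add_ac)
qed

lemma solves_unique:
  assumes x: "solves T M x0 f x" and y: "solves T M x0 f y" and f: "L2 T f" and t: "t \<in> {0..T}"
  shows "x t = y t"
proof -
  have d: "solves T M (1 *\<^sub>R x0 + (-1) *\<^sub>R x0) (\<lambda>t. 1 *\<^sub>R f t + (-1) *\<^sub>R f t) (\<lambda>t. 1 *\<^sub>R x t + (-1) *\<^sub>R y t)"
    by (rule solves_lincomb[OF x y f f])
  have "1 *\<^sub>R x t + (-1) *\<^sub>R y t = 0"
    by (rule volterra_unique[OF solves_cont[OF d] _ t]) (use solves_eq[OF d] in simp)
  then show ?thesis by simp
qed

lemma solves_cong:
  assumes x: "solves T M x0 f x" and eq: "\<And>t. t \<in> {0..T} \<Longrightarrow> x t = y t"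
  shows "solves T M x0 f y"
  unfolding solves_def
proof (intro conjI ballI)
  show "continuous_on {0..T} y" using solves_cont[OF x] eq continuous_on_cong by metis
  fix t assume t: "t \<in> {0..T}"
  have "integral {0..t} (\<lambda>s. M *v x s + f s) = integral {0..t} (\<lambda>s. M *v y s + f s)"
    by (rule Henstock_Kurzweil_Integration.integral_cong) (use t eq in auto)
  then show "y t = x0 + integral {0..t} (\<lambda>s. M *v y s + f s)"
    using solves_eq[OF x t] eq[OF t] by metis
qed

text \<open>The forcing is absorbed into the free term: \<open>x0\<close> plus the indefinite
  integral of \<open>f\<close> is continuous even though \<open>f\<close> is only L2, and the
  Volterra equation for continuous data applies.\<close>

lemma solves_exists:
  fixes M :: "real^'n^'n"
  assumes T: "0 \<le> T" and f: "L2 T f"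
  shows "\<exists>x. solves T M x0 f x \<and>
    (\<forall>t\<in>{0..T}. norm (x t) \<le> (norm x0 + sqrt T * l2norm T f) * exp (onorm ((*v) M) * T))"
proof -
  have fi: "f integrable_on {0..T}" using integrable_on_Icc[OF L2_integrable[OF f], of 0 T] by simp
  have c: "continuous_on {0..T} (\<lambda>t. x0 + integral {0..t} f)"
    by (intro continuous_intros indefinite_integral_continuous_1 fi)
  have "norm (x0 + integral {0..t} f) \<le> norm x0 + sqrt T * l2norm T f" if "t \<in> {0..T}" for t
    by (rule order_trans[OF norm_triangle_ineq]) (use norm_integral_le_L2[OF f that] in simp)
  from volterra_exists[where M=M, OF T c this] obtain x where
    x: "continuous_on {0..T} x" "\<forall>t\<in>{0..T}. x t = x0 + integral {0..t} f + integral {0..t} (\<lambda>s. M *v x s)"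
    "\<forall>t\<in>{0..T}. norm (x t) \<le> (norm x0 + sqrt T * l2norm T f) * exp (onorm ((*v) M) * T)"
    by blast
  have "x0 + integral {0..t} f + integral {0..t} (\<lambda>s. M *v x s) = x0 + integral {0..t} (\<lambda>s. M *v x s + f s)"
    if t: "t \<in> {0..T}" for t
  proof -
    have sub: "{0..t} \<subseteq> {0..T}" using t by auto
    have "integral {0..t} (\<lambda>s. M *v x s + f s) = integral {0..t} (\<lambda>s. M *v x s) + integral {0..t} f"
    proof (rule Henstock_Kurzweil_Integration.integral_add)
      show "(\<lambda>s. M *v x s) integrable_on {0..t}"
        by (rule integrable_continuous_real[OF continuous_on_subset[OF continuous_on_matrix_vector[OF x(1)] sub]])
      show "f integrable_on {0..t}" by (rule integrable_on_Icc[OF L2_integrable[OF f] sub])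
    qed
    then show ?thesis by simp
  qed
  with x show ?thesis unfolding solves_def by (metis (no_types, lifting))
qed

text \<open>The description by \<open>THE\<close> is legitimate since solutions agree on the
  interval and are prescribed off it. The conclusion is therefore an equality of functions on the
  whole line.\<close>

lemma lin_sol_eqI:
  assumes f: "L2 T f" and x: "solves T M x0 f x" and out: "\<And>t. t \<notin> {0..T} \<Longrightarrow> x t = 0"
  shows "lin_sol T M x0 f = x"
  unfolding lin_sol_def
proof (rule the_equality)
  show "continuous_on {0..T} x \<and> (\<forall>t. t \<notin> {0..T} \<longrightarrow> x t = 0) \<and>
      (\<forall>t\<in>{0..T}. x t = x0 + (LINT s|lebesgue_on {0..t}. M *v x s + f s))"
    using x out unfolding solves_iff_LINT[OF f] by blast
  fix y assume y: "continuous_on {0..T} y \<and> (\<forall>t. t \<notin> {0..T} \<longrightarrow> y t = 0) \<and>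
      (\<forall>t\<in>{0..T}. y t = x0 + (LINT s|lebesgue_on {0..t}. M *v y s + f s))"
  then have "solves T M x0 f y" unfolding solves_iff_LINT[OF f] by blast
  from solves_unique[OF this x f] y out show "y = x" by (metis ext)
qed

lemma lin_sol_props:
  assumes T: "0 \<le> T" and f: "L2 T f"
  shows "solves T M x0 f (lin_sol T M x0 f)"
    and "t \<notin> {0..T} \<Longrightarrow> lin_sol T M x0 f t = 0"
    and "t \<in> {0..T} \<Longrightarrow> norm (lin_sol T M x0 f t) \<le> (norm x0 + sqrt T * l2norm T f) * exp (onorm ((*v) M) * T)"
proof -
  obtain x where x: "solves T M x0 f x"
    "\<forall>t\<in>{0..T}. norm (x t) \<le> (norm x0 + sqrt T * l2norm T f) * exp (onorm ((*v) M) * T)"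
    using solves_exists[OF T f] by blast
  define y where "y t = (if t \<in> {0..T} then x t else 0)" for t
  have "solves T M x0 f y" by (rule solves_cong[OF x(1)]) (simp add: y_def)
  moreover have "lin_sol T M x0 f = y"
    by (rule lin_sol_eqI[OF f calculation]) (simp only: y_def if_False)
  ultimately show "solves T M x0 f (lin_sol T M x0 f)"
    "t \<notin> {0..T} \<Longrightarrow> lin_sol T M x0 f t = 0"
    "t \<in> {0..T} \<Longrightarrow> norm (lin_sol T M x0 f t) \<le> (norm x0 + sqrt T * l2norm T f) * exp (onorm ((*v) M) * T)"
    using x(2) by (auto simp: y_def)
qed

lemma lin_sol_lincomb:
  assumes T: "0 \<le> T" and f: "L2 T f" and g: "L2 T g"
  shows "lin_sol T M (a *\<^sub>R x0 + b *\<^sub>R y0) (\<lambda>t. a *\<^sub>R f t + b *\<^sub>R g t)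
    = (\<lambda>t. a *\<^sub>R lin_sol T M x0 f t + b *\<^sub>R lin_sol T M y0 g t)"
proof (rule lin_sol_eqI)
  show "L2 T (\<lambda>t. a *\<^sub>R f t + b *\<^sub>R g t)" by (intro L2_add L2_scaleR f g)
  show "solves T M (a *\<^sub>R x0 + b *\<^sub>R y0) (\<lambda>t. a *\<^sub>R f t + b *\<^sub>R g t)
    (\<lambda>t. a *\<^sub>R lin_sol T M x0 f t + b *\<^sub>R lin_sol T M y0 g t)"
    by (rule solves_lincomb[OF lin_sol_props(1)[OF T f] lin_sol_props(1)[OF T g] f g])
qed (simp add: lin_sol_props(2)[OF T f] lin_sol_props(2)[OF T g])

lemma lin_sol_zero: "0 \<le> T \<Longrightarrow> lin_sol T M 0 (\<lambda>t. 0) = (\<lambda>t. 0)"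
  by (rule lin_sol_eqI) (auto simp: solves_def)

lemma lin_sol_sum:
  assumes T: "0 \<le> T" and f: "\<And>i. i \<in> I \<Longrightarrow> L2 T (f i)"
  shows "lin_sol T M (\<Sum>i\<in>I. x i) (\<lambda>t. \<Sum>i\<in>I. f i t) = (\<lambda>t. \<Sum>i\<in>I. lin_sol T M (x i) (f i) t)"
  using f
proof (induction I rule: infinite_finite_induct)
  case (insert i I)
  have "lin_sol T M (1 *\<^sub>R x i + 1 *\<^sub>R (\<Sum>i\<in>I. x i)) (\<lambda>t. 1 *\<^sub>R f i t + 1 *\<^sub>R (\<Sum>i\<in>I. f i t))
    = (\<lambda>t. 1 *\<^sub>R lin_sol T M (x i) (f i) t + 1 *\<^sub>R lin_sol T M (\<Sum>i\<in>I. x i) (\<lambda>t. \<Sum>i\<in>I. f i t) t)"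
    by (rule lin_sol_lincomb[OF T]) (use insert in \<open>auto intro: L2_sum\<close>)
  with insert show ?case by simp
qed (simp_all add: lin_sol_zero[OF T])

lemma ae_eq_integral_cong:
  assumes fg: "ae_eq T f g" and f: "L2 T f" and g: "L2 T g" and t: "t \<in> {0..T}"
  shows "integral {0..t} f = integral {0..t} g"
proof -
  have "AE s in lebesgue_on {0..t}. f s = g s"
    using fg t unfolding ae_eq_def by (auto simp: AE_restrict_space_iff elim!: eventually_mono)
  moreover have "integrable (lebesgue_on {0..t}) f" "integrable (lebesgue_on {0..t}) g"
    using integrable_subinterval[OF L2_integrable] f g t by auto
  ultimately have "(LINT s|lebesgue_on {0..t}. f s) = (LINT s|lebesgue_on {0..t}. g s)"
    by (intro integral_cong_AE) auto
  then show ?thesis by (simp add: LINT_eq_integral_0[OF f t] LINT_eq_integral_0[OF g t])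
qed

text \<open>Here identities valid almost everywhere turn into genuine equalities: only integrals of
  the forcing enter the equation.\<close>

lemma lin_sol_AE_cong:
  assumes T: "0 \<le> T" and f: "L2 T f" and g: "L2 T g" and fg: "ae_eq T f g"
  shows "lin_sol T M x0 f = lin_sol T M x0 g"
proof (rule lin_sol_eqI[OF f])
  let ?x = "lin_sol T M x0 g"
  have x: "solves T M x0 g ?x" by (rule lin_sol_props(1)[OF T g])
  show "solves T M x0 f ?x"
    unfolding solves_def
  proof (intro conjI ballI solves_cont[OF x])
    fix t assume t: "t \<in> {0..T}"
    have "integral {0..t} (\<lambda>s. M *v ?x s + f s) = integral {0..t} (\<lambda>s. M *v ?x s + g s)"
      by (rule ae_eq_integral_cong[OF _ _ _ t])
         (use fg in \<open>auto intro!: solves_rhs_L2 solves_cont[OF x] f g simp: ae_eq_def\<close>)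
    then show "?x t = x0 + integral {0..t} (\<lambda>s. M *v ?x s + f s)"
      using solves_eq[OF x t] by metis
  qed
qed (simp add: lin_sol_props(2)[OF T g])

lemma solves_0: "solves T M x0 f x \<Longrightarrow> 0 \<le> T \<Longrightarrow> x 0 = x0"
  using solves_eq[of T M x0 f x 0] by simp

lemma solves_weak_deriv:
  assumes x: "solves T M x0 f x" and T: "0 \<le> T" and f: "L2 T f"
  shows "weak_deriv_of T x (\<lambda>s. M *v x s + f s)"
  unfolding weak_deriv_of_iff solves_0[OF x T]
  using solves_rhs_L2[OF solves_cont[OF x] f] x unfolding solves_def by blast

lemma lin_sol_in_S:
  assumes "0 \<le> T" "L2 T f" shows "in_S T (lin_sol T M x0 f)"
  using solves_weak_deriv[OF lin_sol_props(1)] solves_cont[OF lin_sol_props(1)] assms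
  unfolding in_S_def by blast

text \<open>The uniform estimate yields the L2 estimate through a factor \<open>sqrt T\<close>, and
  the S estimate because the weak derivative is \<open>M x + f\<close>. The constant depends on
  \<open>T\<close> and \<open>M\<close> only.\<close>

lemma lin_sol_bound:
  fixes M :: "real^'n^'n"
  assumes T: "0 \<le> T"
  obtains K where "0 \<le> K"
    "\<And>x0 f t. L2 T f \<Longrightarrow> t \<in> {0..T} \<Longrightarrow> norm (lin_sol T M x0 f t) \<le> K * (norm x0 + l2norm T f)"
    "\<And>x0 f. L2 T f \<Longrightarrow> l2norm T (lin_sol T M x0 f) \<le> K * (norm x0 + l2norm T f)"
    "\<And>x0 f. L2 T f \<Longrightarrow> S_norm T (lin_sol T M x0 f) \<le> K * (norm x0 + l2norm T f)"
proof -
  let ?m = "onorm ((*v) M)"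
  have m: "0 \<le> ?m" by (rule onorm_matrix_nonneg)
  define k where "k = (1 + sqrt T) * exp (?m * T)"
  have k0: "0 \<le> k" using T by (simp add: k_def)
  define l where "l = k * sqrt T"
  have l0: "0 \<le> l" using T k0 by (simp add: l_def)
  have b: "norm (lin_sol T M x0 f t) \<le> k * (norm x0 + l2norm T f)" if f: "L2 T f" and t: "t \<in> {0..T}" for x0 f t
  proof -
    have "norm x0 + sqrt T * l2norm T f \<le> (1 + sqrt T) * (norm x0 + l2norm T f)"
      using T by (simp add: algebra_simps)
    then have "(norm x0 + sqrt T * l2norm T f) * exp (?m * T) \<le> (1 + sqrt T) * (norm x0 + l2norm T f) * exp (?m * T)"
      by (rule mult_right_mono) simp
    also have "\<dots> = k * (norm x0 + l2norm T f)" by (simp add: k_def mult_ac)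
    finally show ?thesis using lin_sol_props(3)[OF T f t, of M x0] by linarith
  qed
  have b2: "l2norm T (lin_sol T M x0 f) \<le> l * (norm x0 + l2norm T f)" if f: "L2 T f" for x0 f
  proof -
    have "l2norm T (lin_sol T M x0 f) \<le> k * (norm x0 + l2norm T f) * sqrt T"
      by (rule L2_bounded_on(2)[OF continuous_imp_measurable_on_sets_lebesgue[OF solves_cont[OF lin_sol_props(1)[OF T f]]] b[OF f] _ T])
         (use k0 in auto)
    then show ?thesis by (simp add: l_def mult_ac)
  qed
  have b3: "S_norm T (lin_sol T M x0 f) \<le> (l + ?m * l + 1) * (norm x0 + l2norm T f)" if f: "L2 T f" for x0 f
  proof -
    let ?x = "lin_sol T M x0 f"
    have x: "solves T M x0 f ?x" by (rule lin_sol_props(1)[OF T f])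
    have Lx: "L2 T ?x" by (rule L2_continuous[OF solves_cont[OF x]])
    have "l2norm T (\<lambda>s. M *v ?x s + f s) \<le> l2norm T (\<lambda>s. M *v ?x s) + l2norm T f"
      by (rule l2norm_triangle[OF L2_matrix(1)[OF Lx] f])
    also have "l2norm T (\<lambda>s. M *v ?x s) \<le> ?m * l2norm T ?x" by (rule L2_matrix(2)[OF Lx])
    also have "\<dots> \<le> ?m * (l * (norm x0 + l2norm T f))" by (rule mult_left_mono[OF b2[OF f] m])
    finally have "S_norm T ?x \<le> l * (norm x0 + l2norm T f) + (?m * (l * (norm x0 + l2norm T f)) + l2norm T f)"
      using S_norm_le[OF solves_weak_deriv[OF x T f]] b2[OF f, of x0] by simp
    also have "\<dots> \<le> (l + ?m * l + 1) * (norm x0 + l2norm T f)" by (simp add: algebra_simps)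
    finally show ?thesis .
  qed
  \<comment> \<open>This dominates each of the constants \<open>k\<close>, \<open>l\<close> and
    \<open>l + ?m * l + 1\<close> of the three estimates.\<close>
  define K where "K = k + (l + ?m * l + 1)"
  have up: "c \<le> K * (norm (x0::real^'n) + l2norm T f)" if "c \<le> d * (norm x0 + l2norm T f)" "d \<le> K"
    for c d x0 and f :: "real \<Rightarrow> real^'n"
    using that mult_right_mono[OF that(2), of "norm x0 + l2norm T f"] by simp
  have ml: "0 \<le> ?m * l" using m l0 by simp
  show ?thesis
  proof (rule that[of K])
    show "0 \<le> K" using k0 l0 ml by (simp add: K_def)
  qed (rule up[OF b] up[OF b2] up[OF b3]; use k0 l0 ml in \<open>simp add: K_def\<close>)+
qed

subsection \<open>Duality with the adjoint equation\<close>

text \<open>Over a uniform partition of mesh below \<open>d\<close> the increments telescope to a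
  bound by \<open>e * (H T - H 0)\<close>, with \<open>e\<close> arbitrary. This takes the place of
  differentiating \<open>D\<close>.\<close>

lemma eq_ends_if_small_increments:
  fixes D H :: "real \<Rightarrow> real"
  assumes T: "0 \<le> T"
    and small: "\<And>e. e > 0 \<Longrightarrow> \<exists>d>0. \<forall>s t. 0 \<le> s \<longrightarrow> s \<le> t \<longrightarrow> t \<le> T \<longrightarrow> t - s < d \<longrightarrow> \<bar>D t - D s\<bar> \<le> e * (H t - H s)"
  shows "D T = D 0"
proof (rule ccontr)
  assume ne: "D T \<noteq> D 0"
  \<comment> \<open>\<open>c\<close> is positive and bounds \<open>H T - H 0\<close>; with the
    \<open>e\<close> chosen below, the telescoped bound is half of the distance between
    \<open>D T\<close> and \<open>D 0\<close>, a contradiction.\<close>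
  define c where "c = \<bar>H T - H 0\<bar> + 1"
  have c: "0 < c" unfolding c_def by (rule add_nonneg_pos) auto
  define e where "e = \<bar>D T - D 0\<bar> / (2 * c)"
  have e: "e > 0" using ne c by (simp add: e_def)
  from small[OF this] obtain d where d: "d > 0"
    "\<And>s t. 0 \<le> s \<Longrightarrow> s \<le> t \<Longrightarrow> t \<le> T \<Longrightarrow> t - s < d \<Longrightarrow> \<bar>D t - D s\<bar> \<le> e * (H t - H s)"
    by blast
  obtain n where n: "real (Suc n) > T / d"
    using reals_Archimedean2 less_trans by (metis lessI of_nat_less_iff)
  define t where "t i = real i * (T / real (Suc n))" for i
  have step: "T / real (Suc n) < d" using n d by (simp add: field_simps)
  have "\<bar>D (t i) - D 0\<bar> \<le> e * (H (t i) - H 0)" if "i \<le> Suc n" for i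
    using that
  proof (induction i)
    case (Suc i)
    have "t (Suc i) \<le> T"
    proof -
      have "t (Suc i) \<le> real (Suc n) * (T / real (Suc n))"
        unfolding t_def using Suc.prems T by (intro mult_right_mono) auto
      then show ?thesis by simp
    qed
    moreover have "t (Suc i) - t i = T / real (Suc n)"
      by (simp add: t_def algebra_simps add_divide_distrib)
    moreover have "0 \<le> t i" using T by (simp add: t_def)
    moreover have "t i \<le> t (Suc i)"
      unfolding t_def by (rule mult_right_mono) (use T in auto)
    ultimately have "\<bar>D (t (Suc i)) - D (t i)\<bar> \<le> e * (H (t (Suc i)) - H (t i))"
      using step by (intro d(2)) auto
    moreover have "\<bar>D (t i) - D 0\<bar> \<le> e * (H (t i) - H 0)" using Suc by simp
    ultimately show ?case unfolding right_diff_distrib by linarith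
  qed (simp add: t_def)
  from this[of "Suc n"] have "\<bar>D T - D 0\<bar> \<le> e * (H T - H 0)" by (simp add: t_def)
  also have "\<dots> \<le> e * c" using e by (intro mult_left_mono) (auto simp: c_def)
  also have "\<dots> = \<bar>D T - D 0\<bar> / 2" using c by (simp add: e_def)
  finally show False using ne by simp
qed

lemma weak_deriv_continuous:
  assumes "weak_deriv_of T x g" shows "continuous_on {0..T} x"
proof -
  have "continuous_on {0..T} (\<lambda>t. x 0 + integral {0..t} g)"
    using integrable_on_Icc[OF L2_integrable[OF weak_deriv_L2[OF assms]], of 0 T]
    by (intro continuous_intros indefinite_integral_continuous_1) simp
  then show ?thesis
    using weak_deriv_of_integral[OF assms] continuous_on_cong by (metis (no_types, lifting))
qed

lemma weak_deriv_increment: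
  assumes x: "weak_deriv_of T x g" and "0 \<le> s" "s \<le> t" "t \<le> T"
  shows "x t - x s = integral {s..t} g"
proof -
  have sub: "{0..t} \<subseteq> {0..T}" using assms by auto
  have "integral {0..s} g + integral {s..t} g = integral {0..t} g"
    by (rule Henstock_Kurzweil_Integration.integral_combine)
       (use assms integrable_on_Icc[OF L2_integrable[OF weak_deriv_L2[OF x]] sub] in auto)
  moreover have "x s = x 0 + integral {0..s} g" "x t = x 0 + integral {0..t} g"
    using assms by (auto intro!: weak_deriv_of_integral[OF x])
  ultimately show ?thesis by (simp add: algebra_simps)
qed

lemma integral_inner_const:
  fixes f :: "real \<Rightarrow> 'a::euclidean_space"
  assumes "f integrable_on S"
  shows "(\<lambda>u. f u \<bullet> c) integrable_on S" "integral S (\<lambda>u. f u \<bullet> c) = integral S f \<bullet> c"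
  using integrable_linear[OF assms bounded_linear_inner_left[of c]]
    integral_linear[OF assms bounded_linear_inner_left[of c]] by (simp_all add: o_def)

text \<open>The functions are merely absolutely continuous; the increments of
  \<^term>\<open>x t \<bullet> y t - integral {0..t} (\<lambda>u. g u \<bullet> y u + x u \<bullet> h u)\<close> are small compared with those
  of \<^term>\<open>integral {0..t} (\<lambda>u. norm (g u) + norm (h u))\<close>, by uniform continuity.\<close>

lemma weak_deriv_inner:
  fixes x y :: "real \<Rightarrow> 'a::euclidean_space"
  assumes T: "0 \<le> T" and x: "weak_deriv_of T x g" and y: "weak_deriv_of T y h"
  shows "x T \<bullet> y T = x 0 \<bullet> y 0 + integral {0..T} (\<lambda>u. g u \<bullet> y u + x u \<bullet> h u)"
proof -
  note g = weak_deriv_L2[OF x] and h = weak_deriv_L2[OF y]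
  note cx = weak_deriv_continuous[OF x] and cy = weak_deriv_continuous[OF y]
  note Lx = L2_continuous[OF cx] and Ly = L2_continuous[OF cy]
  have i_gy: "integrable (lebesgue_on {0..T}) (\<lambda>u. g u \<bullet> y u + x u \<bullet> h u)"
    using integrable_inner_L2[OF g Ly] integrable_inner_L2[OF Lx h] by simp
  have i_n: "integrable (lebesgue_on {0..T}) (\<lambda>u. norm (g u) + norm (h u))"
    using L2_integrable[OF g] L2_integrable[OF h] by simp
  define D where "D t = x t \<bullet> y t - integral {0..t} (\<lambda>u. g u \<bullet> y u + x u \<bullet> h u)" for t
  define H where "H t = integral {0..t} (\<lambda>u. norm (g u) + norm (h u))" for t
  have "D T = D 0"
  proof (rule eq_ends_if_small_increments[where H=H, OF T])
    fix e :: real assume e: "e > 0"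
    have "uniformly_continuous_on {0..T} x" "uniformly_continuous_on {0..T} y"
      using cx cy by (auto intro: compact_uniformly_continuous)
    then obtain d1 d2 where d1: "d1 > 0" "\<And>s t. s \<in> {0..T} \<Longrightarrow> t \<in> {0..T} \<Longrightarrow> \<bar>t - s\<bar> < d1 \<Longrightarrow> norm (x t - x s) < e"
      and d2: "d2 > 0" "\<And>s t. s \<in> {0..T} \<Longrightarrow> t \<in> {0..T} \<Longrightarrow> \<bar>t - s\<bar> < d2 \<Longrightarrow> norm (y t - y s) < e"
      unfolding uniformly_continuous_on_def dist_norm real_norm_def using e by metis
    show "\<exists>d>0. \<forall>s t. 0 \<le> s \<longrightarrow> s \<le> t \<longrightarrow> t \<le> T \<longrightarrow> t - s < d \<longrightarrow> \<bar>D t - D s\<bar> \<le> e * (H t - H s)"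
    proof (intro exI[of _ "min d1 d2"] conjI allI impI)
      show "0 < min d1 d2" using d1 d2 by simp
      fix s t assume st: "0 \<le> s" "s \<le> t" "t \<le> T" "t - s < min d1 d2"
      have sub: "{s..t} \<subseteq> {0..T}" and sub0: "{0..t} \<subseteq> {0..T}" using st by auto
      note I = integrable_on_Icc[OF _ sub]
      have gi: "g integrable_on {s..t}" and hi: "h integrable_on {s..t}"
        using L2_integrable g h by (auto intro: I)
      have comb: "integral {0..t} k - integral {0..s} k = integral {s..t} k"
        if "integrable (lebesgue_on {0..T}) k" for k :: "real \<Rightarrow> real"
        using Henstock_Kurzweil_Integration.integral_combine[of 0 s t k] integrable_on_Icc[OF that sub0] st by simp
      have "x t \<bullet> y t - x s \<bullet> y s = (x t - x s) \<bullet> y t + (y t - y s) \<bullet> x s"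
        by (simp add: inner_diff_left inner_commute[of "y _"])
      also have "\<dots> = integral {s..t} (\<lambda>u. g u \<bullet> y t) + integral {s..t} (\<lambda>u. h u \<bullet> x s)"
        using weak_deriv_increment[OF x st(1-3)] weak_deriv_increment[OF y st(1-3)]
        by (simp add: integral_inner_const(2)[OF gi] integral_inner_const(2)[OF hi])
      also have "\<dots> = integral {s..t} (\<lambda>u. g u \<bullet> y t + h u \<bullet> x s)"
        by (rule Henstock_Kurzweil_Integration.integral_add[symmetric])
           (intro integral_inner_const(1) gi hi)+
      finally have "D t - D s = integral {s..t} (\<lambda>u. g u \<bullet> y t + h u \<bullet> x s)
          - integral {s..t} (\<lambda>u. g u \<bullet> y u + x u \<bullet> h u)"
        using comb[OF i_gy] by (simp add: D_def)
      also have "\<dots> = integral {s..t} (\<lambda>u. (g u \<bullet> y t + h u \<bullet> x s) - (g u \<bullet> y u + x u \<bullet> h u))"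
        by (rule Henstock_Kurzweil_Integration.integral_diff[symmetric])
           (intro integrable_add integral_inner_const(1) gi hi I[OF i_gy])+
      finally have Dts: "D t - D s = integral {s..t} (\<lambda>u. (g u \<bullet> y t + h u \<bullet> x s) - (g u \<bullet> y u + x u \<bullet> h u))" .
      have "norm (D t - D s) \<le> integral {s..t} (\<lambda>u. e * (norm (g u) + norm (h u)))"
        unfolding Dts
      proof (rule integral_norm_bound_integral)
        show "(\<lambda>u. (g u \<bullet> y t + h u \<bullet> x s) - (g u \<bullet> y u + x u \<bullet> h u)) integrable_on {s..t}"
          by (intro integrable_diff integrable_add integral_inner_const(1) gi hi I[OF i_gy])
        show "(\<lambda>u. e * (norm (g u) + norm (h u))) integrable_on {s..t}"
          by (rule I) (use i_n in simp)
        fix u assume u: "u \<in> {s..t}"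
        have a: "\<bar>g u \<bullet> (y t - y u)\<bar> \<le> norm (g u) * e"
          using d2(2)[of u t] u st by (intro order_trans[OF Cauchy_Schwarz_ineq2] mult_left_mono) auto
        have b: "\<bar>h u \<bullet> (x s - x u)\<bar> \<le> norm (h u) * e"
          using d1(2)[of u s] u st by (intro order_trans[OF Cauchy_Schwarz_ineq2] mult_left_mono) auto
        have "(g u \<bullet> y t + h u \<bullet> x s) - (g u \<bullet> y u + x u \<bullet> h u) = g u \<bullet> (y t - y u) + h u \<bullet> (x s - x u)"
          by (simp add: inner_diff_right inner_commute)
        then show "norm ((g u \<bullet> y t + h u \<bullet> x s) - (g u \<bullet> y u + x u \<bullet> h u)) \<le> e * (norm (g u) + norm (h u))"
          using a b by (simp add: algebra_simps)
      qed
      also have "\<dots> = e * (H t - H s)"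
        using comb[OF i_n] by (simp add: H_def)
      finally show "\<bar>D t - D s\<bar> \<le> e * (H t - H s)" by simp
    qed
  qed
  then show ?thesis by (simp add: D_def)
qed

lemma inner_transpose_matrix_vector: "x \<bullet> (transpose (A :: real^'n^'m) *v y) = (A *v x) \<bullet> y"
  by (metis transpose_matrix_vector dot_lmul_matrix inner_commute)

lemma minus_matrix_vector: "(- (A :: real^'n^'m)) *v x = - (A *v x)"
  by (simp add: vec_eq_iff matrix_vector_mult_def sum_negf)

lemma adj_sol_solves: "0 \<le> T \<Longrightarrow> solves T (- transpose A) z (\<lambda>t. 0) (adj_sol T A z)"
  unfolding adj_sol_def by (rule lin_sol_props(1)) auto

lemma adj_sol_lincomb:
  assumes "0 \<le> T"
  shows "adj_sol T A (a *\<^sub>R z + b *\<^sub>R w) = (\<lambda>t. a *\<^sub>R adj_sol T A z t + b *\<^sub>R adj_sol T A w t)"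
  using lin_sol_lincomb[OF assms L2_zero L2_zero, of "- transpose A" a z b w] by (simp add: adj_sol_def)

lemma adj_sol_L2: "0 \<le> T \<Longrightarrow> L2 T (adj_sol T A z)"
  by (rule L2_continuous[OF solves_cont[OF adj_sol_solves]])

text \<open>Integration by parts: the terms with \<open>A\<close> and with
  \<open>- transpose A\<close> cancel, and only the forcing remains.\<close>

lemma lin_sol_duality:
  assumes T: "0 \<le> T" and f: "L2 T f"
  shows "lin_sol T A x0 f T \<bullet> adj_sol T A z T = x0 \<bullet> z + (LINT t|lebesgue_on {0..T}. adj_sol T A z t \<bullet> f t)"
proof -
  let ?x = "lin_sol T A x0 f" and ?z = "adj_sol T A z"
  note x = lin_sol_props(1)[OF T f, of A x0] and z = adj_sol_solves[OF T, of A z]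
  have "?x T \<bullet> ?z T = ?x 0 \<bullet> ?z 0 + integral {0..T} (\<lambda>u. (A *v ?x u + f u) \<bullet> ?z u + ?x u \<bullet> (- transpose A *v ?z u + 0))"
    by (rule weak_deriv_inner[OF T solves_weak_deriv[OF x T f] solves_weak_deriv[OF z T L2_zero]])
  also have "(\<lambda>u. (A *v ?x u + f u) \<bullet> ?z u + ?x u \<bullet> (- transpose A *v ?z u + 0)) = (\<lambda>u. ?z u \<bullet> f u)"
  proof
    fix u
    have "?x u \<bullet> (transpose A *v ?z u) = (A *v ?x u) \<bullet> ?z u" by (rule inner_transpose_matrix_vector)
    then show "(A *v ?x u + f u) \<bullet> ?z u + ?x u \<bullet> (- transpose A *v ?z u + 0) = ?z u \<bullet> f u"
      unfolding minus_matrix_vector inner_add_left inner_minus_right add_0_right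
      by (simp del: transpose_matrix_vector add: inner_commute)
  qed
  also have "integral {0..T} (\<lambda>u. ?z u \<bullet> f u) = (LINT t|lebesgue_on {0..T}. ?z t \<bullet> f t)"
    by (rule LINT_eq_integral[symmetric]) (use integrable_inner_L2[OF adj_sol_L2[OF T] f] in auto)
  finally show ?thesis using solves_0[OF x T] solves_0[OF z T] by simp
qed

text \<open>If the adjoint solution from \<open>z\<close> ends at 0, duality with the free solution
  started at \<open>z\<close> gives \<open>z \<bullet> z = 0\<close>. So the final value is an
  injective linear function of \<open>z\<close>, hence surjective in finite dimension.\<close>

lemma adj_sol_final_surj:
  assumes T: "0 \<le> T" shows "\<exists>z. adj_sol T A z T = y"
proof -
  have lin: "linear (\<lambda>z. adj_sol T A z T)"
    using adj_sol_lincomb[OF T, of A 1 _ 1] adj_sol_lincomb[OF T, of A _ _ 0 0]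
    by (intro linearI) (simp_all add: fun_eq_iff)
  have "inj (\<lambda>z. adj_sol T A z T)"
  proof (subst linear_injective_0[OF lin], intro allI impI)
    fix z assume "adj_sol T A z T = 0"
    with lin_sol_duality[OF T L2_zero, of A z z] show "z = 0" by simp
  qed
  from linear_injective_imp_surjective[OF lin this] show ?thesis by (metis surjD)
qed

text \<open>Duality is tested with the adjoint solution that ends at the final state itself, so the
  left-hand side becomes its squared norm.\<close>

lemma lin_sol_final_zero:
  assumes T: "0 \<le> T" and f: "L2 T f"
    and orth: "\<And>z. x0 \<bullet> z + (LINT t|lebesgue_on {0..T}. adj_sol T A z t \<bullet> f t) = 0"
  shows "lin_sol T A x0 f T = 0"
proof -
  obtain z where "adj_sol T A z T = lin_sol T A x0 f T" using adj_sol_final_surj[OF T] by blast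
  with lin_sol_duality[OF T f, of A x0 z] orth[of z] show ?thesis by simp
qed

subsection \<open>Continuous multilinear maps\<close>

lemma ae_eq_refl [simp]: "ae_eq T f f"
  by (simp add: ae_eq_def)

lemma ae_eq_trans: "ae_eq T f g \<Longrightarrow> ae_eq T g h \<Longrightarrow> ae_eq T f h"
  unfolding ae_eq_def by (erule (1) eventually_elim2) simp

lemma ae_eq_scaleR: "ae_eq T f g \<Longrightarrow> ae_eq T (\<lambda>t. a *\<^sub>R f t) (\<lambda>t. a *\<^sub>R g t)"
  unfolding ae_eq_def by (elim eventually_mono) simp

lemma ae_eq_add: "ae_eq T f g \<Longrightarrow> ae_eq T f' g' \<Longrightarrow> ae_eq T (\<lambda>t. f t + f' t) (\<lambda>t. g t + g' t)"
  unfolding ae_eq_def by (erule (1) eventually_elim2) simp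

lemma ae_eq_sum: "(\<And>i. i \<in> I \<Longrightarrow> ae_eq T (f i) (g i)) \<Longrightarrow> ae_eq T (\<lambda>t. \<Sum>i\<in>I. f i t) (\<lambda>t. \<Sum>i\<in>I. g i t)"
  by (induction I rule: infinite_finite_induct) (auto intro: ae_eq_add)

lemma cont_multilinear_L2:
  "cont_multilinear T p G \<Longrightarrow> length xs = p \<Longrightarrow> \<forall>x\<in>set xs. in_S T x \<Longrightarrow> L2 T (G xs)"
  by (simp add: cont_multilinear_def)

lemma cont_multilinear_continuous:
  assumes G: "cont_multilinear T p G" and xs: "length xs = p" "\<forall>x\<in>set xs. in_S T x" and e: "e > 0"
  shows "\<exists>d>0. \<forall>ys. length ys = p \<and> (\<forall>y\<in>set ys. in_S T y) \<and>
     (\<forall>i<p. S_norm T (\<lambda>t. (ys!i) t - (xs!i) t) < d) \<longrightarrow> l2norm T (\<lambda>t. G ys t - G xs t) < e"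
proof -
  have "\<forall>xs. length xs = p \<and> (\<forall>x\<in>set xs. in_S T x) \<longrightarrow>
       (\<forall>\<epsilon>>0. \<exists>\<delta>>0. \<forall>ys. length ys = p \<and> (\<forall>y\<in>set ys. in_S T y) \<and>
           (\<forall>i<p. S_norm T (\<lambda>t. (ys!i) t - (xs!i) t) < \<delta>) \<longrightarrow>
           l2norm T (\<lambda>t. G ys t - G xs t) < \<epsilon>)"
    using G unfolding cont_multilinear_def by (elim conjE)
  from this[rule_format, OF conjI[OF xs(1)]] xs(2) e show ?thesis by blast
qed

text \<open>Linearity in slot \<open>i\<close>, with the list update replaced by a splitting of the
  list; this form suits inductions along the arguments.\<close>

lemma cont_multilinear_slot:
  assumes G: "cont_multilinear T p G" and p: "length xs + Suc (length zs) = p"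
    and S: "\<forall>x\<in>set xs. in_S T x" "\<forall>x\<in>set zs. in_S T x" "in_S T x" "in_S T y"
  shows "ae_eq T (G (xs @ (\<lambda>t. a *\<^sub>R x t + b *\<^sub>R y t) # zs))
     (\<lambda>t. a *\<^sub>R G (xs @ x # zs) t + b *\<^sub>R G (xs @ y # zs) t)"
proof -
  have "\<forall>us i y a b. length us = p \<and> (\<forall>x\<in>set us. in_S T x) \<and> i < p \<and> in_S T y \<longrightarrow>
        ae_eq T (G (us[i := (\<lambda>t. a *\<^sub>R (us!i) t + b *\<^sub>R y t)])) (\<lambda>t. a *\<^sub>R G us t + b *\<^sub>R G (us[i := y]) t)"
    using G unfolding cont_multilinear_def by blast
  from this[rule_format, of "xs @ x # zs" "length xs" y a b] show ?thesis
    using p S by auto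
qed

lemma cont_multilinear_slot_scaleR:
  assumes "cont_multilinear T p G" "length xs + Suc (length zs) = p"
    "\<forall>x\<in>set xs. in_S T x" "\<forall>x\<in>set zs. in_S T x" "in_S T x"
  shows "ae_eq T (G (xs @ (\<lambda>t. a *\<^sub>R x t) # zs)) (\<lambda>t. a *\<^sub>R G (xs @ x # zs) t)"
  using cont_multilinear_slot[OF assms assms(5), of a 0] by simp

lemma cont_multilinear_slot_sum:
  assumes G: "cont_multilinear T p G" and p: "length xs + Suc (length zs) = p"
    and S: "\<forall>x\<in>set xs. in_S T x" "\<forall>x\<in>set zs. in_S T x" and Y: "\<And>i. i \<in> I \<Longrightarrow> in_S T (Y i)"
  shows "ae_eq T (G (xs @ (\<lambda>t. \<Sum>i\<in>I. Y i t) # zs)) (\<lambda>t. \<Sum>i\<in>I. G (xs @ Y i # zs) t)"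
  using Y
proof (induction I rule: infinite_finite_induct)
  case (insert i I)
  have "ae_eq T (G (xs @ (\<lambda>t. 1 *\<^sub>R Y i t + 1 *\<^sub>R (\<Sum>i\<in>I. Y i t)) # zs))
     (\<lambda>t. 1 *\<^sub>R G (xs @ Y i # zs) t + 1 *\<^sub>R G (xs @ (\<lambda>t. \<Sum>i\<in>I. Y i t) # zs) t)"
    by (rule cont_multilinear_slot[OF G p S]) (use insert in \<open>auto intro: in_S_sum\<close>)
  moreover have "ae_eq T (\<lambda>t. G (xs @ Y i # zs) t + G (xs @ (\<lambda>t. \<Sum>i\<in>I. Y i t) # zs) t)
     (\<lambda>t. G (xs @ Y i # zs) t + (\<Sum>i\<in>I. G (xs @ Y i # zs) t))"
    by (rule ae_eq_add[OF ae_eq_refl insert.IH]) (use insert in auto)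
  ultimately show ?case
    using insert.hyps ae_eq_trans by fastforce
\<comment> \<open>Sums over empty or infinite sets are 0; homogeneity with the factor 0 settles both
  cases.\<close>
qed (use cont_multilinear_slot_scaleR[OF G p S in_S_zero, of 0] in auto)

section \<open>Expansion of multilinear maps over lists of choices\<close>

lemma finite_listset: "(\<And>I. I \<in> set Is \<Longrightarrow> finite I) \<Longrightarrow> finite (listset Is)"
  by (induction Is) (auto simp: set_Cons_def intro: finite_subset[OF _ finite_imageI[OF finite_cartesian_product], of _ "\<lambda>(x,y). x # y"])

lemma listset_iff: "is \<in> listset Is \<longleftrightarrow> list_all2 (\<in>) is Is"
  by (induction Is arbitrary: "is") (auto simp: set_Cons_def list_all2_Cons2)

lemma listset_Cons_image: "listset (I # Is) = (\<lambda>(i, is). i # is) ` (I \<times> listset Is)"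
  by (auto simp: set_Cons_def)

lemma sum_listset_Cons:
  "(\<Sum>is\<in>listset (I # Is). h is) = (\<Sum>i\<in>I. \<Sum>is\<in>listset Is. h (i # is))"
proof -
  have "(\<Sum>is\<in>listset (I # Is). h is) = (\<Sum>(i, is)\<in>I \<times> listset Is. h (i # is))"
    unfolding listset_Cons_image by (subst sum.reindex) (auto intro!: inj_onI sum.cong)
  then show ?thesis by (simp add: sum.cartesian_product)
qed

text \<open>The prefix \<open>xs\<close> holds the slots already resolved, so the arity stays
  \<open>p\<close> while the induction moves along the list. A member of \<open>listset Is\<close>
  is a choice of one index per slot.\<close>

lemma cont_multilinear_expand_aux:
  assumes G: "cont_multilinear T p G" and p: "length xs + length Is = p"
    and S: "\<forall>x\<in>set xs. in_S T x" and Y: "\<And>I i. I \<in> set Is \<Longrightarrow> i \<in> I \<Longrightarrow> in_S T (Y i)"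
  shows "ae_eq T (G (xs @ map (\<lambda>I t. \<Sum>i\<in>I. Y i t) Is)) (\<lambda>t. \<Sum>is\<in>listset Is. G (xs @ map Y is) t)"
  using p S Y
proof (induction Is arbitrary: xs)
  case (Cons I Is)
  have "ae_eq T (G (xs @ (\<lambda>t. \<Sum>i\<in>I. Y i t) # map (\<lambda>I t. \<Sum>i\<in>I. Y i t) Is))
     (\<lambda>t. \<Sum>i\<in>I. G (xs @ Y i # map (\<lambda>I t. \<Sum>i\<in>I. Y i t) Is) t)"
    by (rule cont_multilinear_slot_sum[OF G]) (use Cons.prems in \<open>auto intro: in_S_sum\<close>)
  moreover have "ae_eq T (\<lambda>t. \<Sum>i\<in>I. G (xs @ Y i # map (\<lambda>I t. \<Sum>i\<in>I. Y i t) Is) t)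
     (\<lambda>t. \<Sum>i\<in>I. \<Sum>is\<in>listset Is. G (xs @ Y i # map Y is) t)"
  proof (rule ae_eq_sum)
    fix i assume "i \<in> I"
    then have "ae_eq T (G ((xs @ [Y i]) @ map (\<lambda>I t. \<Sum>i\<in>I. Y i t) Is))
       (\<lambda>t. \<Sum>is\<in>listset Is. G ((xs @ [Y i]) @ map Y is) t)"
      by (intro Cons.IH) (use Cons.prems in auto)
    then show "ae_eq T (G (xs @ Y i # map (\<lambda>I t. \<Sum>i\<in>I. Y i t) Is)) (\<lambda>t. \<Sum>is\<in>listset Is. G (xs @ Y i # map Y is) t)"
      by simp
  qed
  ultimately show ?case
    unfolding sum_listset_Cons using ae_eq_trans by force
qed simp

lemmas cont_multilinear_expand = cont_multilinear_expand_aux[where xs="[]", simplified]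

lemma cont_multilinear_scale_aux:
  assumes G: "cont_multilinear T p G" and p: "length xs + length is = p"
    and S: "\<forall>x\<in>set xs. in_S T x" and X: "\<And>i. i \<in> set is \<Longrightarrow> in_S T (X i)"
  shows "ae_eq T (G (xs @ map (\<lambda>i t. c i *\<^sub>R X i t) is)) (\<lambda>t. prod_list (map c is) *\<^sub>R G (xs @ map X is) t)"
  using p S X
proof (induction "is" arbitrary: xs)
  case (Cons i "is")
  have "ae_eq T (G (xs @ (\<lambda>t. c i *\<^sub>R X i t) # map (\<lambda>i t. c i *\<^sub>R X i t) is))
     (\<lambda>t. c i *\<^sub>R G (xs @ X i # map (\<lambda>i t. c i *\<^sub>R X i t) is) t)"
    by (rule cont_multilinear_slot_scaleR[OF G]) (use Cons.prems in \<open>auto intro: in_S_scaleR\<close>)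
  moreover have "ae_eq T (G ((xs @ [X i]) @ map (\<lambda>i t. c i *\<^sub>R X i t) is))
      (\<lambda>t. prod_list (map c is) *\<^sub>R G ((xs @ [X i]) @ map X is) t)"
    by (rule Cons.IH) (use Cons.prems in auto)
  from ae_eq_scaleR[OF this, of "c i"]
  have "ae_eq T (\<lambda>t. c i *\<^sub>R G (xs @ X i # map (\<lambda>i t. c i *\<^sub>R X i t) is) t)
     (\<lambda>t. (c i * prod_list (map c is)) *\<^sub>R G (xs @ X i # map X is) t)" by simp
  ultimately show ?case using ae_eq_trans by simp blast
qed simp

lemmas cont_multilinear_scale = cont_multilinear_scale_aux[where xs="[]", simplified]

text \<open>Continuity at the zero tuple with tolerance 1, followed by homogeneity of degree
  \<open>p\<close> with the factor \<open>d/2\<close>. Without this bound the real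
  \<open>Sup\<close> in \<open>op_norm\<close> would carry no information.\<close>

lemma cont_multilinear_bounded_unit:
  assumes G: "cont_multilinear T p G"
  shows "\<exists>C. \<forall>xs. length xs = p \<and> (\<forall>x\<in>set xs. in_S T x \<and> S_norm T x \<le> 1) \<longrightarrow> l2norm T (G xs) \<le> C"
proof -
  let ?zs = "replicate p (\<lambda>t. 0)"
  have z: "length ?zs = p" "\<forall>x\<in>set ?zs. in_S T x" by (auto simp: in_S_zero)
  obtain d where d: "d > 0" "\<And>ys. length ys = p \<Longrightarrow> \<forall>y\<in>set ys. in_S T y \<Longrightarrow>
      \<forall>i<p. S_norm T (\<lambda>t. (ys!i) t - (?zs!i) t) < d \<Longrightarrow> l2norm T (\<lambda>t. G ys t - G ?zs t) < 1"
    using cont_multilinear_continuous[OF G z zero_less_one] by blast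
  define C where "C = (1 + l2norm T (G ?zs)) / (d/2) ^ p"
  have "l2norm T (G xs) \<le> C" if xs: "length xs = p" "\<forall>x\<in>set xs. in_S T x \<and> S_norm T x \<le> 1" for xs
  proof -
    define ys where "ys = map (\<lambda>x t. (d/2) *\<^sub>R x t) xs"
    have ys: "length ys = p" "\<forall>y\<in>set ys. in_S T y" using xs by (auto simp: ys_def intro: in_S_scaleR)
    have "S_norm T (\<lambda>t. (ys!i) t - (?zs!i) t) < d" if "i < p" for i
    proof -
      have "xs ! i \<in> set xs" using that xs by simp
      then have x: "in_S T (xs!i)" "S_norm T (xs!i) \<le> 1" using xs by auto
      have "S_norm T (\<lambda>t. (d/2) *\<^sub>R (xs!i) t) = d/2 * S_norm T (xs!i)"
        using S_norm_scaleR[OF x(1)] d by simp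
      also have "\<dots> \<le> d/2 * 1" by (rule mult_left_mono[OF x(2)]) (use d in simp)
      also have "\<dots> < d" using d by simp
      finally show ?thesis using that xs by (simp add: ys_def)
    qed
    with d(2)[OF ys] have less: "l2norm T (\<lambda>t. G ys t - G ?zs t) < 1" by blast
    have L: "L2 T (G xs)" "L2 T (G ys)" "L2 T (G ?zs)"
      using cont_multilinear_L2[OF G] xs ys cont_multilinear_L2[OF G z] by auto
    have "l2norm T (G ys) = l2norm T (\<lambda>t. (G ys t - G ?zs t) + G ?zs t)" by simp
    also have "\<dots> \<le> l2norm T (\<lambda>t. G ys t - G ?zs t) + l2norm T (G ?zs)"
      by (rule l2norm_triangle) (intro L2_diff L)+
    finally have a: "l2norm T (G ys) \<le> 1 + l2norm T (G ?zs)" using less by simp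
    have "ae_eq T (G ys) (\<lambda>t. prod_list (map (\<lambda>x. d/2) xs) *\<^sub>R G (map (\<lambda>x. x) xs) t)"
      unfolding ys_def by (rule cont_multilinear_scale[OF G xs(1)]) (use xs in auto)
    also have "prod_list (map (\<lambda>x. d/2) xs) = (d/2) ^ p"
      using xs(1) by (simp add: map_replicate_const prod_list_replicate)
    finally have "l2norm T (G ys) = l2norm T (\<lambda>t. (d/2)^p *\<^sub>R G xs t)"
      by (intro l2norm_cong_AE L L2_scaleR) simp
    then have "l2norm T (G ys) = (d/2)^p * l2norm T (G xs)"
      using d by (simp add: l2norm_scaleR)
    with a d show ?thesis unfolding C_def by (simp add: field_simps)
  qed
  then show ?thesis by blast
qed

lemma op_norm_bdd:
  assumes "cont_multilinear T p G"
  shows "bdd_above {l2norm T (G xs) | xs. length xs = p \<and> (\<forall>x\<in>set xs. in_S T x \<and> S_norm T x \<le> 1)}"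
  using cont_multilinear_bounded_unit[OF assms] by (fastforce simp: bdd_above_def)

lemma op_norm_unit:
  assumes "cont_multilinear T p G" "length xs = p" "\<forall>x\<in>set xs. in_S T x \<and> S_norm T x \<le> 1"
  shows "l2norm T (G xs) \<le> op_norm T p G"
  unfolding op_norm_def by (rule cSup_upper[OF _ op_norm_bdd[OF assms(1)]]) (use assms in blast)

lemma S_norm_zero [simp]: "S_norm T (\<lambda>t. 0) = 0"
  using S_norm_eq[OF weak_deriv_zero] by simp

lemma op_norm_nonneg:
  assumes "cont_multilinear T p G" shows "0 \<le> op_norm T p G"
  using op_norm_unit[OF assms, of "replicate p (\<lambda>t. 0)"]
  by (force simp: in_S_zero intro: order_trans[OF l2norm_nonneg])

lemma tendsto_prod_list:
  fixes f :: "'a \<Rightarrow> 'b \<Rightarrow> real"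
  assumes "\<And>x. x \<in> set xs \<Longrightarrow> ((\<lambda>h. f h x) \<longlongrightarrow> l x) F"
  shows "((\<lambda>h. prod_list (map (f h) xs)) \<longlongrightarrow> prod_list (map l xs)) F"
  using assms by (induction xs) (auto intro!: tendsto_intros)

text \<open>Arguments are normalised by \<open>S_norm T x + h\<close> with \<open>h > 0\<close>,
  which never vanishes; then \<open>h\<close> tends to 0. Arguments of norm 0 thus need no separate
  case.\<close>

lemma op_norm_bound:
  assumes G: "cont_multilinear T p G" and p: "length xs = p" and S: "\<forall>x\<in>set xs. in_S T x"
  shows "l2norm T (G xs) \<le> op_norm T p G * prod_list (map (S_norm T) xs)"
proof (rule tendsto_lowerbound)
  show "((\<lambda>h. op_norm T p G * prod_list (map (\<lambda>x. S_norm T x + h) xs)) \<longlongrightarrow>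
      op_norm T p G * prod_list (map (S_norm T) xs)) (at_right 0)"
  proof (intro tendsto_intros tendsto_prod_list)
    fix x
    have "((\<lambda>h. S_norm T x + h) \<longlongrightarrow> S_norm T x + 0) (at_right 0)"
      by (intro tendsto_intros)
    then show "((\<lambda>h. S_norm T x + h) \<longlongrightarrow> S_norm T x) (at_right 0)" by simp
  qed
  show "eventually (\<lambda>h. l2norm T (G xs) \<le> op_norm T p G * prod_list (map (\<lambda>x. S_norm T x + h) xs)) (at_right 0)"
    unfolding eventually_at_right_field
  proof (intro exI[of _ 1] conjI allI impI)
    fix h :: real assume h: "0 < h"
    have pos: "S_norm T x + h > 0" for x using h S_norm_nonneg[of T x] by linarith
    define X where "X x t = (1 / (S_norm T x + h)) *\<^sub>R x t" for x :: "real \<Rightarrow> 'a" and t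
    have X: "in_S T (X x)" "S_norm T (X x) \<le> 1" if "x \<in> set xs" for x
    proof -
      show "in_S T (X x)" unfolding X_def[abs_def] using S that by (auto intro: in_S_scaleR)
      have "S_norm T (X x) = S_norm T x / (S_norm T x + h)"
        unfolding X_def[abs_def] using S that pos[of x] by (simp add: S_norm_scaleR)
      then show "S_norm T (X x) \<le> 1" using pos[of x] h by simp
    qed
    have eq: "map (\<lambda>x t. (S_norm T x + h) *\<^sub>R X x t) xs = xs"
    proof (rule map_idI)
      fix x show "(\<lambda>t. (S_norm T x + h) *\<^sub>R X x t) = x" using pos[of x] by (simp add: X_def)
    qed
    have ae: "ae_eq T (G xs) (\<lambda>t. prod_list (map (\<lambda>x. S_norm T x + h) xs) *\<^sub>R G (map X xs) t)"
      using cont_multilinear_scale[where c="\<lambda>x. S_norm T x + h" and X=X, OF G p X(1)] unfolding eq by simp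
    have pn: "0 \<le> prod_list (map (\<lambda>x. S_norm T x + h) xs)"
      by (rule prod_list_nonneg) (auto intro: less_imp_le[OF pos])
    have "l2norm T (G xs) = prod_list (map (\<lambda>x. S_norm T x + h) xs) * l2norm T (G (map X xs))"
      using l2norm_cong_AE[OF _ _ ae] cont_multilinear_L2[OF G] p S X(1) pn
      by (simp add: l2norm_scaleR L2_scaleR)
    also have "\<dots> \<le> prod_list (map (\<lambda>x. S_norm T x + h) xs) * op_norm T p G"
      by (rule mult_left_mono[OF op_norm_unit[OF G] pn]) (use p X in auto)
    finally show "l2norm T (G xs) \<le> op_norm T p G * prod_list (map (\<lambda>x. S_norm T x + h) xs)"
      by (simp add: mult.commute)
  qed simp
qed simp

subsection \<open>Grafting and the recursion for the trees\<close>

text \<open>Cuts the inputs of a forest into consecutive blocks, one per tree. The list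
  \<open>ps\<close> of pairs (tree, block) is the form in which grafting, cuts and
  \<open>Phi_forest\<close> are compared.\<close>

lemma forest_split:
  assumes "length E = sum_list (map leaves cs)"
  obtains ps where "cs = map fst ps" "E = concat (map snd ps)" "\<forall>(c, E)\<in>set ps. length E = leaves c"
proof -
  have "\<exists>ps. cs = map fst ps \<and> E = concat (map snd ps) \<and> (\<forall>(c, E)\<in>set ps. length E = leaves c)"
    using assms
  proof (induction cs arbitrary: E)
    case (Cons c cs)
    then have "length (drop (leaves c) E) = sum_list (map leaves cs)" by simp
    from Cons.IH[OF this] obtain ps where ps: "cs = map fst ps" "drop (leaves c) E = concat (map snd ps)"
      "\<forall>(c, E)\<in>set ps. length E = leaves c"
      by blast
    have "E = take (leaves c) E @ concat (map snd ps)" using ps(2) by (metis append_take_drop_id)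
    with ps Cons.prems show ?case by (intro exI[of _ "(c, take (leaves c) E) # ps"]) auto
  qed simp
  with that show thesis by blast
qed

lemma graft_forest_pairs:
  assumes "\<And>c E R. (c, E) \<in> set ps \<Longrightarrow> graft_aux c (E @ R) = (graft E c, R)"
  shows "graft_forest (map fst ps) (concat (map snd ps) @ R) = (map (\<lambda>(c, E). graft E c) ps, R)"
  using assms by (induction ps) auto

text \<open>The second component of \<open>graft_aux\<close> is the unconsumed suffix; a tree
  consumes exactly as many inputs as it has leaves.\<close>

lemma graft_aux_append:
  "length E = leaves c \<Longrightarrow> graft_aux c (E @ R) = (graft E c, R)"
proof (induction c arbitrary: E R)
  case Leaf
  then obtain e where "E = [e]" by (metis One_nat_def Suc_length_conv leaves.simps(1) length_0_conv)
  then show ?case by (simp add: graft_def)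
next
  case (Node cs)
  then have "length E = sum_list (map leaves cs)" by simp
  then obtain ps where ps: "cs = map fst ps" "E = concat (map snd ps)" "\<forall>(c, E)\<in>set ps. length E = leaves c"
    by (rule forest_split)
  have *: "graft_aux c (E' @ R) = (graft E' c, R)" if "(c, E') \<in> set ps" for c E' R
  proof (rule Node.IH)
    show "c \<in> set cs" using that ps(1) by force
    show "length E' = leaves c" using that ps(3) by auto
  qed
  show ?case
    using graft_forest_pairs[where ps=ps, OF *, of R] graft_forest_pairs[where ps=ps, OF *, of "[]"] ps by (simp add: graft_def[of _ "Node _"])
qed

lemma graft_Node:
  assumes "\<forall>(c, E)\<in>set ps. length E = leaves c"
  shows "graft (concat (map snd ps)) (Node (map fst ps)) = Node (map (\<lambda>(c, E). graft E c) ps)"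
proof -
  have "graft_aux c (E @ R) = (graft E c, R)" if "(c, E) \<in> set ps" for c E R
    using assms that by (intro graft_aux_append) auto
  from graft_forest_pairs[where ps=ps and R="[]", OF this] show ?thesis by (simp add: graft_def[of _ "Node _"])
qed

text \<open>The index set of the sum in \<open>Phi_star\<close>: each element cuts \<open>b\<close>
  into an upper tree containing the root and the subtrees hanging at its leaves.\<close>

definition cuts :: "tree \<Rightarrow> (tree \<times> tree list) set" where
  "cuts b = {(c, E). wf_tree c \<and> length E = leaves c \<and> (\<forall>e\<in>set E. wf_tree e) \<and> graft E c = b}"

lemma cuts_Leaf_part:
  "wf_tree b \<Longrightarrow> (Leaf, E) \<in> cuts b \<longleftrightarrow> E = [b]"
  by (cases E) (auto simp: cuts_def graft_def)

text \<open>Grafting acts child by child, so a cut whose upper tree is not a leaf is an independent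
  choice of one cut per child.\<close>

lemma cuts_Node_part:
  "wf_tree (Node bs) \<Longrightarrow> (Node cs, E) \<in> cuts (Node bs) \<longleftrightarrow>
     (\<exists>ps\<in>listset (map cuts bs). cs = map fst ps \<and> E = concat (map snd ps))"
proof
  assume wf: "wf_tree (Node bs)" and "(Node cs, E) \<in> cuts (Node bs)"
  then have c: "wf_tree (Node cs)" "length E = sum_list (map leaves cs)" "\<forall>e\<in>set E. wf_tree e"
    "graft E (Node cs) = Node bs" by (auto simp: cuts_def)
  obtain ps where ps: "cs = map fst ps" "E = concat (map snd ps)" "\<forall>(c, E)\<in>set ps. length E = leaves c"
    using forest_split[OF c(2)] by blast
  have bs: "bs = map (\<lambda>(c, E). graft E c) ps"
    using graft_Node[OF ps(3)] c(4) ps by simp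
  have "p \<in> cuts (case p of (c, E) \<Rightarrow> graft E c)" if "p \<in> set ps" for p
    using that ps c by (force simp: cuts_def)
  then have "ps \<in> listset (map cuts bs)"
    unfolding listset_iff bs by (auto simp: list_all2_map2 list_all2_same)
  with ps show "\<exists>ps\<in>listset (map cuts bs). cs = map fst ps \<and> E = concat (map snd ps)" by blast
next
  assume wf: "wf_tree (Node bs)" and "\<exists>ps\<in>listset (map cuts bs). cs = map fst ps \<and> E = concat (map snd ps)"
  then obtain ps where ps: "list_all2 (\<lambda>p b. p \<in> cuts b) ps bs" "cs = map fst ps" "E = concat (map snd ps)"
    by (auto simp: listset_iff list_all2_map2)
  have len: "length ps = length bs" using ps(1) by (rule list_all2_lengthD)
  have each: "wf_tree (fst p) \<and> length (snd p) = leaves (fst p) \<and> (\<forall>e\<in>set (snd p). wf_tree e)"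
    if "p \<in> set ps" for p
  proof -
    have "\<forall>p\<in>set ps. \<exists>b. p \<in> cuts b" using ps(1) by (induction rule: list_all2_induct) auto
    with that obtain b where "p \<in> cuts b" by blast
    then show ?thesis by (auto simp: cuts_def)
  qed
  have "map (\<lambda>(c, E). graft E c) ps = bs"
    using ps(1) by (induction rule: list_all2_induct) (auto simp: cuts_def)
  moreover have "\<forall>(c, E)\<in>set ps. length E = leaves c" using each by auto
  ultimately have "graft E (Node cs) = Node bs"
    using graft_Node[of ps] ps by simp
  moreover have "length E = leaves (Node cs)"
    using each unfolding ps by (induction ps) auto
  ultimately show "(Node cs, E) \<in> cuts (Node bs)"
    using wf len each ps by (auto simp: cuts_def)
qed

lemma cuts_Leaf: "cuts Leaf = {(Leaf, [Leaf])}"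
proof -
  have "(c, E) \<in> cuts Leaf \<longleftrightarrow> (c, E) = (Leaf, [Leaf])" for c E
  proof (cases c)
    case Leaf
    then show ?thesis using cuts_Leaf_part[of Leaf E] by simp
  next
    case (Node cs)
    then show ?thesis by (auto simp: cuts_def graft_def split: prod.splits)
  qed
  then show ?thesis by auto
qed

text \<open>Either the cut passes above the root, leaving a leaf as upper tree, or it descends to
  all children. This dichotomy is the source of the recursion for \<open>Phi_star\<close>.\<close>

lemma cuts_Node:
  assumes "wf_tree (Node bs)"
  shows "cuts (Node bs) = insert (Leaf, [Node bs])
     ((\<lambda>ps. (Node (map fst ps), concat (map snd ps))) ` listset (map cuts bs))"
proof -
  have "(c, E) \<in> cuts (Node bs) \<longleftrightarrow> (c, E) \<in> insert (Leaf, [Node bs])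
     ((\<lambda>ps. (Node (map fst ps), concat (map snd ps))) ` listset (map cuts bs))" for c E
    using cuts_Leaf_part[OF assms, of E] cuts_Node_part[OF assms, of _ E]
    by (cases c) (auto simp: image_iff)
  then show ?thesis by auto
qed

text \<open>Concatenation loses no information: the block lengths are the leaf numbers of the upper
  trees, which the first component records.\<close>

lemma inj_on_listset_cuts:
  "inj_on (\<lambda>ps. (Node (map fst ps), concat (map snd ps))) (listset (map cuts bs))"
proof (rule inj_onI)
  fix ps qs assume ps: "ps \<in> listset (map cuts bs)" and qs: "qs \<in> listset (map cuts bs)"
    and eq: "(Node (map fst ps), concat (map snd ps)) = (Node (map fst qs), concat (map snd qs))"
  have l: "map (length \<circ> snd) ps = map (leaves \<circ> fst) ps" if "ps \<in> listset (map cuts bs)" for ps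
    using that unfolding listset_iff list_all2_map2
    by (induction rule: list_all2_induct) (auto simp: cuts_def)
  have "map (length \<circ> snd) ps = map (length \<circ> snd) qs"
    using l[OF ps] l[OF qs] eq by (metis list.map_comp prod.inject tree.inject)
  moreover have "concat (map snd ps) = concat (map snd qs)" using eq by simp
  ultimately have "map snd ps = map snd qs"
  proof (induction ps arbitrary: qs)
    case (Cons p ps)
    then show ?case by (cases qs) auto
  qed simp
  with eq show "ps = qs" by (metis pair_list_eqI prod.inject tree.inject)
qed

lemma finite_cuts: "wf_tree b \<Longrightarrow> finite (cuts b)"
proof (induction b)
  case (Node bs)
  then show ?case unfolding cuts_Node[OF Node.prems] by (auto intro!: finite_imageI finite_listset)
qed (simp add: cuts_Leaf)

text \<open>Completeness of L2 sums enumerates the index type, and is to be applied to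
  trees.\<close>

instance tree :: countable by countable_datatype

lemma H1_cont_multilinear: "H1 T F \<Longrightarrow> 2 \<le> p \<Longrightarrow> cont_multilinear T p (F p)"
  by (simp add: H1_def)

section \<open>The recursion satisfied by \<open>Phi_star\<close>\<close>

lemma Phi_forest_pairs:
  assumes "\<forall>(c, E)\<in>set ps. length E = leaves c"
  shows "Phi_forest T A F (map fst ps) (map u (concat (map snd ps))) = map (\<lambda>(c, E). Phi T A F c (map u E)) ps"
  using assms by (induction ps) auto

lemma Phi_in_S:
  assumes T: "0 \<le> T" and F: "H1 T F"
  shows "wf_tree c \<Longrightarrow> length E = leaves c \<Longrightarrow> \<forall>e\<in>set E. L2 T (snd (u e)) \<Longrightarrow> in_S T (Phi T A F c (map u E))"
proof (induction c arbitrary: E)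
  case Leaf
  then have "hd E \<in> set E" "E \<noteq> []" by (cases E; simp)+
  with Leaf show ?case by (auto intro!: lin_sol_in_S[OF T] simp: hd_map)
next
  case (Node cs)
  then have "length E = sum_list (map leaves cs)" by simp
  then obtain ps where ps: "cs = map fst ps" "E = concat (map snd ps)" "\<forall>(c, E)\<in>set ps. length E = leaves c"
    by (rule forest_split)
  have "in_S T (Phi T A F c (map u E'))" if p: "(c, E') \<in> set ps" for c E'
  proof (rule Node.IH)
    show "c \<in> set cs" using p ps(1) by force
    then show "wf_tree c" using Node.prems by simp
    show "length E' = leaves c" using p ps(3) by auto
    show "\<forall>e\<in>set E'. L2 T (snd (u e))" using Node.prems(3) p unfolding ps(2) by force
  qed
  then have "\<forall>x\<in>set (map (\<lambda>(c, E). Phi T A F c (map u E)) ps). in_S T x" by auto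
  moreover have "length cs \<ge> 2" "length cs = length ps" using Node.prems ps by auto
  ultimately have "L2 T (F (length cs) (map (\<lambda>(c, E). Phi T A F c (map u E)) ps))"
    by (intro cont_multilinear_L2[OF H1_cont_multilinear[OF F]]) auto
  then show ?case
    using Phi_forest_pairs[OF ps(3), of T A F u] ps(1,2) by (auto intro: lin_sol_in_S[OF T])
qed

lemma Phi_star_cuts: "Phi_star T A F u b = (\<lambda>t. \<Sum>p\<in>cuts b. (case p of (c, E) \<Rightarrow> Phi T A F c (map u E)) t)"
  unfolding Phi_star_def cuts_def by (rule ext, rule sum.cong) auto

lemma Phi_cuts_in_S:
  assumes "0 \<le> T" "H1 T F" "\<forall>e. wf_tree e \<longrightarrow> L2 T (snd (u e))" "p \<in> cuts b"
  shows "in_S T (case p of (c, E) \<Rightarrow> Phi T A F c (map u E))"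
  using assms by (auto simp: cuts_def intro!: Phi_in_S)

lemma Phi_star_in_S:
  assumes "0 \<le> T" "H1 T F" "\<forall>e. wf_tree e \<longrightarrow> L2 T (snd (u e))"
  shows "in_S T (Phi_star T A F u b)"
  unfolding Phi_star_cuts by (rule in_S_sum[OF Phi_cuts_in_S[OF assms]])

lemma Phi_star_Leaf: "Phi_star T A F u Leaf = lin_sol T A (fst (u Leaf)) (snd (u Leaf))"
  unfolding Phi_star_cuts cuts_Leaf by simp

text \<open>The cut above the root contributes the linear solution with data
  \<open>u (Node bs)\<close>. The other cuts are lists of cuts of the children, so their
  contributions are the terms in the expansion of \<open>F r\<close> on the sums
  \<open>Phi_star\<close> of the children. Linearity of \<open>lin_sol\<close> merges both
  parts.\<close>

lemma Phi_star_Node: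
  assumes T: "0 \<le> T" and F: "H1 T F" and u: "\<forall>e. wf_tree e \<longrightarrow> L2 T (snd (u e))" and wf: "wf_tree (Node bs)"
  shows "Phi_star T A F u (Node bs) = lin_sol T A (fst (u (Node bs)))
      (\<lambda>t. snd (u (Node bs)) t + F (length bs) (map (Phi_star T A F u) bs) t)"
proof -
  let ?Y = "\<lambda>p. case p of (c, E) \<Rightarrow> Phi T A F c (map u E)"
  let ?r = "length bs" and ?L = "listset (map cuts bs)"
  have G: "cont_multilinear T ?r (F ?r)" by (rule H1_cont_multilinear[OF F]) (use wf in simp)
  have fin: "finite ?L" using wf by (auto intro!: finite_listset finite_cuts)
  have each: "length ps = ?r \<and> (\<forall>p\<in>set ps. in_S T (?Y p)) \<and> (\<forall>(c, E)\<in>set ps. length E = leaves c)"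
    if "ps \<in> ?L" for ps
  proof -
    have l: "list_all2 (\<lambda>p b. p \<in> cuts b) ps bs" using that by (simp add: listset_iff list_all2_map2)
    have "\<forall>p\<in>set ps. \<exists>b. p \<in> cuts b" using l by (induction rule: list_all2_induct) auto
    then show ?thesis
      using list_all2_lengthD[OF l] Phi_cuts_in_S[OF T F u] by (fastforce simp: cuts_def)
  qed
  have L: "L2 T (F ?r (map ?Y ps))" if "ps \<in> ?L" for ps
    using each[OF that] by (intro cont_multilinear_L2[OF G]) auto
  have "ae_eq T (F ?r (map (\<lambda>I t. \<Sum>p\<in>I. ?Y p t) (map cuts bs))) (\<lambda>t. \<Sum>ps\<in>?L. F ?r (map ?Y ps) t)"
  proof (rule cont_multilinear_expand[OF G])
    fix I p assume "I \<in> set (map cuts bs)" "p \<in> I"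
    then obtain b where "p \<in> cuts b" by auto
    then show "in_S T (?Y p)" using Phi_cuts_in_S[OF T F u] by blast
  qed simp
  moreover have "map (\<lambda>I t. \<Sum>p\<in>I. ?Y p t) (map cuts bs) = map (Phi_star T A F u) bs"
    by (simp add: Phi_star_cuts[abs_def])
  ultimately have ae: "ae_eq T (F ?r (map (Phi_star T A F u) bs)) (\<lambda>t. \<Sum>ps\<in>?L. F ?r (map ?Y ps) t)"
    by (simp only:)
  have LX: "L2 T (F ?r (map (Phi_star T A F u) bs))"
    by (rule cont_multilinear_L2[OF G]) (auto intro: Phi_star_in_S[OF T F u])
  have Phi_Node: "Phi T A F (Node (map fst ps)) (map u (concat (map snd ps))) = lin_sol T A 0 (F ?r (map ?Y ps))"
    if "ps \<in> ?L" for ps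
    using each[OF that] Phi_forest_pairs[of ps T A F u] by simp
  have "Phi_star T A F u (Node bs) t = lin_sol T A (fst (u (Node bs))) (snd (u (Node bs))) t
     + (\<Sum>ps\<in>?L. lin_sol T A 0 (F ?r (map ?Y ps)) t)" for t
  proof -
    have "Phi_star T A F u (Node bs) t = Phi T A F Leaf (map u [Node bs]) t
      + (\<Sum>ps\<in>?L. Phi T A F (Node (map fst ps)) (map u (concat (map snd ps))) t)"
      unfolding Phi_star_cuts cuts_Node[OF wf]
      by (subst sum.insert) (auto simp: fin sum.reindex[OF inj_on_listset_cuts] o_def)
    also have "(\<Sum>ps\<in>?L. Phi T A F (Node (map fst ps)) (map u (concat (map snd ps))) t)
       = (\<Sum>ps\<in>?L. lin_sol T A 0 (F ?r (map ?Y ps)) t)"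
      by (rule sum.cong[OF refl]) (simp only: Phi_Node)
    finally show ?thesis by simp
  qed
  \<comment> \<open>The expansion \<open>ae\<close> holds almost everywhere only; applying
    \<open>lin_sol\<close> makes it an equality.\<close>
  moreover have "(\<lambda>t. \<Sum>ps\<in>?L. lin_sol T A 0 (F ?r (map ?Y ps)) t) = lin_sol T A 0 (F ?r (map (Phi_star T A F u) bs))"
    using lin_sol_sum[where I="?L" and M=A and x="\<lambda>_. 0", OF T L] lin_sol_AE_cong[OF T LX L2_sum[OF L] ae] by simp
  ultimately have "Phi_star T A F u (Node bs) = (\<lambda>t. 1 *\<^sub>R lin_sol T A (fst (u (Node bs))) (snd (u (Node bs))) t
     + 1 *\<^sub>R lin_sol T A 0 (F ?r (map (Phi_star T A F u) bs)) t)"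
    by (simp add: fun_eq_iff)
  also have "\<dots> = lin_sol T A (1 *\<^sub>R fst (u (Node bs)) + 1 *\<^sub>R 0)
      (\<lambda>t. 1 *\<^sub>R snd (u (Node bs)) t + 1 *\<^sub>R F ?r (map (Phi_star T A F u) bs) t)"
    by (rule lin_sol_lincomb[OF T u[rule_format, OF wf] LX, symmetric])
  finally show ?thesis by simp
qed

subsection \<open>The controls of the construction\<close>

text \<open>On the orthogonal complement of its kernel \<open>L\<close> is injective, hence bounded
  below by some \<open>e > 0\<close>. By symmetry the kernel component of \<open>y\<close>
  contributes nothing to \<open>L y \<bullet> y\<close>, and \<open>C = 1 / e\<close> works.\<close>

lemma selfadjoint_form_le_norm:
  fixes L :: "'a::euclidean_space \<Rightarrow> 'a"
  assumes L: "linear L" and sym: "\<And>x y. L x \<bullet> y = x \<bullet> L y"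
  obtains C where "0 \<le> C" "\<And>y. L y \<bullet> y \<le> C * (norm (L y))\<^sup>2"
proof -
  define N where "N = {x. L x = 0}"
  have N: "subspace N" unfolding N_def by (rule linear_subspace_kernel[OF L])
  define S where "S = {y. \<forall>x\<in>N. orthogonal x y}"
  have S: "subspace S"
    unfolding S_def orthogonal_def by (auto simp: subspace_def inner_add_right)
  have "x = 0" if "x \<in> S" "L x = 0" for x
    using that by (auto simp: S_def N_def orthogonal_def)
  then obtain e where e: "e > 0" "\<And>x. x \<in> S \<Longrightarrow> norm (L x) \<ge> e * norm x"
    using injective_imp_isometric[OF closed_subspace[OF S] S, of L] L
    by (metis linear_conv_bounded_linear)
  have "L y \<bullet> y \<le> 1 / e * (norm (L y))\<^sup>2" for y
  proof -
    obtain k s where ks: "k \<in> span N" "\<And>w. w \<in> span N \<Longrightarrow> orthogonal s w" "y = k + s"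
      using orthogonal_subspace_decomp_exists[of N y] by blast
    have "span N = N" using N span_eq_iff by blast
    then have "k \<in> N" using ks(1) by blast
    then have k: "L k = 0" by (simp add: N_def)
    have s: "s \<in> S" using ks(2) N by (auto simp: S_def span_base orthogonal_commute)
    have Ls: "L y = L s" using k ks(3) by (simp add: linear_add[OF L])
    have "L y \<bullet> k = 0" using sym[of y k] k by simp
    then have "L y \<bullet> y = L s \<bullet> s" using Ls ks(3) by (simp add: inner_add_right)
    also have "\<dots> \<le> norm (L s) * norm s" by (rule norm_cauchy_schwarz)
    also have "\<dots> \<le> norm (L s) * (norm (L s) / e)"
      using e(2)[OF s] e(1) by (intro mult_left_mono) (auto simp: field_simps)
    finally show ?thesis using Ls by (simp add: power2_eq_square)
  qed
  then show ?thesis using that[of "1 / e"] e(1) by simp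
qed

lemma linear_coeff_zero_if_nonneg:
  fixes c d :: real
  assumes "\<And>s. 0 \<le> s * c + s\<^sup>2 * d" shows "c = 0"
proof (rule ccontr)
  assume c: "c \<noteq> 0"
  define D where "D = \<bar>d\<bar> + 1"
  have D: "D > 0" by (simp add: D_def)
  \<comment> \<open>The test value is the vertex of the parabola with \<open>d\<close> replaced by
    the positive majorant \<open>D\<close>.\<close>
  have "0 \<le> (- c / (2 * D)) * c + (- c / (2 * D))\<^sup>2 * d" by (rule assms)
  also have "\<dots> \<le> (- c / (2 * D)) * c + (- c / (2 * D))\<^sup>2 * D"
    by (intro add_left_mono mult_left_mono) (auto simp: D_def)
  also have "\<dots> = - (c\<^sup>2 / (4 * D))" using D by (simp add: power2_eq_square field_simps)
  also have "\<dots> < 0" using c D by simp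
  finally show False by simp
qed

locale control_family =
  fixes T :: real and A :: "real^'n^'n" and B :: "real^'m^'n"
    and F :: "nat \<Rightarrow> (real \<Rightarrow> real^'n) list \<Rightarrow> real \<Rightarrow> real^'n"
    and x0 :: "real^'n" and v :: "tree \<Rightarrow> real \<Rightarrow> real^'m"
  assumes T: "0 < T" and F: "H1 T F" and family: "constructed_family T A B F x0 v"
begin

lemma T0: "0 \<le> T"
  using T by simp

definition ctrl :: "real^'n \<Rightarrow> real \<Rightarrow> real^'m" where
  "ctrl y t = transpose B *v adj_sol T A y t"

text \<open>The controllability Gramian as a bilinear form on initial values of the adjoint problem;
  half of \<open>gram y y\<close> is the quadratic part of every \<open>J b\<close>.\<close>

definition gram :: "real^'n \<Rightarrow> real^'n \<Rightarrow> real" where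
  "gram y z = (LINT t|lebesgue_on {0..T}. ctrl y t \<bullet> ctrl z t)"

lemma ctrl_continuous: "continuous_on {0..T} (ctrl y)"
  unfolding ctrl_def[abs_def] by (rule continuous_on_matrix_vector[OF solves_cont[OF adj_sol_solves[OF T0]]])

lemma ctrl_L2: "L2 T (ctrl y)"
  by (rule L2_continuous[OF ctrl_continuous])

lemma ctrl_lincomb: "ctrl (a *\<^sub>R y + b *\<^sub>R z) t = a *\<^sub>R ctrl y t + b *\<^sub>R ctrl z t"
  unfolding ctrl_def adj_sol_lincomb[OF T0]
  by (simp add: matrix_vector_right_distrib matrix_vector_mult_scaleR)

lemma gram_commute: "gram y z = gram z y"
  by (simp add: gram_def inner_commute)

lemma gram_lincomb: "gram (a *\<^sub>R y + b *\<^sub>R z) w = a * gram y w + b * gram z w"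
  unfolding gram_def ctrl_lincomb inner_add_left inner_scaleR_left
  by (simp add: integrable_inner_L2[OF ctrl_L2 ctrl_L2])

lemma gram_add: "gram (y + z) w = gram y w + gram z w"
  using gram_lincomb[of 1 y 1 z w] by simp

lemma gram_scaleR: "gram (a *\<^sub>R y) w = a * gram y w"
  using gram_lincomb[of a y 0 0 w] by simp

lemma gram_self: "gram y y = (l2norm T (ctrl y))\<^sup>2"
  by (simp add: gram_def l2norm_power2 power2_norm_eq_inner)

text \<open>The Riesz representative of \<open>gram y\<close>, that is, the Gramian as a linear
  map.\<close>

definition gram_op :: "real^'n \<Rightarrow> real^'n" where
  "gram_op y = (\<Sum>i\<in>Basis. gram y i *\<^sub>R i)"

lemma gram_op_inner: "gram_op y \<bullet> z = gram y z"
proof -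
  have lin: "linear (gram y)"
    by (rule linearI) (simp_all add: gram_commute[of y] gram_add gram_scaleR)
  have "gram y z = gram y (\<Sum>i\<in>Basis. (z \<bullet> i) *\<^sub>R i)" by (simp add: euclidean_representation)
  also have "\<dots> = (\<Sum>i\<in>Basis. (z \<bullet> i) * gram y i)"
    unfolding linear_sum[OF lin] by (simp add: linear_scale[OF lin])
  also have "\<dots> = gram_op y \<bullet> z"
    unfolding gram_op_def inner_sum_left by (simp add: inner_commute mult.commute)
  finally show ?thesis by simp
qed

definition X :: "tree \<Rightarrow> real \<Rightarrow> real^'n" where
  "X = Phi_star T A F (u_of B x0 v)"

text \<open>The value 0 at \<open>Leaf\<close> makes the exponent \<open>internal b - 1\<close>,
  truncated there to 0, harmless in the series of forcings.\<close>

definition force :: "tree \<Rightarrow> real \<Rightarrow> real^'n" where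
  "force b = (case b of Leaf \<Rightarrow> (\<lambda>t. 0) | Node bs \<Rightarrow> F (length bs) (map X bs))"

definition init :: "tree \<Rightarrow> real^'n" where
  "init b = (if b = Leaf then x0 else 0)"

text \<open>The linear part of \<open>J b\<close>. By duality its value at \<open>z\<close> pairs
  the final state reached without control with the final value of the adjoint solution from
  \<open>z\<close>.\<close>

definition pairing :: "tree \<Rightarrow> real^'n \<Rightarrow> real" where
  "pairing b z = init b \<bullet> z + (LINT t|lebesgue_on {0..T}. adj_sol T A z t \<bullet> force b t)"

lemma J_eq: "J T A B F x0 v b y = (1/2) * gram y y + pairing b y"
  unfolding J_def gram_self l2norm_power2 ctrl_def pairing_def init_def force_def X_def[symmetric]
  by (cases b) simp_all

lemma v_ctrl:
  assumes "wf_tree b"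
  shows "\<exists>y. (\<forall>z. J T A B F x0 v b y \<le> J T A B F x0 v b z) \<and> (\<forall>t\<in>{0..T}. v b t = ctrl y t)"
  using family assms unfolding constructed_family_def Trees_def ctrl_def by blast

lemma v_L2: assumes "wf_tree b" shows "L2 T (v b)"
proof -
  obtain y where "\<forall>t\<in>{0..T}. v b t = ctrl y t"
    using v_ctrl[OF assms] by blast
  then have "continuous_on {0..T} (v b)" using ctrl_continuous[of y] continuous_on_cong by metis
  then show ?thesis by (rule L2_continuous)
qed

lemma u_L2: "\<forall>e. wf_tree e \<longrightarrow> L2 T (snd (u_of B x0 v e))"
  by (simp add: u_of_def L2_matrix(1)[OF v_L2])

lemma X_in_S: "in_S T (X b)"
  unfolding X_def by (rule Phi_star_in_S[OF T0 F u_L2])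

lemma F_multilinear: "2 \<le> p \<Longrightarrow> cont_multilinear T p (F p)"
  by (rule H1_cont_multilinear[OF F])

lemma force_L2: assumes "wf_tree b" shows "L2 T (force b)"
proof (cases b)
  case (Node bs)
  then show ?thesis
    using assms cont_multilinear_L2[OF F_multilinear, of "length bs" "map X bs"] X_in_S
    by (auto simp: force_def)
qed (simp add: force_def)

lemma X_eq:
  assumes "wf_tree b" shows "X b = lin_sol T A (init b) (\<lambda>t. B *v v b t + force b t)"
proof (cases b)
  case Leaf
  then show ?thesis by (simp add: X_def Phi_star_Leaf init_def force_def u_of_def)
next
  case (Node bs)
  then have "wf_tree (Node bs)" using assms by simp
  from Phi_star_Node[OF T0 F u_L2 this, of A, folded X_def] show ?thesis
    by (simp add: Node init_def force_def u_of_def)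
qed

lemma rhs_L2: "wf_tree b \<Longrightarrow> L2 T (\<lambda>t. B *v v b t + force b t)"
  by (intro L2_add L2_matrix(1) v_L2 force_L2)

lemma pairing_lincomb:
  assumes "wf_tree b" shows "pairing b (a *\<^sub>R y + c *\<^sub>R z) = a * pairing b y + c * pairing b z"
  unfolding pairing_def adj_sol_lincomb[OF T0] inner_add_left inner_add_right inner_scaleR_left inner_scaleR_right
  by (simp add: integrable_inner_L2[OF adj_sol_L2[OF T0] force_L2[OF assms]] algebra_simps)

text \<open>Along \<open>y + s z\<close> the functional changes by \<open>s\<close> times the
  left-hand side plus a term quadratic in \<open>s\<close>; minimality at \<open>s = 0\<close> makes
  the linear coefficient vanish.\<close>

lemma v_optimal:
  assumes "wf_tree b"
  shows "\<exists>y. (\<forall>t\<in>{0..T}. v b t = ctrl y t) \<and> (\<forall>z. gram y z + pairing b z = 0)"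
proof -
  obtain y where y: "\<forall>z. J T A B F x0 v b y \<le> J T A B F x0 v b z" "\<forall>t\<in>{0..T}. v b t = ctrl y t"
    using v_ctrl[OF assms] by blast
  have "gram y z + pairing b z = 0" for z
  proof (rule linear_coeff_zero_if_nonneg)
    fix s :: real
    let ?w = "1 *\<^sub>R y + s *\<^sub>R z"
    have "gram ?w ?w = gram ?w y + s * gram ?w z"
      using gram_lincomb[of 1 y s z ?w] gram_commute[of ?w y] gram_commute[of ?w z] by simp
    also have "\<dots> = gram y y + 2 * s * gram y z + s\<^sup>2 * gram z z"
      using gram_lincomb[of 1 y s z y] gram_lincomb[of 1 y s z z] gram_commute[of z y]
      by (simp add: power2_eq_square algebra_simps)
    finally have "gram ?w ?w = gram y y + 2 * s * gram y z + s\<^sup>2 * gram z z" .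
    moreover have "pairing b (1 *\<^sub>R y + s *\<^sub>R z) = pairing b y + s * pairing b z"
      unfolding pairing_lincomb[OF assms] by simp
    ultimately show "0 \<le> s * (gram y z + pairing b z) + s\<^sup>2 * (gram z z / 2)"
      using y(1)[rule_format, of "1 *\<^sub>R y + s *\<^sub>R z"] unfolding J_eq by (simp add: algebra_simps)
  qed
  with y(2) show ?thesis by blast
qed

text \<open>The term \<open>B v(b)\<close> contributes exactly \<open>gram y z\<close> to the dual
  pairing, so the Euler equation is the orthogonality condition for a zero final state.\<close>

lemma X_final:
  assumes "wf_tree b" shows "X b T = 0"
  unfolding X_eq[OF assms]
proof (rule lin_sol_final_zero[OF T0 rhs_L2[OF assms]])
  fix z
  obtain y where y: "\<forall>t\<in>{0..T}. v b t = ctrl y t" "\<forall>z. gram y z + pairing b z = 0"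
    using v_optimal[OF assms] by blast
  have "(LINT t|lebesgue_on {0..T}. adj_sol T A z t \<bullet> (B *v v b t + force b t))
     = (LINT t|lebesgue_on {0..T}. adj_sol T A z t \<bullet> (B *v v b t)) + (LINT t|lebesgue_on {0..T}. adj_sol T A z t \<bullet> force b t)"
    unfolding inner_add_right
    by (rule Bochner_Integration.integral_add)
       (intro integrable_inner_L2 adj_sol_L2 T0 L2_matrix(1) v_L2 force_L2 assms)+
  also have "(LINT t|lebesgue_on {0..T}. adj_sol T A z t \<bullet> (B *v v b t)) = gram y z"
    unfolding gram_def
  proof (rule Bochner_Integration.integral_cong[OF refl])
    fix t assume "t \<in> space (lebesgue_on {0..T})"
    then have "v b t = ctrl y t" using y(1) by simp
    then show "adj_sol T A z t \<bullet> (B *v v b t) = ctrl y t \<bullet> ctrl z t"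
      using inner_transpose_matrix_vector[of "ctrl y t" B "adj_sol T A z t"] by (metis ctrl_def inner_commute)
  qed
  finally show "init b \<bullet> z + (LINT t|lebesgue_on {0..T}. adj_sol T A z t \<bullet> (B *v v b t + force b t)) = 0"
    using y(2)[rule_format, of z] by (simp add: pairing_def)
qed

text \<open>The Gram form may have a kernel, on which the controls vanish; it is coercive on the
  orthogonal complement.\<close>

lemma v_bound:
  obtains C where "0 \<le> C" "\<And>b. wf_tree b \<Longrightarrow> l2norm T (v b) \<le> C * (norm (init b) + l2norm T (force b))"
proof -
  have lin: "linear gram_op"
    by (rule linearI) (simp_all add: gram_op_def gram_add gram_scaleR scaleR_add_left sum.distrib scaleR_sum_right)
  have sym: "gram_op y \<bullet> z = y \<bullet> gram_op z" for y z
    by (metis gram_op_inner gram_commute inner_commute)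
  obtain c where c: "0 \<le> c" "\<And>y. gram_op y \<bullet> y \<le> c * (norm (gram_op y))\<^sup>2"
    using selfadjoint_form_le_norm[OF lin sym] by blast
  obtain K where K: "0 \<le> K" "\<And>z. l2norm T (adj_sol T A z) \<le> K * norm z"
  proof -
    obtain K where "0 \<le> K" "\<And>z f. L2 T f \<Longrightarrow> l2norm T (lin_sol T (- transpose A) z f) \<le> K * (norm z + l2norm T f)"
      using lin_sol_bound[OF T0, of "- transpose A"] by metis
    from that[OF this(1)] this(2)[OF L2_zero] show thesis by (simp add: adj_sol_def)
  qed
  have "l2norm T (v b) \<le> sqrt c * (K + 1) * (norm (init b) + l2norm T (force b))" if b: "wf_tree b" for b
  proof -
    obtain y where y: "\<forall>t\<in>{0..T}. v b t = ctrl y t" "\<forall>z. gram y z + pairing b z = 0"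
      using v_optimal[OF b] by blast
    let ?R = "(K + 1) * (norm (init b) + l2norm T (force b))"
    have R: "\<bar>pairing b z\<bar> \<le> ?R * norm z" for z
    proof -
      have "\<bar>pairing b z\<bar> \<le> norm (init b) * norm z + l2norm T (adj_sol T A z) * l2norm T (force b)"
        unfolding pairing_def
        using Cauchy_Schwarz_ineq2[of "init b" z] abs_integral_inner_le[OF adj_sol_L2[OF T0] force_L2[OF b], of A z]
        by linarith
      also have "\<dots> \<le> norm (init b) * norm z + K * norm z * l2norm T (force b)"
        by (intro add_left_mono mult_right_mono K(2)) simp
      also have "\<dots> \<le> ?R * norm z"
        using K(1) by (simp add: algebra_simps)
      finally show ?thesis .
    qed
    \<comment> \<open>The Euler equation is tested with \<open>gram_op y\<close>: the data control
      the image of \<open>y\<close> under the Gramian, though not \<open>y\<close> itself.\<close>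
    have "(norm (gram_op y))\<^sup>2 = - pairing b (gram_op y)"
      using y(2)[rule_format, of "gram_op y"] gram_op_inner[of y "gram_op y"] by (simp add: power2_norm_eq_inner)
    then have "norm (gram_op y) * norm (gram_op y) \<le> ?R * norm (gram_op y)"
      using R[of "gram_op y"] by (simp add: power2_eq_square)
    then have g: "norm (gram_op y) \<le> ?R"
      using K(1) by (cases "norm (gram_op y) = 0") auto
    have "(l2norm T (v b))\<^sup>2 = (l2norm T (ctrl y))\<^sup>2"
      unfolding l2norm_power2 by (rule Bochner_Integration.integral_cong) (auto simp: y(1))
    also have "\<dots> \<le> c * (norm (gram_op y))\<^sup>2"
      using c(2)[of y] by (simp add: gram_op_inner gram_self)
    also have "\<dots> \<le> c * ?R\<^sup>2" using g c(1) by (intro mult_left_mono power_mono) auto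
    also have "\<dots> = (sqrt c * ?R)\<^sup>2" using c(1) by (simp add: power_mult_distrib)
    finally have "(l2norm T (v b))\<^sup>2 \<le> (sqrt c * ?R)\<^sup>2" .
    then have "l2norm T (v b) \<le> sqrt c * ?R"
      by (rule power2_le_imp_le) (use c(1) K(1) in simp)
    then show ?thesis by (simp only: mult.assoc)
  qed
  moreover have "0 \<le> sqrt c * (K + 1)" using c(1) K(1) by simp
  ultimately show thesis using that by blast
qed

lemma X_bound:
  obtains C where "0 \<le> C" "\<And>b. wf_tree b \<Longrightarrow> S_norm T (X b) \<le> C * (norm (init b) + l2norm T (force b))"
proof -
  obtain C where C: "0 \<le> C" "\<And>b. wf_tree b \<Longrightarrow> l2norm T (v b) \<le> C * (norm (init b) + l2norm T (force b))"
    using v_bound by blast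
  obtain K where K: "0 \<le> K" "\<And>x0 f. L2 T f \<Longrightarrow> S_norm T (lin_sol T A x0 f) \<le> K * (norm x0 + l2norm T f)"
    using lin_sol_bound[OF T0, of A] by metis
  let ?m = "onorm ((*v) B)"
  have m: "0 \<le> ?m" by (rule onorm_matrix_nonneg)
  have "S_norm T (X b) \<le> K * (1 + ?m * C) * (norm (init b) + l2norm T (force b))" if b: "wf_tree b" for b
  proof -
    have "l2norm T (\<lambda>t. B *v v b t + force b t) \<le> l2norm T (\<lambda>t. B *v v b t) + l2norm T (force b)"
      by (rule l2norm_triangle[OF L2_matrix(1)[OF v_L2[OF b]] force_L2[OF b]])
    also have "l2norm T (\<lambda>t. B *v v b t) \<le> ?m * l2norm T (v b)" by (rule L2_matrix(2)[OF v_L2[OF b]])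
    also have "\<dots> \<le> ?m * (C * (norm (init b) + l2norm T (force b)))" by (rule mult_left_mono[OF C(2)[OF b] m])
    finally have "norm (init b) + l2norm T (\<lambda>t. B *v v b t + force b t)
        \<le> (1 + ?m * C) * (norm (init b) + l2norm T (force b))"
      by (simp add: algebra_simps)
    from mult_left_mono[OF this K(1)] K(2)[OF rhs_L2[OF b], of "init b"] show ?thesis
      unfolding X_eq[OF b] by (simp add: mult.assoc)
  qed
  moreover have "0 \<le> K * (1 + ?m * C)" using K(1) m C(1) by simp
  ultimately show thesis using that by blast
qed

lemma force_bound:
  assumes "wf_tree (Node bs)"
  shows "l2norm T (force (Node bs)) \<le> op_norm T (length bs) (F (length bs)) * prod_list (map (\<lambda>b. S_norm T (X b)) bs)"
proof -
  have "l2norm T (F (length bs) (map X bs))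
      \<le> op_norm T (length bs) (F (length bs)) * prod_list (map (S_norm T) (map X bs))"
    by (rule op_norm_bound[OF F_multilinear]) (use assms X_in_S in auto)
  then show ?thesis by (simp add: force_def o_def)
qed

end

subsection \<open>Summability over the trees\<close>

text \<open>Finite pieces of the set of trees on which sums factor over the children; bounding the
  root degree by \<open>N\<close> matches the truncation of F at degree \<open>N\<close>.\<close>

definition graft_level :: "nat \<Rightarrow> tree set \<Rightarrow> tree set" where
  "graft_level N G = (\<Union>r\<in>{2..N}. Node ` listset (replicate r G))"

lemma listset_replicate_iff: "bs \<in> listset (replicate r G) \<longleftrightarrow> length bs = r \<and> set bs \<subseteq> G"
  unfolding listset_iff list_all2_conv_all_nth by (auto simp: in_set_conv_nth subset_iff)

lemma graft_level_iff: "Node bs \<in> graft_level N G \<longleftrightarrow> 2 \<le> length bs \<and> length bs \<le> N \<and> set bs \<subseteq> G"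
  by (auto simp: graft_level_def listset_replicate_iff image_iff)

lemma Leaf_notin_graft_level [simp]: "Leaf \<notin> graft_level N G"
  by (auto simp: graft_level_def)

lemma finite_graft_level: "finite G \<Longrightarrow> finite (graft_level N G)"
  unfolding graft_level_def by (auto intro!: finite_listset)

lemma graft_level_Trees: "G \<subseteq> Trees \<Longrightarrow> graft_level N G \<subseteq> Trees"
  by (fastforce simp: graft_level_def listset_replicate_iff Trees_def)

lemma sum_graft_level:
  assumes "finite G"
  shows "(\<Sum>b\<in>graft_level N G. h b) = (\<Sum>r\<in>{2..N}. \<Sum>bs\<in>listset (replicate r G). h (Node bs))"
proof -
  have "(\<Sum>b\<in>graft_level N G. h b) = (\<Sum>r\<in>{2..N}. \<Sum>b\<in>Node ` listset (replicate r G). h b)"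
    unfolding graft_level_def
    by (rule sum.UNION_disjoint) (use assms in \<open>auto intro!: finite_listset simp: listset_replicate_iff\<close>)
  also have "\<dots> = (\<Sum>r\<in>{2..N}. \<Sum>bs\<in>listset (replicate r G). h (Node bs))"
    by (rule sum.cong[OF refl], subst sum.reindex) (auto intro: inj_onI)
  finally show ?thesis .
qed

lemma sum_prod_list_replicate:
  "(\<Sum>bs\<in>listset (replicate r G). prod_list (map w bs)) = (\<Sum>b\<in>G. w b :: real) ^ r"
proof (induction r)
  case (Suc r)
  have "(\<Sum>bs\<in>listset (replicate (Suc r) G). prod_list (map w bs))
     = (\<Sum>b\<in>G. \<Sum>bs\<in>listset (replicate r G). w b * prod_list (map w bs))"
    unfolding replicate_Suc sum_listset_Cons by simp
  also have "\<dots> = (\<Sum>b\<in>G. w b) * (\<Sum>b\<in>G. w b) ^ r"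
    unfolding sum_distrib_left[symmetric] sum_distrib_right[symmetric] Suc.IH ..
  finally show ?case by simp
qed simp

text \<open>\<open>H\<close> collects the children of the roots in \<open>G\<close> and
  \<open>N\<close> is the largest root degree. The last clause ensures that members of
  \<open>H\<close> have fewer internal vertices than some member of \<open>G\<close>, which drives
  the majorant induction.\<close>

lemma tree_set_in_graft_level:
  assumes "finite G" "G \<subseteq> Trees"
  obtains N H where "finite H" "H \<subseteq> Trees" "G \<subseteq> insert Leaf (graft_level N H)"
    "\<And>b. b \<in> H \<Longrightarrow> \<exists>bs. Node bs \<in> G \<and> b \<in> set bs"
proof -
  define ch where "ch b = (case b of Leaf \<Rightarrow> [] | Node bs \<Rightarrow> bs)" for b
  define H where "H = (\<Union>b\<in>G. set (ch b))"
  define N where "N = Max (insert 0 ((\<lambda>b. length (ch b)) ` G))"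
  have N: "length (ch b) \<le> N" if "b \<in> G" for b
    unfolding N_def by (rule Max_ge) (use that assms(1) in auto)
  show thesis
  proof (rule that[of H N])
    show "finite H" unfolding H_def using assms(1) by simp
    show "H \<subseteq> Trees"
      using assms(2) by (auto simp: H_def ch_def Trees_def split: tree.splits)
    show "G \<subseteq> insert Leaf (graft_level N H)"
    proof
      fix b assume b: "b \<in> G"
      show "b \<in> insert Leaf (graft_level N H)"
      proof (cases b)
        case (Node bs)
        then have "wf_tree (Node bs)" "length bs \<le> N" "set bs \<subseteq> H"
          using b assms(2) N[OF b] by (auto simp: Trees_def ch_def H_def)
        then show ?thesis by (simp add: Node graft_level_iff)
      qed simp
    qed
    show "\<exists>bs. Node bs \<in> G \<and> b \<in> set bs" if "b \<in> H" for b
      using that by (auto simp: H_def ch_def split: tree.splits)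
  qed
qed

lemma internal_child_less: "b \<in> set bs \<Longrightarrow> internal b < internal (Node bs)"
  by (simp add: less_Suc_eq_le member_le_sum_list)

text \<open>The majorant argument: the weighted sums over trees of bounded size satisfy
  \<open>S \<le> M + q (\<Sum>r. c r * S ^ r)\<close> with the right-hand side taken one size lower, so \<open>M + 1\<close> is
  an invariant bound.\<close>

lemma tree_sum_bounded:
  fixes w :: "tree \<Rightarrow> real" and c :: "nat \<Rightarrow> real"
  assumes w: "\<And>b. 0 \<le> w b" and q: "0 \<le> q" and c: "\<And>r. 2 \<le> r \<Longrightarrow> 0 \<le> c r"
    and Leaf: "w Leaf \<le> M"
    and Node: "\<And>bs. wf_tree (Node bs) \<Longrightarrow> w (Node bs) \<le> q * (c (length bs) * prod_list (map w bs))"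
    and R: "\<And>N. (\<Sum>r\<in>{2..N}. c r * (M + 1) ^ r) \<le> R" and qR: "q * R \<le> 1"
    and G: "finite G" "G \<subseteq> Trees"
  shows "(\<Sum>b\<in>G. w b) \<le> M + 1"
proof -
  have level: "(\<Sum>b\<in>graft_level N H. w b) \<le> q * (\<Sum>r\<in>{2..N}. c r * (\<Sum>b\<in>H. w b) ^ r)"
    if H: "finite H" "H \<subseteq> Trees" for N H
  proof -
    have "(\<Sum>b\<in>graft_level N H. w b) = (\<Sum>r\<in>{2..N}. \<Sum>bs\<in>listset (replicate r H). w (Node bs))"
      by (rule sum_graft_level[OF H(1)])
    also have "\<dots> \<le> (\<Sum>r\<in>{2..N}. \<Sum>bs\<in>listset (replicate r H). q * (c r * prod_list (map w bs)))"
    proof (intro sum_mono)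
      fix r bs assume "r \<in> {2..N}" "bs \<in> listset (replicate r H)"
      then show "w (Node bs) \<le> q * (c r * prod_list (map w bs))"
        using Node[of bs] H(2) by (auto simp: listset_replicate_iff Trees_def)
    qed
    also have "\<dots> = q * (\<Sum>r\<in>{2..N}. c r * (\<Sum>b\<in>H. w b) ^ r)"
      by (simp only: sum_distrib_left[symmetric] sum_prod_list_replicate)
    finally show ?thesis .
  qed
  have "(\<Sum>b\<in>G. w b) \<le> M + 1" if "finite G" "G \<subseteq> Trees" "\<forall>b\<in>G. internal b < n" for n G
    using that
  proof (induction n arbitrary: G)
    case 0
    then have "G = {}" by auto
    then show ?case using Leaf w[of Leaf] by simp
  next
    case (Suc n)
    obtain N H where H: "finite H" "H \<subseteq> Trees" "G \<subseteq> insert Leaf (graft_level N H)"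
      "\<And>b. b \<in> H \<Longrightarrow> \<exists>bs. Node bs \<in> G \<and> b \<in> set bs"
      using tree_set_in_graft_level[OF Suc.prems(1,2)] by metis
    have "internal b < n" if b: "b \<in> H" for b
    proof -
      obtain bs where "Node bs \<in> G" "b \<in> set bs" using H(4)[OF b] by blast
      then have "internal (Node bs) < Suc n" "internal b < internal (Node bs)"
        using Suc.prems(3) internal_child_less by auto
      then show ?thesis by linarith
    qed
    then have IH: "(\<Sum>b\<in>H. w b) \<le> M + 1" using Suc.IH[OF H(1,2)] by blast
    have "(\<Sum>b\<in>G. w b) \<le> (\<Sum>b\<in>insert Leaf (graft_level N H). w b)"
      by (rule sum_mono2) (use H w in \<open>auto intro: finite_graft_level\<close>)
    also have "\<dots> = w Leaf + (\<Sum>b\<in>graft_level N H. w b)"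
      by (rule sum.insert) (use H in \<open>auto intro: finite_graft_level\<close>)
    also have "\<dots> \<le> M + q * (\<Sum>r\<in>{2..N}. c r * (\<Sum>b\<in>H. w b) ^ r)"
      by (rule add_mono[OF Leaf level[OF H(1,2)]])
    also have "\<dots> \<le> M + q * (\<Sum>r\<in>{2..N}. c r * (M + 1) ^ r)"
      using IH w q c by (intro add_left_mono mult_left_mono sum_mono power_mono) (auto intro: sum_nonneg)
    also have "\<dots> \<le> M + q * R" by (intro add_left_mono mult_left_mono R q)
    also have "\<dots> \<le> M + 1" using qR by simp
    finally show ?case .
  qed
  from this[OF G, of "Suc (Max (insert 0 (internal ` G)))"] show ?thesis
    using G(1) by (simp add: less_Suc_eq_le)
qed

lemma power_internal_Node:
  fixes x :: "'a::comm_monoid_mult"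
  shows "x ^ internal (Node bs) = x * prod_list (map (\<lambda>b. x ^ internal b) bs)"
proof -
  have "x ^ sum_list (map internal bs) = prod_list (map (\<lambda>b. x ^ internal b) bs)"
    by (induction bs) (auto simp: power_add)
  then show ?thesis by simp
qed

lemma prod_list_mult_map:
  "prod_list (map (\<lambda>b. f b * g b) bs) = prod_list (map f bs) * (prod_list (map g bs) :: 'a::comm_monoid_mult)"
  by (induction bs) (auto simp: mult_ac)

text \<open>The series of (H1), evaluated at the real point \<open>z\<close> and shifted by two, has
  nonnegative terms, so its sum bounds all partial sums.\<close>

lemma H1_sum_bounded:
  assumes F: "H1 T F" and z: "0 \<le> z"
  obtains R where "0 \<le> R" "\<And>N. (\<Sum>r\<in>{2..N}. op_norm T r (F r) * z ^ r) \<le> R"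
proof -
  let ?a = "\<lambda>k. op_norm T (k+2) (F (k+2)) * z ^ (k+2)"
  have nonneg: "0 \<le> ?a k" for k
    using op_norm_nonneg[OF H1_cont_multilinear[OF F, of "k+2"]] z by simp
  have "summable (\<lambda>k. complex_of_real (op_norm T (k+2) (F (k+2))) * complex_of_real z ^ (k+2))"
    using F unfolding H1_def by blast
  then have "summable (\<lambda>k. complex_of_real (?a k))" by simp
  then have sm: "summable ?a" by (rule summable_of_real_iff[THEN iffD1])
  have "(\<Sum>r\<in>{2..N}. op_norm T r (F r) * z ^ r) \<le> suminf ?a" for N
  proof -
    have "{2..N} = (\<lambda>k. k + 2) ` {k. k + 2 \<le> N}"
    proof (intro set_eqI iffI)
      fix r assume "r \<in> {2..N}"
      then have "r = (r - 2) + 2" "(r - 2) + 2 \<le> N" by auto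
      then show "r \<in> (\<lambda>k. k + 2) ` {k. k + 2 \<le> N}" by blast
    qed auto
    then have "(\<Sum>r\<in>{2..N}. op_norm T r (F r) * z ^ r) = (\<Sum>k\<in>{k. k + 2 \<le> N}. ?a k)"
      by (simp only: sum.reindex[OF inj_onI] o_def add_right_cancel)
    also have "\<dots> \<le> suminf ?a"
      by (rule sum_le_suminf[OF sm]) (use nonneg in \<open>auto intro: finite_subset[of _ "{..N}"]\<close>)
    finally show ?thesis .
  qed
  moreover have "0 \<le> suminf ?a" by (rule suminf_nonneg[OF sm nonneg])
  ultimately show thesis using that by blast
qed

context control_family
begin

text \<open>The weight of a tree is the modulus of \<open>lam\<close> to the power |b| times
  \<open>S_norm T (X b)\<close>. The linear bound of \<open>X b\<close> by its forcing and the
  operator norm bound of the forcing combine into the recursive inequality of the majorant argument,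
  with \<open>q = \<bar>lam\<bar> * K\<close>.\<close>

lemma series_bounded:
  "\<exists>lam0>0. \<exists>C. \<forall>lam G. \<bar>lam\<bar> < lam0 \<longrightarrow> finite G \<longrightarrow> G \<subseteq> Trees \<longrightarrow>
     (\<Sum>b\<in>G. l2norm T (\<lambda>t. lam ^ (internal b - 1) *\<^sub>R force b t)) \<le> C \<and>
     (\<Sum>b\<in>G. l2norm T (\<lambda>t. lam ^ internal b *\<^sub>R v b t)) \<le> C"
proof -
  obtain K where K: "0 \<le> K" "\<And>b. wf_tree b \<Longrightarrow> S_norm T (X b) \<le> K * (norm (init b) + l2norm T (force b))"
    using X_bound by blast
  obtain D where D: "0 \<le> D" "\<And>b. wf_tree b \<Longrightarrow> l2norm T (v b) \<le> D * (norm (init b) + l2norm T (force b))"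
    using v_bound by blast
  define c where "c r = op_norm T r (F r)" for r
  have c: "0 \<le> c r" if "2 \<le> r" for r
    unfolding c_def by (rule op_norm_nonneg[OF F_multilinear[OF that]])
  define M where "M = K * norm x0"
  have M: "0 \<le> M" using K by (simp add: M_def)
  obtain R where R: "0 \<le> R" "\<And>N. (\<Sum>r\<in>{2..N}. c r * (M + 1) ^ r) \<le> R"
    using H1_sum_bounded[OF F, of "M + 1"] M unfolding c_def by auto
  \<comment> \<open>\<open>M\<close> bounds the weight of \<open>Leaf\<close> and \<open>R\<close>
    the power series at \<open>M + 1\<close>; the majorant argument asks for
    \<open>\<bar>lam\<bar> * K * R \<le> 1\<close>. The summand 1 keeps the quotient meaningful when
    \<open>K * R = 0\<close>.\<close>
  define lam0 where "lam0 = 1 / (K * R + 1)"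
  have KR: "0 \<le> K * R" using K R by simp
  then have lam0: "0 < lam0" by (simp add: lam0_def)
  have bd: "(\<Sum>b\<in>G. l2norm T (\<lambda>t. lam ^ (internal b - 1) *\<^sub>R force b t)) \<le> R"
    if lam: "\<bar>lam\<bar> < lam0" and G: "finite G" "G \<subseteq> Trees" for lam G
  proof -
    define w where "w b = \<bar>lam\<bar> ^ internal b * S_norm T (X b)" for b
    have w: "0 \<le> w b" for b by (simp add: w_def)
    have w_prod: "prod_list (map w bs) = prod_list (map (\<lambda>b. \<bar>lam\<bar> ^ internal b) bs) * prod_list (map (\<lambda>b. S_norm T (X b)) bs)" for bs
      unfolding w_def[abs_def] by (rule prod_list_mult_map)
    have force_w: "prod_list (map (\<lambda>b. \<bar>lam\<bar> ^ internal b) bs) * l2norm T (force (Node bs)) \<le> c (length bs) * prod_list (map w bs)"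
      if "wf_tree (Node bs)" for bs
    proof -
      have "0 \<le> prod_list (map (\<lambda>b. \<bar>lam\<bar> ^ internal b) bs)" by (rule prod_list_nonneg) auto
      from mult_left_mono[OF force_bound[OF that] this] show ?thesis
        unfolding w_prod c_def by (simp only: mult_ac)
    qed
    have lamKR: "\<bar>lam\<bar> * K * R \<le> 1"
    proof -
      have "\<bar>lam\<bar> * (K * R) \<le> lam0 * (K * R + 1)"
        using lam KR by (intro mult_mono) auto
      then show ?thesis using KR by (simp add: lam0_def mult.assoc)
    qed
    have wM: "(\<Sum>b\<in>H. w b) \<le> M + 1" if H: "finite H" "H \<subseteq> Trees" for H
    proof (rule tree_sum_bounded[where c=c and R=R and q="\<bar>lam\<bar> * K", OF w _ c _ _ R(2) lamKR H])
      show "0 \<le> \<bar>lam\<bar> * K" using K by simp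
      show "w Leaf \<le> M" using K(2)[of Leaf] by (simp add: w_def M_def init_def force_def)
      fix bs assume wf: "wf_tree (Node bs)"
      have "w (Node bs) \<le> \<bar>lam\<bar> ^ internal (Node bs) * (K * l2norm T (force (Node bs)))"
        unfolding w_def using K(2)[OF wf] by (intro mult_left_mono) (auto simp: init_def)
      also have "\<dots> = \<bar>lam\<bar> * K * (prod_list (map (\<lambda>b. \<bar>lam\<bar> ^ internal b) bs) * l2norm T (force (Node bs)))"
        unfolding power_internal_Node by (simp only: mult_ac)
      also have "\<dots> \<le> \<bar>lam\<bar> * K * (c (length bs) * prod_list (map w bs))"
        using K(1) by (intro mult_left_mono force_w[OF wf]) auto
      finally show "w (Node bs) \<le> \<bar>lam\<bar> * K * (c (length bs) * prod_list (map w bs))" .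
    qed
    \<comment> \<open>The forcings carry one power of \<open>lam\<close> less than the weights, so
      \<open>wM\<close> cannot be applied to \<open>G\<close> directly. It is applied to the
      children, and the roots are restored without the factor \<open>lam\<close>.\<close>
    obtain N H where H: "finite H" "H \<subseteq> Trees" "G \<subseteq> insert Leaf (graft_level N H)"
      using tree_set_in_graft_level[OF G] by metis
    let ?h = "\<lambda>b. l2norm T (\<lambda>t. lam ^ (internal b - 1) *\<^sub>R force b t)"
    have "(\<Sum>b\<in>G. ?h b) \<le> (\<Sum>b\<in>insert Leaf (graft_level N H). ?h b)"
      by (rule sum_mono2) (use H in \<open>auto intro: finite_graft_level\<close>)
    also have "\<dots> = ?h Leaf + (\<Sum>b\<in>graft_level N H. ?h b)"
      by (rule sum.insert) (use H in \<open>auto intro: finite_graft_level\<close>)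
    also have "?h Leaf = 0" by (simp add: force_def)
    also have "(\<Sum>b\<in>graft_level N H. ?h b) = (\<Sum>r\<in>{2..N}. \<Sum>bs\<in>listset (replicate r H). ?h (Node bs))"
      by (rule sum_graft_level[OF H(1)])
    also have "\<dots> \<le> (\<Sum>r\<in>{2..N}. \<Sum>bs\<in>listset (replicate r H). c r * prod_list (map w bs))"
    proof (intro sum_mono)
      fix r bs assume "r \<in> {2..N}" "bs \<in> listset (replicate r H)"
      then have wf: "wf_tree (Node bs)" and r: "length bs = r"
        using H(2) by (auto simp: listset_replicate_iff Trees_def)
      have "\<bar>lam\<bar> ^ (internal (Node bs) - 1) = prod_list (map (\<lambda>b. \<bar>lam\<bar> ^ internal b) bs)"
        by (induction bs) (auto simp: power_add)
      then show "?h (Node bs) \<le> c r * prod_list (map w bs)"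
        using force_w[OF wf] r unfolding l2norm_scaleR power_abs by simp
    qed
    also have "\<dots> = (\<Sum>r\<in>{2..N}. c r * (\<Sum>b\<in>H. w b) ^ r)"
      by (simp only: sum_distrib_left[symmetric] sum_prod_list_replicate)
    also have "\<dots> \<le> (\<Sum>r\<in>{2..N}. c r * (M + 1) ^ r)"
      using wM[OF H(1,2)] w c by (intro mult_left_mono sum_mono power_mono) (auto intro: sum_nonneg)
    also have "\<dots> \<le> R" by (rule R(2))
    finally show ?thesis by simp
  qed
  have bd': "(\<Sum>b\<in>G. l2norm T (\<lambda>t. lam ^ internal b *\<^sub>R v b t)) \<le> D * (norm x0 + lam0 * R)"
    if lam: "\<bar>lam\<bar> < lam0" and G: "finite G" "G \<subseteq> Trees" for lam G
  proof -
    let ?h = "\<lambda>b. l2norm T (\<lambda>t. lam ^ (internal b - 1) *\<^sub>R force b t)"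
    have "l2norm T (\<lambda>t. lam ^ internal b *\<^sub>R v b t) \<le> D * (norm (init b) + lam0 * ?h b)" if "b \<in> G" for b
    proof (cases b)
      case Leaf
      then show ?thesis using D(2)[of Leaf] by (simp add: force_def)
    next
      case (Node bs)
      have "wf_tree b" using that G by (auto simp: Trees_def)
      then have "l2norm T (\<lambda>t. lam ^ internal b *\<^sub>R v b t) \<le> \<bar>lam\<bar> ^ internal b * (D * l2norm T (force b))"
        unfolding l2norm_scaleR power_abs using D(2)[of b] Node
        by (intro mult_left_mono) (auto simp: init_def)
      also have "\<dots> = D * (\<bar>lam\<bar> * ?h b)"
        unfolding l2norm_scaleR power_abs Node by simp
      also have "\<dots> \<le> D * (lam0 * ?h b)"
        using lam D(1) by (intro mult_left_mono mult_right_mono) auto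
      finally show ?thesis using Node by (simp add: init_def)
    qed
    then have "(\<Sum>b\<in>G. l2norm T (\<lambda>t. lam ^ internal b *\<^sub>R v b t)) \<le> (\<Sum>b\<in>G. D * (norm (init b) + lam0 * ?h b))"
      by (rule sum_mono)
    also have "\<dots> = D * ((\<Sum>b\<in>G. norm (init b)) + lam0 * (\<Sum>b\<in>G. ?h b))"
      by (simp only: sum_distrib_left[symmetric] sum.distrib)
    \<comment> \<open>Only \<open>Leaf\<close> has a nonzero initial value, so the bound is
      independent of \<open>G\<close>.\<close>
    also have "(\<Sum>b\<in>G. norm (init b)) \<le> norm x0"
    proof -
      have "(\<Sum>b\<in>G. norm (init b)) = (\<Sum>b\<in>G \<inter> {Leaf}. norm (init b))"
        by (rule sum.mono_neutral_right) (use G in \<open>auto simp: init_def\<close>)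
      also have "\<dots> \<le> (\<Sum>b\<in>{Leaf}. norm (init b))" by (rule sum_mono2) auto
      finally show ?thesis by (simp add: init_def)
    qed
    finally show ?thesis
      using bd[OF lam G] D(1) lam0 by (smt (verit) mult_left_mono)
  qed
  have "0 \<le> D * (norm x0 + lam0 * R)" using D R lam0 by simp
  then show ?thesis
    using lam0 bd bd' R(1)
    by (intro exI[of _ lam0] conjI exI[of _ "R + D * (norm x0 + lam0 * R)"]) (auto intro: add_increasing2 add_increasing)
qed

end

subsection \<open>Summing the series\<close>

lemma L2_has_sum_tendsto:
  assumes "L2_has_sum T w I s"
  shows "((\<lambda>G. l2norm T (\<lambda>t. (\<Sum>i\<in>G. w i t) - s t)) \<longlongrightarrow> 0) (finite_subsets_at_top I)"
proof (rule tendstoI)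
  fix e :: real assume "e > 0"
  then show "\<forall>\<^sub>F G in finite_subsets_at_top I. dist (l2norm T (\<lambda>t. (\<Sum>i\<in>G. w i t) - s t)) 0 < e"
    using assms unfolding L2_has_sum_def eventually_finite_subsets_at_top by simp
qed

context control_family
begin

definition partial :: "real \<Rightarrow> tree set \<Rightarrow> real \<Rightarrow> real^'n" where
  "partial lam G t = (\<Sum>b\<in>G. lam ^ internal b *\<^sub>R X b t)"

lemma partial_in_S: "in_S T (partial lam G)"
  unfolding partial_def[abs_def] by (intro in_S_sum in_S_scaleR X_in_S)

lemma partial_final: "G \<subseteq> Trees \<Longrightarrow> partial lam G T = 0"
  unfolding partial_def by (rule sum.neutral) (auto simp: Trees_def X_final)

text \<open>A partial sum is itself a linear solution. Membership of \<open>Leaf\<close> gives it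
  the initial value \<open>x0\<close>, so the error starts at 0 and is driven by the errors of the
  two L2 series alone.\<close>

lemma partial_diff:
  assumes G: "finite G" "G \<subseteq> Trees" "Leaf \<in> G" and vs: "L2 T vs" and g: "L2 T g"
  shows "(\<lambda>t. partial lam G t - lin_sol T A x0 (\<lambda>t. B *v vs t + lam *\<^sub>R g t) t) =
    lin_sol T A 0 (\<lambda>t. B *v ((\<Sum>b\<in>G. lam ^ internal b *\<^sub>R v b t) - vs t) +
       lam *\<^sub>R ((\<Sum>b\<in>G. lam ^ (internal b - 1) *\<^sub>R force b t) - g t))"
proof -
  let ?h = "\<lambda>b t. lam ^ internal b *\<^sub>R (B *v v b t + force b t)"
  have wf: "wf_tree b" if "b \<in> G" for b using that G(2) by (auto simp: Trees_def)
  have h: "L2 T (?h b)" if "b \<in> G" for b by (rule L2_scaleR[OF rhs_L2[OF wf[OF that]]])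
  have Lh: "L2 T (\<lambda>t. \<Sum>b\<in>G. ?h b t)" by (rule L2_sum[OF h])
  have Lr: "L2 T (\<lambda>t. B *v vs t + lam *\<^sub>R g t)" by (intro L2_add L2_matrix(1) L2_scaleR vs g)
  have init: "(\<Sum>b\<in>G. lam ^ internal b *\<^sub>R init b) = x0"
  proof -
    have "(\<Sum>b\<in>G. lam ^ internal b *\<^sub>R init b) = (\<Sum>b\<in>{Leaf}. lam ^ internal b *\<^sub>R init b)"
      by (rule sum.mono_neutral_right) (use G in \<open>auto simp: init_def\<close>)
    then show ?thesis by (simp add: init_def)
  qed
  have each: "lin_sol T A (lam ^ internal b *\<^sub>R init b) (?h b) = (\<lambda>t. lam ^ internal b *\<^sub>R X b t)" if "b \<in> G" for b
    using lin_sol_lincomb[OF T0 rhs_L2[OF wf[OF that]] L2_zero, of A "lam ^ internal b" "init b" 0 0]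
    unfolding X_eq[OF wf[OF that]] by simp
  have "partial lam G = (\<lambda>t. \<Sum>b\<in>G. lin_sol T A (lam ^ internal b *\<^sub>R init b) (?h b) t)"
    unfolding partial_def[abs_def] by (rule ext, rule sum.cong) (simp_all add: each)
  also have "\<dots> = lin_sol T A x0 (\<lambda>t. \<Sum>b\<in>G. ?h b t)"
    using lin_sol_sum[where I=G and M=A and x="\<lambda>b. lam ^ internal b *\<^sub>R init b" and f="?h", OF T0 h] init by simp
  finally have "(\<lambda>t. 1 *\<^sub>R partial lam G t + (-1) *\<^sub>R lin_sol T A x0 (\<lambda>t. B *v vs t + lam *\<^sub>R g t) t) =
     lin_sol T A (1 *\<^sub>R x0 + (-1) *\<^sub>R x0) (\<lambda>t. 1 *\<^sub>R (\<Sum>b\<in>G. ?h b t) + (-1) *\<^sub>R (B *v vs t + lam *\<^sub>R g t))"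
    using lin_sol_lincomb[OF T0 Lh Lr, of A 1 x0 "-1" x0] by simp
  moreover have "1 *\<^sub>R (\<Sum>b\<in>G. ?h b t) + (-1) *\<^sub>R (B *v vs t + lam *\<^sub>R g t) =
      B *v ((\<Sum>b\<in>G. lam ^ internal b *\<^sub>R v b t) - vs t) +
       lam *\<^sub>R ((\<Sum>b\<in>G. lam ^ (internal b - 1) *\<^sub>R force b t) - g t)" for t
  proof -
    \<comment> \<open>At \<open>Leaf\<close> the powers of \<open>lam\<close> differ, but the force
      is 0 there.\<close>
    have f: "lam ^ internal b *\<^sub>R force b t = lam *\<^sub>R lam ^ (internal b - 1) *\<^sub>R force b t" for b
      by (cases b) (simp_all add: force_def)
    have "(\<Sum>b\<in>G. ?h b t) = B *v (\<Sum>b\<in>G. lam ^ internal b *\<^sub>R v b t) +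
       lam *\<^sub>R (\<Sum>b\<in>G. lam ^ (internal b - 1) *\<^sub>R force b t)"
      unfolding linear_sum[OF matrix_vector_mul_linear] scaleR_sum_right sum.distrib[symmetric]
      by (rule sum.cong[OF refl]) (simp add: scaleR_add_right matrix_vector_mult_scaleR f)
    then show ?thesis
      by (simp add: matrix_vector_mult_diff_distrib scaleR_diff_right)
  qed
  ultimately show ?thesis by simp
qed

text \<open>Choosing one tree of \<open>G\<close> for each of the \<open>p\<close> slots is the same
  as choosing a tree with \<open>p\<close> children in \<open>G\<close>; the powers of
  \<open>lam\<close> of the children multiply to the exponent |b| - 1.\<close>

lemma F_partial:
  assumes G: "finite G" "G \<subseteq> Trees"
  shows "ae_eq T (\<lambda>t. \<Sum>p\<in>{2..N}. F p (replicate p (partial lam G)) t)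
     (\<lambda>t. \<Sum>b\<in>graft_level N G. lam ^ (internal b - 1) *\<^sub>R force b t)"
  unfolding sum_graft_level[OF G(1)]
proof (rule ae_eq_sum)
  fix p assume "p \<in> {2..N}"
  then have p: "2 \<le> p" by simp
  let ?Y = "\<lambda>b t. lam ^ internal b *\<^sub>R X b t"
  have "ae_eq T (F p (map (\<lambda>I t. \<Sum>b\<in>I. ?Y b t) (replicate p G))) (\<lambda>t. \<Sum>bs\<in>listset (replicate p G). F p (map ?Y bs) t)"
    by (rule cont_multilinear_expand[OF F_multilinear[OF p]]) (auto intro: in_S_scaleR X_in_S)
  also have "map (\<lambda>I t. \<Sum>b\<in>I. ?Y b t) (replicate p G) = replicate p (partial lam G)"
    by (simp add: partial_def[abs_def])
  finally have 1: "ae_eq T (F p (replicate p (partial lam G))) (\<lambda>t. \<Sum>bs\<in>listset (replicate p G). F p (map ?Y bs) t)" .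
  have 2: "ae_eq T (\<lambda>t. \<Sum>bs\<in>listset (replicate p G). F p (map ?Y bs) t)
      (\<lambda>t. \<Sum>bs\<in>listset (replicate p G). lam ^ (internal (Node bs) - 1) *\<^sub>R force (Node bs) t)"
  proof (rule ae_eq_sum)
    fix bs assume "bs \<in> listset (replicate p G)"
    then have len: "length bs = p" by (simp add: listset_replicate_iff)
    have "ae_eq T (F p (map ?Y bs)) (\<lambda>t. prod_list (map (\<lambda>b. lam ^ internal b) bs) *\<^sub>R F p (map X bs) t)"
      by (rule cont_multilinear_scale[OF F_multilinear[OF p] len X_in_S])
    moreover have "prod_list (map (\<lambda>b. lam ^ internal b) bs) = lam ^ (internal (Node bs) - 1)"
      by (induction bs) (auto simp: power_add)
    ultimately show "ae_eq T (F p (map ?Y bs)) (\<lambda>t. lam ^ (internal (Node bs) - 1) *\<^sub>R force (Node bs) t)"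
      by (simp add: force_def len)
  qed
  show "ae_eq T (F p (replicate p (partial lam G)))
      (\<lambda>t. \<Sum>bs\<in>listset (replicate p G). lam ^ (internal (Node bs) - 1) *\<^sub>R force (Node bs) t)"
    by (rule ae_eq_trans[OF 1 2])
qed

text \<open>By \<open>partial_diff\<close> the partial sums tend to \<open>x\<close> at time
  \<open>T\<close> and in the norm of S. They vanish at \<open>T\<close>, and each
  \<open>F p\<close> is continuous; the final value and F(x) follow from these two facts.\<close>

lemma series_solution:
  assumes vs: "L2_has_sum T (\<lambda>b t. lam ^ internal b *\<^sub>R v b t) Trees vs"
    and g: "L2_has_sum T (\<lambda>b t. lam ^ (internal b - 1) *\<^sub>R force b t) Trees g"
  defines "x \<equiv> lin_sol T A x0 (\<lambda>t. B *v vs t + lam *\<^sub>R g t)"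
  shows "x T = 0" and "L2_series_sum_from2 T (\<lambda>p. F p (replicate p x)) g"
proof -
  let ?F = "finite_subsets_at_top Trees"
  let ?vG = "\<lambda>G t. (\<Sum>b\<in>G. lam ^ internal b *\<^sub>R v b t) - vs t"
  let ?gG = "\<lambda>G t. (\<Sum>b\<in>G. lam ^ (internal b - 1) *\<^sub>R force b t) - g t"
  have Lvs: "L2 T vs" and Lg: "L2 T g" using vs g by (simp_all add: L2_has_sum_def)
  have LvG: "L2 T (?vG G)" and LgG: "L2 T (?gG G)" if "G \<subseteq> Trees" for G
    using that by (auto intro!: L2_diff L2_sum L2_scaleR Lvs Lg v_L2 force_L2 simp: Trees_def)
  have xS: "in_S T x" unfolding x_def by (intro lin_sol_in_S T0 L2_add L2_matrix(1) L2_scaleR Lvs Lg)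
  obtain K where K: "0 \<le> K"
    "\<And>x0 f t. L2 T f \<Longrightarrow> t \<in> {0..T} \<Longrightarrow> norm (lin_sol T A x0 f t) \<le> K * (norm x0 + l2norm T f)"
    "\<And>x0 f. L2 T f \<Longrightarrow> S_norm T (lin_sol T A x0 f) \<le> K * (norm x0 + l2norm T f)"
    using lin_sol_bound[OF T0, of A] by metis
  \<comment> \<open>A common bound for both distances between \<open>partial lam G\<close> and
    \<open>x\<close>, tending to 0 along the finite sets of trees.\<close>
  define E where "E G = K * (onorm ((*v) B) * l2norm T (?vG G) + \<bar>lam\<bar> * l2norm T (?gG G))" for G
  have "(E \<longlongrightarrow> K * (onorm ((*v) B) * 0 + \<bar>lam\<bar> * 0)) ?F"
    unfolding E_def[abs_def] by (intro tendsto_intros L2_has_sum_tendsto vs g)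
  then have E: "(E \<longlongrightarrow> 0) ?F" by simp
  have ev: "\<forall>\<^sub>F G in ?F. finite G \<and> G \<subseteq> Trees \<and> Leaf \<in> G"
    unfolding eventually_finite_subsets_at_top by (intro exI[of _ "{Leaf}"]) (auto simp: Trees_def)
  have est: "norm (partial lam G T - x T) \<le> E G \<and> S_norm T (\<lambda>t. partial lam G t - x t) \<le> E G"
    if G: "finite G \<and> G \<subseteq> Trees \<and> Leaf \<in> G" for G
  proof -
    let ?f = "\<lambda>t. B *v ?vG G t + lam *\<^sub>R ?gG G t"
    have LB: "L2 T (\<lambda>t. B *v ?vG G t)" and Ll: "L2 T (\<lambda>t. lam *\<^sub>R ?gG G t)"
      using G LvG LgG by (auto intro: L2_matrix(1) L2_scaleR)
    have Lf: "L2 T ?f" by (rule L2_add[OF LB Ll])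
    have "l2norm T ?f \<le> onorm ((*v) B) * l2norm T (?vG G) + \<bar>lam\<bar> * l2norm T (?gG G)"
      using l2norm_triangle[OF LB Ll] L2_matrix(2)[OF LvG, of G B] G unfolding l2norm_scaleR by linarith
    then have "K * (norm (0::real^'n) + l2norm T ?f) \<le> E G"
      unfolding E_def using K(1) by (intro mult_left_mono) simp_all
    moreover have d: "(\<lambda>t. partial lam G t - x t) = lin_sol T A 0 ?f"
      unfolding x_def using G by (intro partial_diff Lvs Lg) auto
    ultimately show ?thesis
      using K(2)[OF Lf, of T 0] K(3)[OF Lf, of 0] T0 fun_cong[OF d, of T] unfolding d by auto
  qed
  have "norm (x T) \<le> 0"
  proof (rule tendsto_lowerbound[OF E])
    show "\<forall>\<^sub>F G in ?F. norm (x T) \<le> E G"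
      using ev by eventually_elim (use est partial_final in force)
  qed simp
  then show "x T = 0" by simp
  have S: "((\<lambda>G. S_norm T (\<lambda>t. partial lam G t - x t)) \<longlongrightarrow> 0) ?F"
  proof (rule tendsto_sandwich[OF _ _ tendsto_const E])
    show "\<forall>\<^sub>F G in ?F. S_norm T (\<lambda>t. partial lam G t - x t) \<le> E G"
      using ev by eventually_elim (use est in blast)
  qed simp
  let ?Fx = "\<lambda>p. F p (replicate p x)" and ?FG = "\<lambda>p G. F p (replicate p (partial lam G))"
  have LFx: "L2 T (?Fx p)" and LFG: "L2 T (?FG p G)" if "2 \<le> p" for p G
    using cont_multilinear_L2[OF F_multilinear[OF that]] xS partial_in_S by auto
  have FG: "((\<lambda>G. l2norm T (\<lambda>t. ?FG p G t - ?Fx p t)) \<longlongrightarrow> 0) ?F" if p: "2 \<le> p" for p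
  proof (rule tendstoI)
    fix e :: real assume e: "e > 0"
    obtain d where d: "d > 0" "\<And>ys. length ys = p \<Longrightarrow> \<forall>y\<in>set ys. in_S T y \<Longrightarrow>
        \<forall>i<p. S_norm T (\<lambda>t. (ys!i) t - (replicate p x!i) t) < d \<Longrightarrow>
        l2norm T (\<lambda>t. F p ys t - ?Fx p t) < e"
      using cont_multilinear_continuous[OF F_multilinear[OF p], of "replicate p x" e] xS e by auto
    have "\<forall>\<^sub>F G in ?F. S_norm T (\<lambda>t. partial lam G t - x t) < d"
      using order_tendstoD(2)[OF S d(1)] .
    then show "\<forall>\<^sub>F G in ?F. dist (l2norm T (\<lambda>t. ?FG p G t - ?Fx p t)) 0 < e"
    proof eventually_elim
      case (elim G)
      then have "l2norm T (\<lambda>t. ?FG p G t - ?Fx p t) < e"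
        by (intro d(2)) (auto simp: partial_in_S)
      then show ?case by simp
    qed
  qed
  show "L2_series_sum_from2 T ?Fx g"
    unfolding L2_series_sum_from2_def
  proof (intro conjI Lg LIMSEQ_I)
    fix e :: real assume e: "e > 0"
    then have "e / 2 > 0" by simp
    from g[unfolded L2_has_sum_def, THEN conjunct2, rule_format, OF this]
    obtain G0 where G0: "finite G0" "G0 \<subseteq> Trees"
      "\<forall>G. finite G \<and> G0 \<subseteq> G \<and> G \<subseteq> Trees \<longrightarrow> l2norm T (?gG G) < e / 2"
      by blast
    \<comment> \<open>For \<open>N \<ge> N0\<close> and any \<open>G\<close> containing
      \<open>H\<close>, the trees with at most \<open>N\<close> children, all in \<open>G\<close>,
      include those of \<open>G0\<close> up to \<open>Leaf\<close>. So the estimate for sets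
      containing \<open>G0\<close> applies to them.\<close>
    obtain N0 H where H: "finite H" "H \<subseteq> Trees" "G0 \<subseteq> insert Leaf (graft_level N0 H)"
      using tree_set_in_graft_level[OF G0(1,2)] by metis
    have "l2norm T (\<lambda>t. (\<Sum>p\<in>{2..N}. ?Fx p t) - g t) < e" if N: "N \<ge> N0" for N
    proof -
      \<comment> \<open>\<open>N\<close> is fixed here, so only finitely many degrees are compared,
        and \<open>G1\<close> may depend on \<open>N\<close>.\<close>
      have "((\<lambda>G. \<Sum>p\<in>{2..N}. l2norm T (\<lambda>t. ?FG p G t - ?Fx p t)) \<longlongrightarrow> (\<Sum>p\<in>{2..N}. 0)) ?F"
        by (rule tendsto_sum) (simp add: FG)
      then have "\<forall>\<^sub>F G in ?F. (\<Sum>p\<in>{2..N}. l2norm T (\<lambda>t. ?FG p G t - ?Fx p t)) < e / 2"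
        by (rule order_tendstoD(2)) (use e in simp)
      then obtain G1 where G1: "finite G1" "G1 \<subseteq> Trees" "\<forall>G. finite G \<and> G1 \<subseteq> G \<and> G \<subseteq> Trees \<longrightarrow>
          (\<Sum>p\<in>{2..N}. l2norm T (\<lambda>t. ?FG p G t - ?Fx p t)) < e / 2"
        unfolding eventually_finite_subsets_at_top by (elim exE conjE)
      define G where "G = G1 \<union> H"
      have G: "finite G" "G \<subseteq> Trees" using G1 H by (auto simp: G_def)
      have sumG: "(\<Sum>p\<in>{2..N}. l2norm T (\<lambda>t. ?FG p G t - ?Fx p t)) < e / 2"
        by (rule G1(3)[rule_format]) (use G in \<open>auto simp: G_def\<close>)
      have "graft_level N0 H \<subseteq> graft_level N G"
        unfolding graft_level_def using N by (intro UN_mono image_mono) (auto simp: listset_replicate_iff G_def)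
      then have "l2norm T (?gG (insert Leaf (graft_level N G))) < e / 2"
        using G H(3) graft_level_Trees[OF G(2)] by (intro G0(3)[rule_format]) (auto simp: finite_graft_level Trees_def)
      \<comment> \<open>\<open>Leaf\<close> is needed to cover \<open>G0\<close> but has zero force,
        so it drops out again.\<close>
      also have "?gG (insert Leaf (graft_level N G)) = ?gG (graft_level N G)"
        using finite_graft_level[OF G(1)] by (simp add: force_def)
      finally have tail: "l2norm T (?gG (graft_level N G)) < e / 2" .
      have LG: "L2 T (\<lambda>t. \<Sum>p\<in>{2..N}. ?FG p G t)" and Lx: "L2 T (\<lambda>t. \<Sum>p\<in>{2..N}. ?Fx p t)"
        by (intro L2_sum LFG LFx; simp)+
      have "l2norm T (\<lambda>t. (\<Sum>p\<in>{2..N}. ?FG p G t) - g t) = l2norm T (?gG (graft_level N G))"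
        by (rule l2norm_cong_AE[OF L2_diff[OF LG Lg] LgG[OF graft_level_Trees[OF G(2)]]])
           (use F_partial[OF G] in \<open>auto simp: ae_eq_def elim: eventually_mono\<close>)
      then have a: "l2norm T (\<lambda>t. (\<Sum>p\<in>{2..N}. ?FG p G t) - g t) < e / 2" using tail by simp
      have "l2norm T (\<lambda>t. (\<Sum>p\<in>{2..N}. ?FG p G t) - (\<Sum>p\<in>{2..N}. ?Fx p t))
          = l2norm T (\<lambda>t. \<Sum>p\<in>{2..N}. ?FG p G t - ?Fx p t)"
        by (simp only: sum_subtractf)
      also have "\<dots> \<le> (\<Sum>p\<in>{2..N}. l2norm T (\<lambda>t. ?FG p G t - ?Fx p t))"
        by (rule l2norm_sum_le) (intro L2_diff LFG LFx; simp)
      also have "\<dots> < e / 2" by (rule sumG)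
      finally have "l2norm T (\<lambda>t. (\<Sum>p\<in>{2..N}. ?Fx p t) - (\<Sum>p\<in>{2..N}. ?FG p G t)) < e / 2"
        by (subst l2norm_minus_commute)
      with l2norm_triangle_diff[OF Lx LG Lg] a show ?thesis by linarith
    qed
    then show "\<exists>N0. \<forall>N\<ge>N0. norm (l2norm T (\<lambda>t. (\<Sum>p\<in>{2..N}. ?Fx p t) - g t) - 0) < e"
      by (intro exI[of _ N0]) simp
  qed
qed

end

theorem mainTheorem9:
  fixes T :: real and A :: "real^'n^'n" and B :: "real^'m^'n"
    and F :: "nat \<Rightarrow> (real \<Rightarrow> real^'n) list \<Rightarrow> real \<Rightarrow> real^'n"
    and x0 :: "real^'n" and v :: "tree \<Rightarrow> real \<Rightarrow> real^'m"
  assumes "T > 0"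
    and "H1 T F"
    and "kalman_rank A B = CARD('n)"
    and "constructed_family T A B F x0 v"
  shows "\<exists>lam0>0. \<forall>lam::real. \<bar>lam\<bar> < lam0 \<longrightarrow>
     (\<exists>vs. L2_has_sum T (\<lambda>b t. lam ^ internal b *\<^sub>R v b t) Trees vs \<and>
        (\<exists>x. in_S T x \<and>
           (\<exists>Fx. L2_series_sum_from2 T (\<lambda>p. F p (replicate p x)) Fx \<and>
              (\<forall>t\<in>{0..T}. x t = x0 + (LINT s|lebesgue_on {0..t}. A *v x s + B *v vs s + lam *\<^sub>R Fx s))) \<and>
           x T = 0))"
proof -
  interpret control_family T A B F x0 v
    using assms by unfold_locales
  obtain lam0 C where lam0: "0 < lam0"
    and bd: "\<forall>lam G. \<bar>lam\<bar> < lam0 \<longrightarrow> finite G \<longrightarrow> G \<subseteq> Trees \<longrightarrow>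
      (\<Sum>b\<in>G. l2norm T (\<lambda>t. lam ^ (internal b - 1) *\<^sub>R force b t)) \<le> C \<and>
      (\<Sum>b\<in>G. l2norm T (\<lambda>t. lam ^ internal b *\<^sub>R v b t)) \<le> C"
    using series_bounded by blast
  have "\<exists>vs. L2_has_sum T (\<lambda>b t. lam ^ internal b *\<^sub>R v b t) Trees vs \<and>
        (\<exists>x. in_S T x \<and>
           (\<exists>Fx. L2_series_sum_from2 T (\<lambda>p. F p (replicate p x)) Fx \<and>
              (\<forall>t\<in>{0..T}. x t = x0 + (LINT s|lebesgue_on {0..t}. A *v x s + B *v vs s + lam *\<^sub>R Fx s))) \<and>
           x T = 0)" if lam: "\<bar>lam\<bar> < lam0" for lam
  proof -
    have Lv: "L2 T (\<lambda>t. lam ^ internal b *\<^sub>R v b t)"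
      and Lf: "L2 T (\<lambda>t. lam ^ (internal b - 1) *\<^sub>R force b t)" if "b \<in> Trees" for b
      using that by (auto simp: Trees_def intro: L2_scaleR v_L2 force_L2)
    have fC: "(\<Sum>b\<in>G. l2norm T (\<lambda>t. lam ^ (internal b - 1) *\<^sub>R force b t)) \<le> C"
      and vC: "(\<Sum>b\<in>G. l2norm T (\<lambda>t. lam ^ internal b *\<^sub>R v b t)) \<le> C"
      if "finite G" "G \<subseteq> Trees" for G
      using bd lam that by blast+
    obtain vs where vs: "L2_has_sum T (\<lambda>b t. lam ^ internal b *\<^sub>R v b t) Trees vs"
      using L2_has_sum_complete[OF T0 Lv vC] by blast
    obtain g where g: "L2_has_sum T (\<lambda>b t. lam ^ (internal b - 1) *\<^sub>R force b t) Trees g"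
      using L2_has_sum_complete[OF T0 Lf fC] by blast
    \<comment> \<open>With \<open>g\<close> as the witness for \<open>Fx\<close>, the nonlinear
      equation is the linear one that \<open>x\<close> solves by definition.\<close>
    define x where "x = lin_sol T A x0 (\<lambda>t. B *v vs t + lam *\<^sub>R g t)"
    have L: "L2 T (\<lambda>t. B *v vs t + lam *\<^sub>R g t)"
      using vs g by (auto simp: L2_has_sum_def intro: L2_add L2_matrix(1) L2_scaleR)
    have "solves T A x0 (\<lambda>t. B *v vs t + lam *\<^sub>R g t) x"
      unfolding x_def by (rule lin_sol_props(1)[OF T0 L])
    then have "\<forall>t\<in>{0..T}. x t = x0 + (LINT s|lebesgue_on {0..t}. A *v x s + B *v vs s + lam *\<^sub>R g s)"
      unfolding solves_iff_LINT[OF L] add.assoc by blast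
    moreover have "in_S T x" unfolding x_def by (rule lin_sol_in_S[OF T0 L])
    moreover have "x T = 0" "L2_series_sum_from2 T (\<lambda>p. F p (replicate p x)) g"
      unfolding x_def by (rule series_solution[OF vs g])+
    ultimately show ?thesis using vs by blast
  qed
  with lam0 show ?thesis by blast
qed

end
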